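(* Assume that $g_{n,0}[\bar M]$ satisfies condition $(P_g)$ for some $\bar M\in\mathbb{R}$. Denote $P_0=(\bar M_0,\bar M_1]$ if $P_0$ is bounded from above, and $P_0=(\bar M_0,+\infty)$ otherwise. Then the two following properties are fulfilled: (i) Suppose that $P_l\neq\emptyset$ for some fixed $l\in\{1,\ldots,n-1\}$ and that there is $M_1\in P_l$ such that $M_1>\bar M_0$. Then $\inf(P_l)=\inf(P_0)=\bar M_0$. Moreover, the function $\frac{\partial^l}{\partial t^l}g_{n,0}[M](t,s)$ is nonincreasing with respect to $M\in(\bar M_0,\min\{\sup(P_0),\sup(P_l)\}]$ (if both suprema are equal to $+\infty$ this interval is open at the right extreme). (ii) Suppose that $N_l\neq\emptyset$ for some fixed $l\in\{1,\ldots,n-1\}$ and that there is $M_1\in N_l$ such that $M_1>\bar M_0$. Then $\inf(N_l)=\inf(P_0)=\bar M_0$. Moreover, the function $\frac{\partial^l}{\partial t^l}g_{n,0}[M](t,s)$ is nondecreasing with respect to $M\in(\bar M_0,\min\{\sup(P_0),\sup(N_l)\}]$ (if both suprema are equal to $+\infty$ this interval is open at the right extreme).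
   Context: Let $I=[a,b]$, $M\in\mathbb{R}$. Problem $(P_{n,0}^M)$ is: find $u\in C^n(I)$ with $T_{n,0}[M]u(t)=\sigma(t)$, $t\in I$, and $B_i(u)=0$, $i=1,\ldots,n$, where $T_{n,0}[M]u(t)=u^{(n)}(t)+a_1(t)u^{(n-1)}(t)+\cdots+a_n(t)u(t)+M\,u(t)$, $B_i(u)=\sum_{j=0}^{n-1}\bigl(\alpha^i_ju^{(j)}(a)+\beta^i_ju^{(j)}(b)\bigr)$, with real constants $\alpha^i_j,\beta^i_j$ and $\sigma,a_1,\ldots,a_n\in C(I)$. "$(P_{n,0}^M)$ has a unique solution" means that it has exactly one solution for every $\sigma\in C(I)$. The Green's function of $(P_{n,0}^M)$ is $g_{n,0}[M]\in C^{n-2}(I\times I)\cap C^n((I\times I)\setminus\{(t,t):t\in I\})$ which is, for each fixed $s\in(a,b)$, the unique solution of $T_{n,0}[M](g_{n,0}[M](t,s))=0$ for $t\in I\setminus\{s\}$, $B_i(g_{n,0}[M](\cdot,s))=0$, $i=1,\ldots,n$, and which satisfies: for each $t\in(a,b)$ the following lateral limits exist, are finite, and fulfil, with $h=\frac{\partial^{n-1}}{\partial t^{n-1}}g_{n,0}[M]$, $h(t^-,t)=h(t,t^+)$, $h(t,t^-)=h(t^+,t)$ and $h(t^+,t)-h(t^-,t)=h(t,t^-)-h(t,t^+)=1$, where $h(t^{\pm},t)=\lim_{r\to t^\pm}h(r,t)$ and $h(t,t^\pm)=\lim_{r\to t^\pm}h(t,r)$. If $(P_{n,0}^M)$ has a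 unique solution, that solution is $u(t)=\int_a^b g_{n,0}[M](t,s)\sigma(s)\,ds$. Condition $(P_g)$ for $g_{n,0}[M]$: there are a continuous function $\phi$ with $\phi(t)>0$ for all $t\in(a,b)$, and $k_1,k_2\in L^1(I)$ with $0<k_1(s)<k_2(s)$ for a.e. $s\in I$, such that $\phi(t)k_1(s)\le g_{n,0}[M](t,s)\le\phi(t)k_2(s)$ for a.e. $(t,s)\in I\times I$. For $l\in\{0,\ldots,n-1\}$, $P_l=\{M\in\mathbb{R}:\frac{\partial^l}{\partial t^l}g_{n,0}[M](t,s)\ge0\ \forall(t,s)\in I\times I\}$ and $N_l=\{M\in\mathbb{R}:\frac{\partial^l}{\partial t^l}g_{n,0}[M](t,s)\le0\ \forall(t,s)\in I\times I\}$, where only values of $M$ for which $g_{n,0}[M]$ exists are considered, and derivatives of order $n-1$ are considered off the diagonal. A previously known result, used in the notation of the claim: if $(P_{n,0}^{\bar M})$ has a unique solution and $g_{n,0}[\bar M]$ satisfies $(P_g)$, and $P_0$ is bounded from above, then $P_0=(\bar M-\lambda_1,\bar M-\bar\mu]$, where $\lambda_1>0$ is the smallest positive eigenvalue of $(P_{n,0}^{\bar M})$ (i.e. the smallest $\lambda>0$ such that $T_{n,0}[\bar M]u=\lambda u$, $B_i(u)=0$, $i=1,\ldots,n$, has a nontrivial solution) and $\bar\mu\le0$. *)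

theory Defs
  imports "HOL-Analysis.Analysis"
begin

text \<open>Functions are only relevant on the interval \<open>S = [a,b]\<close>, so all derivatives are taken
  within \<open>S\<close> (one-sided at the end points). At a point \<open>t\<close> of a relatively open
  \<open>U \<subseteq> S\<close>, the value \<open>nderiv S k u t\<close> depends only on \<open>u\<close> near \<open>t\<close>, so the same
  derivative also serves for functions that are smooth on \<open>U\<close> only, e.g. on \<open>[a,b] - {s}\<close>.\<close>

primrec nderiv :: "real set \<Rightarrow> nat \<Rightarrow> (real \<Rightarrow> real) \<Rightarrow> real \<Rightarrow> real" where
  "nderiv S 0 u = u"
| "nderiv S (Suc k) u = (\<lambda>t. vector_derivative (nderiv S k u) (at t within S))"

definition C_on :: "real set \<Rightarrow> nat \<Rightarrow> real set \<Rightarrow> (real \<Rightarrow> real) \<Rightarrow> bool" where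
  "C_on S k U u \<longleftrightarrow>
     (\<forall>j<k. \<forall>t\<in>U. nderiv S j u differentiable (at t within S)) \<and>
     (\<forall>j\<le>k. continuous_on U (nderiv S j u))"

definition dt :: "real set \<Rightarrow> nat \<Rightarrow> (real \<Rightarrow> real \<Rightarrow> real) \<Rightarrow> real \<Rightarrow> real \<Rightarrow> real" where
  "dt S k g t s = nderiv S k (\<lambda>r. g r s) t"

text \<open>\<open>C^k\<close> for kernels on a relatively open \<open>W \<subseteq> S \<times> S\<close> is meant with respect to the first
  variable: the derivatives in \<open>t\<close> up to order \<open>k\<close> exist and are jointly continuous in \<open>(t,s)\<close>.
  Existence of derivatives in \<open>s\<close> cannot be demanded, as Green's functions of operators whose
  coefficients are merely continuous are in general not smooth in \<open>s\<close>.\<close>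

definition kernel_C_on ::
    "real set \<Rightarrow> nat \<Rightarrow> (real \<times> real) set \<Rightarrow> (real \<Rightarrow> real \<Rightarrow> real) \<Rightarrow> bool" where
  "kernel_C_on S k W g \<longleftrightarrow>
     (\<forall>j<k. \<forall>(t, s)\<in>W. (\<lambda>r. dt S j g r s) differentiable (at t within S)) \<and>
     (\<forall>j\<le>k. continuous_on W (\<lambda>(t, s). dt S j g t s))"

text \<open>The data of the family of problems: \<open>coef p k\<close> is used for \<open>k \<in> {1..n}\<close>,
  \<open>bl p i j\<close> and \<open>br p i j\<close> (the constants \<open>\<alpha>\<^sup>i\<^sub>j\<close>, \<open>\<beta>\<^sup>i\<^sub>j\<close>) for
  \<open>i \<in> {1..n}\<close>, \<open>j \<in> {0..<n}\<close>, where \<open>n = dim_ord p\<close>.\<close>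

record bvp =
  dim_ord :: nat
  lend :: real
  rend :: real
  coef :: "nat \<Rightarrow> real \<Rightarrow> real"
  bl :: "nat \<Rightarrow> nat \<Rightarrow> real"
  br :: "nat \<Rightarrow> nat \<Rightarrow> real"

definition intv :: "bvp \<Rightarrow> real set" where
  "intv p = {lend p..rend p}"

definition T_op :: "bvp \<Rightarrow> real \<Rightarrow> (real \<Rightarrow> real) \<Rightarrow> real \<Rightarrow> real" where
  "T_op p M u t =
     nderiv (intv p) (dim_ord p) u t
     + (\<Sum>k=1..dim_ord p. coef p k t * nderiv (intv p) (dim_ord p - k) u t)
     + M * u t"

definition B_op :: "bvp \<Rightarrow> nat \<Rightarrow> (real \<Rightarrow> real) \<Rightarrow> real" where
  "B_op p i u =
     (\<Sum>j<dim_ord p. bl p i j * nderiv (intv p) j u (lend p)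
                     + br p i j * nderiv (intv p) j u (rend p))"

text \<open>The problem whose unique solution is the section \<open>g(\<cdot>,s)\<close> of the Green's function. Without
  the unit jump of the derivative of order \<open>n - 1\<close> the zero function would be a solution.\<close>

definition green_section :: "bvp \<Rightarrow> real \<Rightarrow> real \<Rightarrow> (real \<Rightarrow> real) \<Rightarrow> bool" where
  "green_section p M s v \<longleftrightarrow>
     C_on (intv p) (dim_ord p - 2) (intv p) v \<and>
     C_on (intv p) (dim_ord p) (intv p - {s}) v \<and>
     (\<forall>t\<in>intv p - {s}. T_op p M v t = 0) \<and>
     (\<forall>i\<in>{1..dim_ord p}. B_op p i v = 0) \<and>
     (\<exists>hp hm. (nderiv (intv p) (dim_ord p - 1) v \<longlongrightarrow> hp) (at_right s) \<and>
              (nderiv (intv p) (dim_ord p - 1) v \<longlongrightarrow> hm) (at_left s) \<and>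
              hp - hm = 1)"

text \<open>In the last clause \<open>hp = h(t\<^sup>+,t) = h(t,t\<^sup>-)\<close> and
  \<open>hm = h(t\<^sup>-,t) = h(t,t\<^sup>+)\<close>.\<close>

definition is_green :: "bvp \<Rightarrow> real \<Rightarrow> (real \<Rightarrow> real \<Rightarrow> real) \<Rightarrow> bool" where
  "is_green p M g \<longleftrightarrow>
     kernel_C_on (intv p) (dim_ord p - 2) (intv p \<times> intv p) g \<and>
     kernel_C_on (intv p) (dim_ord p) (intv p \<times> intv p - Id) g \<and>
     (\<forall>s\<in>{lend p<..<rend p}.
        green_section p M s (\<lambda>t. g t s) \<and>
        (\<forall>v. green_section p M s v \<longrightarrow> (\<forall>t\<in>intv p. v t = g t s))) \<and>
     (\<forall>t\<in>{lend p<..<rend p}.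
        let h = dt (intv p) (dim_ord p - 1) g in
        \<exists>hp hm. ((\<lambda>r. h r t) \<longlongrightarrow> hp) (at_right t) \<and> ((\<lambda>r. h t r) \<longlongrightarrow> hp) (at_left t) \<and>
                ((\<lambda>r. h r t) \<longlongrightarrow> hm) (at_left t) \<and> ((\<lambda>r. h t r) \<longlongrightarrow> hm) (at_right t) \<and>
                hp - hm = 1)"

definition green_exists :: "bvp \<Rightarrow> real \<Rightarrow> bool" where
  "green_exists p M \<longleftrightarrow> (\<exists>g. is_green p M g)"

text \<open>Any two kernels satisfying \<open>is_green p M\<close> agree on \<open>[a,b] \<times> [a,b]\<close> (for \<open>n \<ge> 2\<close>); the
  choice only concerns the irrelevant values outside this square.\<close>

definition green :: "bvp \<Rightarrow> real \<Rightarrow> real \<Rightarrow> real \<Rightarrow> real" where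
  "green p M = (SOME g. is_green p M g)"

definition cond_Pg :: "bvp \<Rightarrow> (real \<Rightarrow> real \<Rightarrow> real) \<Rightarrow> bool" where
  "cond_Pg p g \<longleftrightarrow>
     (\<exists>\<phi> k1 k2.
        continuous_on (intv p) \<phi> \<and> (\<forall>t\<in>{lend p<..<rend p}. \<phi> t > 0) \<and>
        k1 absolutely_integrable_on intv p \<and> k2 absolutely_integrable_on intv p \<and>
        (AE s in lebesgue. s \<in> intv p \<longrightarrow> 0 < k1 s \<and> k1 s < k2 s) \<and>
        (AE (t, s) in lebesgue. (t, s) \<in> intv p \<times> intv p \<longrightarrow>
            \<phi> t * k1 s \<le> g t s \<and> g t s \<le> \<phi> t * k2 s))"

text \<open>The points at which the derivative of order \<open>l \<le> n - 1\<close> in \<open>t\<close> is considered.\<close>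

definition dt_dom :: "bvp \<Rightarrow> nat \<Rightarrow> (real \<times> real) set" where
  "dt_dom p l = {(t, s). t \<in> intv p \<and> s \<in> intv p \<and> (l = dim_ord p - 1 \<longrightarrow> t \<noteq> s)}"

definition Pset :: "bvp \<Rightarrow> nat \<Rightarrow> real set" where
  "Pset p l = {M. green_exists p M \<and> (\<forall>(t, s)\<in>dt_dom p l. dt (intv p) l (green p M) t s \<ge> 0)}"

definition Nset :: "bvp \<Rightarrow> nat \<Rightarrow> real set" where
  "Nset p l = {M. green_exists p M \<and> (\<forall>(t, s)\<in>dt_dom p l. dt (intv p) l (green p M) t s \<le> 0)}"

text \<open>The interval \<open>(M0, min {sup P, sup Q}]\<close>, with suprema in the extended reals; as it consists
  of real numbers, it is \<open>(M0, \<infinity>)\<close> if both suprema are infinite.\<close>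

definition M_range :: "real \<Rightarrow> real set \<Rightarrow> real set \<Rightarrow> real set" where
  "M_range M0 P Q =
     {M. M0 < M \<and> ereal M \<le> min (Sup (ereal ` P)) (Sup (ereal ` Q))}"

end

theory Submission
  imports Defs "HOL-Complex_Analysis.Great_Picard"
begin

text \<open>Everything rests on the resolvent identity
  \<open>g\<^sub>M(t,s) = g\<^sub>N(t,s) + (N - M) \<integral> g\<^sub>N(t,r) g\<^sub>M(r,s) dr\<close>, which may be differentiated \<open>n - 1\<close> times
  in \<open>t\<close>. If \<open>g\<^sub>M \<ge> 0\<close>, \<open>M \<le> N\<close> and \<open>\<partial>\<^sup>lg\<^sub>N\<close> has constant sign, it shows that \<open>\<partial>\<^sup>lg\<^sub>M\<close> has the same
  sign and is larger in absolute value; this is the monotonicity, and it makes \<open>P\<^sub>l\<close> and \<open>N\<^sub>l\<close>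
  downward closed in \<open>P\<^sub>0\<close>. Solving the identity by a Neumann series with small \<open>N - M\<close> shows that
  \<open>P\<^sub>0\<close> is an interval which is open on the left and closed on the right, and condition \<open>(P\<^sub>g)\<close>
  bounds it from below. At \<open>M\<^sub>0 = inf P\<^sub>0\<close> the Green's functions blow up and, after normalisation,
  produce an eigenfunction \<open>u > 0\<close> of the operator with parameter \<open>M\<^sub>0\<close>. It satisfies
  \<open>u\<^sup>(\<^sup>l\<^sup>) = (M - M\<^sub>0) \<integral> \<partial>\<^sup>lg\<^sub>M(\<cdot>,r) u(r) dr\<close> for every \<open>M\<close>, so that \<open>\<partial>\<^sup>lg\<^sub>M\<close> cannot have the same sign
  for one \<open>M\<close> below and one \<open>M\<close> above \<open>M\<^sub>0\<close>, unless \<open>\<partial>\<^sup>lg\<^sub>M\<close> vanishes off the diagonal, which the jump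
  condition excludes.\<close>

section \<open>Iterated derivatives on an interval\<close>

text \<open>Three gaps in the definition of a Green's function shape the work: sections with
  \<open>s\<close> at an end point solve no equation, the derivative of order \<open>n - 1\<close>
  is not bounded by assumption, and the boundary value problem itself is not mentioned. So bounds
  and the equation are used for interior \<open>s\<close> only, the resolvent identity reaches the
  end points by continuity of the undifferentiated kernel, and unique solvability is read off from
  the uniqueness of a single section. The Neumann series started at \<open>N\<close> reaches all
  parameters within \<open>1 / (2 * (b - a) * C)\<close> of \<open>N\<close>, where \<open>C\<close>
  bounds the kernel at \<open>N\<close>. On \<open>Pset p 0\<close> kernels decrease in the
  parameter, so a bound at one member serves all members to its right, and steps there keep a fixed
  length. Towards the left end this bound is lost: that no step may reach the excluded infimum is
  what forces the blow-up. Below the infimum Green's functions take negative values, so comparing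
  kernels says nothing there. An eigenfunction that is represented through the kernels of all
  parameters at once replaces the comparison.\<close>

lemma nderiv_chain:
  fixes u :: "real \<Rightarrow> real" and f :: "nat \<Rightarrow> real \<Rightarrow> real"
  assumes ab: "a < b" and U: "openin (top_of_set {a..b}) U"
    and f0: "\<And>t. t \<in> U \<Longrightarrow> u t = f 0 t"
    and f: "\<And>j t. j < k \<Longrightarrow> t \<in> U \<Longrightarrow> (f j has_real_derivative f (Suc j) t) (at t within {a..b})"
    and "j \<le> k" "t \<in> U"
  shows "nderiv {a..b} j u t = f j t"
  using assms(5,6)
proof (induction j arbitrary: t)
  case 0
  then show ?case using f0 by simp
next
  case (Suc j)
  obtain V where V: "open V" "U = {a..b} \<inter> V"
    using U by (auto simp: openin_open)
  have "eventually (\<lambda>x. x \<in> V) (nhds t)"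
    using V Suc.prems eventually_nhds by blast
  then have ev: "eventually (\<lambda>x. x \<in> {a..b} \<longrightarrow> nderiv {a..b} j u x = f j x) (nhds t)"
    by eventually_elim (use V Suc in auto)
  have "vector_derivative (nderiv {a..b} j u) (at t within {a..b})
      = vector_derivative (f j) (at t within {a..b})"
    by (rule vector_derivative_cong_eq[OF ev]) (use V Suc.prems in auto)
  also have "\<dots> = f (Suc j) t"
    using f[of j t] Suc.prems V ab
    by (intro vector_derivative_within_closed_interval)
       (auto simp: has_real_derivative_iff_has_vector_derivative)
  finally show ?case by simp
qed

text \<open>\<open>vector_derivative\<close> has a value everywhere, so \<open>nderiv\<close> alone
  carries no differentiability. Smoothness is therefore shown by exhibiting candidate derivatives
  \<open>f 0, ..., f k\<close>, each the genuine derivative of its predecessor.\<close>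

lemma C_on_chain:
  fixes u :: "real \<Rightarrow> real" and f :: "nat \<Rightarrow> real \<Rightarrow> real"
  assumes ab: "a < b" and U: "openin (top_of_set {a..b}) U"
    and f0: "\<And>t. t \<in> U \<Longrightarrow> u t = f 0 t"
    and f: "\<And>j t. j < k \<Longrightarrow> t \<in> U \<Longrightarrow> (f j has_real_derivative f (Suc j) t) (at t within {a..b})"
    and fk: "continuous_on U (f k)"
  shows "C_on {a..b} k U u"
  unfolding C_on_def
proof (intro conjI allI ballI impI)
  have eq: "nderiv {a..b} j u t = f j t" if "j \<le> k" "t \<in> U" for j t
    by (rule nderiv_chain[OF ab U f0 f]) (use that in auto)
  obtain V where V: "open V" "U = {a..b} \<inter> V"
    using U by (auto simp: openin_open)
  fix j
  {
    fix t assume j: "j < k" and t: "t \<in> U"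
    have "eventually (\<lambda>x. x \<in> V) (nhds t)"
      using V t eventually_nhds by blast
    then have ev: "eventually (\<lambda>x. x \<in> {a..b} \<longrightarrow> nderiv {a..b} j u x = f j x) (nhds t)"
      by eventually_elim (use V j eq in auto)
    have "(nderiv {a..b} j u has_real_derivative f (Suc j) t) (at t within {a..b})
       \<longleftrightarrow> (f j has_real_derivative f (Suc j) t) (at t within {a..b})"
      using ev V t by (intro has_field_derivative_cong_ev) auto
    then show "nderiv {a..b} j u differentiable (at t within {a..b})"
      using f[OF j t] real_differentiable_def by blast
  }
  assume j: "j \<le> k"
  have "continuous_on U (f j)"
  proof (cases "j = k")
    case False
    then have "continuous (at t within U) (f j)" if "t \<in> U" for t
      using f[of j t] that j V DERIV_continuous DERIV_subset[of "f j" _ t "{a..b}" U]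
      by (metis inf_le1 le_neq_implies_less)
    then show ?thesis by (simp add: continuous_on_eq_continuous_within)
  qed (use fk in simp)
  then show "continuous_on U (nderiv {a..b} j u)"
    using eq[OF j] by (metis (no_types, lifting) continuous_on_cong)
qed

lemma C_on_deriv:
  assumes "C_on S k U u" "j < k" "t \<in> U"
  shows "(nderiv S j u has_real_derivative nderiv S (Suc j) u t) (at t within S)"
  using assms unfolding C_on_def
  by (simp add: vector_derivative_works has_real_derivative_iff_has_vector_derivative)

lemma C_on_continuous: "C_on S k U u \<Longrightarrow> j \<le> k \<Longrightarrow> continuous_on U (nderiv S j u)"
  by (simp add: C_on_def)

lemma C_on_mono: "C_on S k U u \<Longrightarrow> j \<le> k \<Longrightarrow> V \<subseteq> U \<Longrightarrow> C_on S j V u"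
  unfolding C_on_def
  by (meson continuous_on_subset le_trans less_le_trans subsetD)

lemma
  assumes ab: "a < b" and U: "openin (top_of_set {a..b}) U"
    and u: "C_on {a..b} k U u" and v: "C_on {a..b} k U v"
  shows C_on_lincomb: "C_on {a..b} k U (\<lambda>t. u t + c * v t)"
    and nderiv_lincomb: "\<And>j t. j \<le> k \<Longrightarrow> t \<in> U \<Longrightarrow>
      nderiv {a..b} j (\<lambda>t. u t + c * v t) t = nderiv {a..b} j u t + c * nderiv {a..b} j v t"
proof -
  let ?f = "\<lambda>j t. nderiv {a..b} j u t + c * nderiv {a..b} j v t"
  have d: "(?f j has_real_derivative ?f (Suc j) t) (at t within {a..b})" if "j < k" "t \<in> U" for j t
    using C_on_deriv[OF u that] C_on_deriv[OF v that] by (auto intro!: derivative_eq_intros)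
  have "continuous_on U (?f k)"
    using C_on_continuous[OF u] C_on_continuous[OF v] by (intro continuous_intros) auto
  then show "C_on {a..b} k U (\<lambda>t. u t + c * v t)"
    by (intro C_on_chain[where f = ?f, OF ab U] d) auto
  show "nderiv {a..b} j (\<lambda>t. u t + c * v t) t = ?f j t" if "j \<le> k" "t \<in> U" for j t
    by (rule nderiv_chain[where f = ?f, OF ab U _ d]) (use that in auto)
qed

text \<open>Differentiation is local, and relative openness of \<open>U\<close> provides the
  neighbourhood. Differentiability is no issue: where it fails, both sides are the same default
  value.\<close>

lemma nderiv_cong_on:
  assumes ab: "a < b" and U: "openin (top_of_set {a..b}) U" 
    and eq: "\<And>t. t \<in> U \<Longrightarrow> u t = v t" and "t \<in> U"
  shows "nderiv {a..b} j u t = nderiv {a..b} j v t"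
  using assms(4)
proof (induction j arbitrary: t)
  case 0
  then show ?case using eq by simp
next
  case (Suc j)
  obtain V where V: "open V" "U = {a..b} \<inter> V"
    using U by (auto simp: openin_open)
  have "eventually (\<lambda>x. x \<in> V) (nhds t)"
    using V Suc.prems eventually_nhds by blast
  then have ev: "eventually (\<lambda>x. x \<in> {a..b} \<longrightarrow> nderiv {a..b} j u x = nderiv {a..b} j v x) (nhds t)"
    by eventually_elim (use V Suc in auto)
  show ?case
    unfolding nderiv.simps
    by (rule vector_derivative_cong_eq[OF ev]) (use V Suc.prems in auto)
qed

text \<open>Carries the vanishing of the derivative of order \<open>l\<close> up to order
  \<open>n - 1\<close>, where the jump condition of a Green's function can be contradicted.\<close>

lemma nderiv_zero_on:
  assumes ab: "a < b" and U: "openin (top_of_set {a..b}) U"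
    and eq: "\<And>t. t \<in> U \<Longrightarrow> nderiv {a..b} l u t = 0" and t: "t \<in> U" and "l \<le> k"
  shows "nderiv {a..b} k u t = 0"
proof -
  have z: "nderiv {a..b} j (\<lambda>_. 0) x = 0" if "x \<in> {a..b}" for j x
    by (rule nderiv_chain[where f = "\<lambda>_ _. 0" and k = j and U = "{a..b}"]) (use that ab in auto)
  have shift: "nderiv {a..b} (m + l) u = nderiv {a..b} m (nderiv {a..b} l u)" for m
    by (induction m) auto
  have "nderiv {a..b} (k - l) (nderiv {a..b} l u) t = nderiv {a..b} (k - l) (\<lambda>_. 0) t"
    by (rule nderiv_cong_on[OF ab U]) (use eq t in auto)
  also have "\<dots> = 0"
    using z openin_imp_subset[OF U] t by auto
  finally show ?thesis
    using shift[of "k - l"] \<open>l \<le> k\<close> by simp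
qed

lemma continuous_on_Icc_tendsto:
  fixes f :: "real \<Rightarrow> real"
  assumes "continuous_on {a..b} f" "s \<in> {a<..<b}"
  shows "(f \<longlongrightarrow> f s) (at_right s)" "(f \<longlongrightarrow> f s) (at_left s)"
proof -
  have "(f \<longlongrightarrow> f s) (at s within {a..b})"
    using assms by (auto simp: continuous_on_def)
  moreover have "at s within {a..b} = at s" using assms(2) by (intro at_within_interior) auto
  ultimately show "(f \<longlongrightarrow> f s) (at_right s)" "(f \<longlongrightarrow> f s) (at_left s)"
    by (simp_all add: filterlim_at_split)
qed

lemma eventually_Icc_minus:
  fixes s :: real
  assumes "s \<in> {a<..<b}"
  shows "eventually (\<lambda>t. t \<in> {a..b} - {s}) (at_left s)" "eventually (\<lambda>t. t \<in> {a..b} - {s}) (at_right s)"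
proof -
  have "eventually (\<lambda>t. t \<in> {a..b} - {s}) (at s)"
    using eventually_at_in_open[of "{a<..<b}" s] assms by (auto elim!: eventually_mono)
  then show "eventually (\<lambda>t. t \<in> {a..b} - {s}) (at_left s)" "eventually (\<lambda>t. t \<in> {a..b} - {s}) (at_right s)"
    by (auto simp: eventually_at_split)
qed

text \<open>Subtracting the jump \<open>hp - hm\<close> to the right of \<open>s\<close> leaves a
  function that extends continuously to \<open>s\<close>, so the mean value theorem gives one
  Lipschitz constant across \<open>s\<close>. This is the source of the bounds that are uniform in
  \<open>s\<close>.\<close>

lemma lipschitz_off_jump:
  fixes f f' :: "real \<Rightarrow> real"
  assumes s: "s \<in> {a<..<b}"
    and f: "\<And>t. t \<in> {a..b} - {s} \<Longrightarrow> (f has_real_derivative f' t) (at t within {a..b})"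
    and B: "\<And>t. t \<in> {a..b} - {s} \<Longrightarrow> \<bar>f' t\<bar> \<le> B"
    and hp: "(f \<longlongrightarrow> hp) (at_right s)" and hm: "(f \<longlongrightarrow> hm) (at_left s)"
    and t: "t \<in> {a..b} - {s}" "t' \<in> {a..b} - {s}"
  shows "\<bar>(f t - (if s < t then hp - hm else 0)) - (f t' - (if s < t' then hp - hm else 0))\<bar> \<le> B * \<bar>t - t'\<bar>"
proof -
  \<comment> \<open>The value \<open>f s\<close> is arbitrary, so \<open>h\<close> takes the left
    limit there; the corrected right limit agrees with it.\<close>
  define h where "h x = (if x = s then hm else f x - (if s < x then hp - hm else 0))" for x
  have d: "(h has_real_derivative f' x) (at x within {a..b})" if x: "x \<in> {a..b} - {s}" for x
  proof -
    let ?c = "if s < x then hp - hm else 0"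
    have "((\<lambda>y. f y - ?c) has_real_derivative f' x) (at x within {a..b})"
      using f[OF x] by (auto intro!: derivative_eq_intros)
    moreover have "eventually (\<lambda>y. y \<in> {a..b} \<longrightarrow> h y = f y - ?c) (nhds x)"
    proof (cases "s < x")
      case True
      then have "eventually (\<lambda>y. y \<in> {s<..}) (nhds x)"
        using eventually_nhds by (metis greaterThan_iff open_greaterThan)
      then show ?thesis by eventually_elim (use True in \<open>auto simp: h_def\<close>)
    next
      case False
      then have "eventually (\<lambda>y. y \<in> {..<s}) (nhds x)"
        using x eventually_nhds by (metis DiffE antisym_conv3 lessThan_iff open_lessThan singletonI)
      then show ?thesis by eventually_elim (use False in \<open>auto simp: h_def\<close>)
    qed
    ultimately show ?thesis
      using x by (subst has_field_derivative_cong_ev[where g = "\<lambda>y. f y - ?c" and y = x and t = "{a..b}" and v = "f' x"]) auto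
  qed
  have hs: "continuous (at s) h"
  proof -
    have "(h \<longlongrightarrow> hm) (at_left s)"
      by (rule Lim_transform_eventually[OF hm]) (auto simp: h_def eventually_at_filter)
    moreover have "(h \<longlongrightarrow> hp - (hp - hm)) (at_right s)"
      by (rule Lim_transform_eventually[OF tendsto_diff[OF hp tendsto_const]])
         (auto simp: h_def eventually_at_filter)
    ultimately have "(h \<longlongrightarrow> hm) (at s)" by (simp add: filterlim_split_at)
    then show ?thesis by (simp add: isCont_def h_def)
  qed
  have cont: "continuous_on {a..b} h"
    unfolding continuous_on_eq_continuous_within
  proof
    fix x assume "x \<in> {a..b}"
    then show "continuous (at x within {a..b}) h"
      using d[of x] hs DERIV_continuous continuous_at_imp_continuous_at_within
      by (cases "x = s") auto
  qed
  have mvt: "\<bar>h y - h x\<bar> \<le> B * (y - x)" if xy: "a \<le> x" "x < y" "y \<le> b" "s \<notin> {x<..<y}" for x y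
  proof -
    have dd: "(h has_real_derivative f' z) (at z)" if "x < z" "z < y" for z
    proof -
      have "z \<in> interior {a..b}" using that xy by auto
      then have "at z within {a..b} = at z" by (rule at_within_interior)
      moreover have "z \<in> {a..b} - {s}" using that xy by auto
      ultimately show ?thesis using d[of z] by simp
    qed
    have "continuous_on {x..y} h"
      by (rule continuous_on_subset[OF cont]) (use xy in auto)
    moreover have "h differentiable (at z)" if "x < z" "z < y" for z
      using dd[OF that] real_differentiable_def by blast
    ultimately obtain l z where z: "x < z" "z < y" "(h has_real_derivative l) (at z)" "h y - h x = (y - x) * l"
      using MVT[OF xy(2), of h] by blast
    have "l = f' z" using DERIV_unique z dd by blast
    moreover have "\<bar>f' z\<bar> \<le> B" using B[of z] z xy by auto
    ultimately show ?thesis using z xy by (simp add: abs_mult mult.commute)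
  qed
  \<comment> \<open>An interval with \<open>s\<close> in its interior is split at \<open>s\<close>,
    where \<open>h\<close> is only known to be continuous, and the two bounds add up.\<close>
  have main: "\<bar>h y - h x\<bar> \<le> B * (y - x)" if xy: "a \<le> x" "x < y" "y \<le> b" for x y
  proof (cases "s \<in> {x<..<y}")
    case True
    then have "\<bar>h s - h x\<bar> \<le> B * (s - x)" "\<bar>h y - h s\<bar> \<le> B * (y - s)"
      using xy by (auto intro!: mvt)
    then show ?thesis by (simp add: algebra_simps)
  qed (use mvt xy in blast)
  have "\<bar>h t - h t'\<bar> \<le> B * \<bar>t - t'\<bar>"
    using main[of t t'] main[of t' t] t by (cases t t' rule: linorder_cases) (auto simp: abs_minus_commute)
  then show ?thesis using t by (simp add: h_def)
qed

section \<open>Integral operators with kernels that are discontinuous on the diagonal\<close>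

text \<open>Omitting the end points leaves the integral unchanged and keeps \<open>r = a\<close> and
  \<open>r = b\<close>, where \<open>bkernel\<close> gives no bound, out of every estimate.\<close>

definition kint :: "real \<Rightarrow> real \<Rightarrow> (real \<Rightarrow> real \<Rightarrow> real) \<Rightarrow> (real \<Rightarrow> real) \<Rightarrow> real \<Rightarrow> real" where
  "kint a b G \<sigma> t = (LINT r:{a<..<b}|lborel. G t r * \<sigma> r)"

text \<open>Bounds are only requested for \<open>s\<close> in the open interval: at \<open>s = a\<close> and \<open>s = b\<close> a Green's
  function satisfies neither the differential equation nor the jump condition by definition.\<close>

definition bkernel :: "real \<Rightarrow> real \<Rightarrow> (real \<Rightarrow> real \<Rightarrow> real) \<Rightarrow> bool" where
  "bkernel a b G \<longleftrightarrow> continuous_on ({a..b} \<times> {a..b} - Id) (\<lambda>(t, s). G t s) \<and>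
     (\<exists>C. \<forall>t\<in>{a..b}. \<forall>s\<in>{a<..<b}. t \<noteq> s \<longrightarrow> \<bar>G t s\<bar> \<le> C)"

lemma bkernelI_continuous:
  assumes "continuous_on ({a..b} \<times> {a..b}) (\<lambda>(t, s). G t s)"
  shows "bkernel a b G"
proof -
  have "bounded ((\<lambda>(t, s). G t s) ` ({a..b} \<times> {a..b}))"
    by (intro compact_imp_bounded compact_continuous_image assms compact_Times compact_Icc)
  then obtain C where "\<forall>x\<in>(\<lambda>(t, s). G t s) ` ({a..b} \<times> {a..b}). norm x \<le> C"
    unfolding bounded_iff by blast
  then have "\<forall>t\<in>{a..b}. \<forall>s\<in>{a<..<b}. t \<noteq> s \<longrightarrow> \<bar>G t s\<bar> \<le> C" by force
  then show ?thesis
    unfolding bkernel_def using continuous_on_subset[OF assms] by blast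
qed

lemma bkernel_section:
  assumes "bkernel a b G" "t \<in> {a..b}"
  shows "continuous_on ({a<..<b} - {t}) (G t)"
proof -
  have "continuous_on ({a..b} \<times> {a..b} - Id) (\<lambda>(t, s). G t s)"
    using assms by (simp add: bkernel_def)
  then have "continuous_on ({a<..<b} - {t}) (\<lambda>s. (\<lambda>(t, s). G t s) (t, s))"
    by (rule continuous_on_compose2) (use assms in \<open>auto intro!: continuous_intros\<close>)
  then show ?thesis by simp
qed

lemma continuous_on_section:
  assumes "continuous_on (S \<times> T) (\<lambda>(t, s). G t s)" 
  shows "t \<in> S \<Longrightarrow> continuous_on T (G t)" "s \<in> T \<Longrightarrow> continuous_on S (\<lambda>t. G t s)"
proof -
  assume "t \<in> S"
  have "continuous_on T (\<lambda>s. (\<lambda>(t, s). G t s) (t, s))"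
    by (rule continuous_on_compose2[OF assms]) (use \<open>t \<in> S\<close> in \<open>auto intro!: continuous_intros\<close>)
  then show "continuous_on T (G t)" by simp
next
  assume "s \<in> T"
  have "continuous_on S (\<lambda>t. (\<lambda>(t, s). G t s) (t, s))"
    by (rule continuous_on_compose2[OF assms]) (use \<open>s \<in> T\<close> in \<open>auto intro!: continuous_intros\<close>)
  then show "continuous_on S (\<lambda>t. G t s)" by simp
qed

text \<open>Nothing is known of \<open>f c\<close>: measurability comes from splitting off the
  single point \<open>c\<close>, and the bound is enlarged to cover that value.\<close>

lemma set_integrable_bounded_off_point:
  fixes f :: "real \<Rightarrow> real"
  assumes f: "continuous_on ({a<..<b} - {c}) f" and C: "\<And>x. x \<in> {a<..<b} - {c} \<Longrightarrow> \<bar>f x\<bar> \<le> C"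
  shows "set_integrable lborel {a<..<b} f"
  unfolding set_integrable_def
proof (rule integrableI_bounded_set[where A = "{a<..<b}" and B = "max C \<bar>f c\<bar>"])
  have "(\<lambda>x. indicator ({a<..<b} - {c}) x *\<^sub>R f x) \<in> borel_measurable borel"
    by (intro borel_measurable_continuous_on_indicator f) auto
  then have "(\<lambda>x. indicator ({a<..<b} - {c}) x *\<^sub>R f x + indicator ({a<..<b} \<inter> {c}) x *\<^sub>R f c) \<in> borel_measurable borel"
    by (intro borel_measurable_add) auto
  also have "(\<lambda>x. indicator ({a<..<b} - {c}) x *\<^sub>R f x + indicator ({a<..<b} \<inter> {c}) x *\<^sub>R f c)
     = (\<lambda>x. indicator {a<..<b} x *\<^sub>R f x)"
    by (auto simp: indicator_def fun_eq_iff)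
  finally show "(\<lambda>x. indicator {a<..<b} x *\<^sub>R f x) \<in> borel_measurable lborel" by simp
  show "emeasure lborel {a<..<b} < \<infinity>" by (cases "a \<le> b") (auto simp: emeasure_lborel_Ioo)
  show "AE x in lborel. x \<in> {a<..<b} \<longrightarrow> norm (indicator {a<..<b} x *\<^sub>R f x) \<le> max C \<bar>f c\<bar>"
  proof (rule AE_I2, intro impI)
    fix x assume "x \<in> {a<..<b}"
    then show "norm (indicator {a<..<b} x *\<^sub>R f x) \<le> max C \<bar>f c\<bar>"
      using C[of x] by (cases "x = c") (auto simp: indicator_def)
  qed
qed (auto simp: indicator_def)

lemma continuous_on_Icc_bounded:
  fixes f :: "real \<Rightarrow> real"
  assumes "continuous_on {a..b} f"
  obtains C where "C \<ge> 0" "\<And>x. x \<in> {a..b} \<Longrightarrow> \<bar>f x\<bar> \<le> C"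
proof -
  have "bounded (f ` {a..b})"
    by (intro compact_imp_bounded compact_continuous_image assms compact_Icc)
  then obtain C where "\<forall>x\<in>f ` {a..b}. norm x \<le> C" unfolding bounded_iff by blast
  then show ?thesis by (intro that[of "\<bar>C\<bar>"]) force+
qed

lemma bkernel_bound:
  assumes "bkernel a b G"
  obtains C where "C \<ge> 0" "\<And>t s. t \<in> {a..b} \<Longrightarrow> s \<in> {a<..<b} \<Longrightarrow> t \<noteq> s \<Longrightarrow> \<bar>G t s\<bar> \<le> C"
proof -
  obtain C where C: "\<forall>t\<in>{a..b}. \<forall>s\<in>{a<..<b}. t \<noteq> s \<longrightarrow> \<bar>G t s\<bar> \<le> C"
    using assms unfolding bkernel_def by blast
  show ?thesis by (rule that[of "\<bar>C\<bar>"]) (use C in force)+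
qed

lemma kint_integrable:
  assumes "bkernel a b G" "continuous_on {a..b} \<sigma>" "t \<in> {a..b}"
  shows "set_integrable lborel {a<..<b} (\<lambda>r. G t r * \<sigma> r)"
proof -
  obtain C where C: "C \<ge> 0" "\<And>t s. t \<in> {a..b} \<Longrightarrow> s \<in> {a<..<b} \<Longrightarrow> t \<noteq> s \<Longrightarrow> \<bar>G t s\<bar> \<le> C"
    using bkernel_bound[OF assms(1)] by blast
  obtain D where D: "D \<ge> 0" "\<And>x. x \<in> {a..b} \<Longrightarrow> \<bar>\<sigma> x\<bar> \<le> D"
    using continuous_on_Icc_bounded[OF assms(2)] by blast
  show ?thesis
  proof (rule set_integrable_bounded_off_point[where c = t and C = "C * D"])
    show "continuous_on ({a<..<b} - {t}) (\<lambda>r. G t r * \<sigma> r)"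
      by (intro continuous_intros bkernel_section assms continuous_on_subset[OF assms(2)]) auto
    fix x assume "x \<in> {a<..<b} - {t}"
    then show "\<bar>G t x * \<sigma> x\<bar> \<le> C * D"
      unfolding abs_mult by (intro mult_mono C D assms(3)) (use C in auto)
  qed
qed

text \<open>Kernels are uncontrolled on the diagonal, and along a sequence of first arguments the
  diagonal point moves. The set \<open>X\<close> of all these points is countable, hence
  null.\<close>

lemma LINT_dominated:
  fixes f :: "nat \<Rightarrow> real \<Rightarrow> real"
  assumes f: "\<And>k. set_integrable lborel {a<..<b} (f k)" and g: "set_integrable lborel {a<..<b} g"
    and X: "countable X"
    and C: "\<And>k x. x \<in> {a<..<b} - X \<Longrightarrow> \<bar>f k x\<bar> \<le> C"
    and lim: "\<And>x. x \<in> {a<..<b} - X \<Longrightarrow> (\<lambda>k. f k x) \<longlonglongrightarrow> g x"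
  shows "(\<lambda>k. LINT x:{a<..<b}|lborel. f k x) \<longlonglongrightarrow> (LINT x:{a<..<b}|lborel. g x)"
  unfolding set_lebesgue_integral_def
proof (rule integral_dominated_convergence[where w = "\<lambda>x. indicator {a<..<b} x *\<^sub>R C"])
  have ae: "AE x in lborel. x \<notin> X"
    by (rule AE_not_in[OF countable_imp_null_set_lborel[OF X]])
  show "AE x in lborel. (\<lambda>i. indicator {a<..<b} x *\<^sub>R f i x) \<longlonglongrightarrow> indicator {a<..<b} x *\<^sub>R g x"
    using ae by eventually_elim (use lim in \<open>auto simp: indicator_def\<close>)
  show "AE x in lborel. norm (indicator {a<..<b} x *\<^sub>R f i x) \<le> indicator {a<..<b} x *\<^sub>R C" for i
    using ae by eventually_elim (use C in \<open>auto simp: indicator_def\<close>)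
  show "integrable lborel (\<lambda>x. indicator {a<..<b} x *\<^sub>R C)"
    using set_integrable_bounded_off_point[of a b a "\<lambda>_. C" "\<bar>C\<bar>"] by (simp add: set_integrable_def)
qed (use f g in \<open>auto simp: set_integrable_def\<close>)

lemma kint_jointly_continuous:
  assumes G: "bkernel a b G" and R: "continuous_on ({a..b} \<times> {a..b}) (\<lambda>(t, s). R t s)"
  shows "continuous_on ({a..b} \<times> {a..b}) (\<lambda>(t, s). kint a b G (\<lambda>r. R r s) t)"
  unfolding continuous_on_sequentially
proof (intro allI ballI impI, elim conjE)
  fix x :: "nat \<Rightarrow> real \<times> real" and p
  assume p: "p \<in> {a..b} \<times> {a..b}" and x: "\<forall>n. x n \<in> {a..b} \<times> {a..b}" and lim: "x \<longlonglongrightarrow> p"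
  obtain t s where ts: "p = (t, s)" by (cases p)
  define u v where "u n = fst (x n)" and "v n = snd (x n)" for n
  have uv: "x n = (u n, v n)" "u n \<in> {a..b}" "v n \<in> {a..b}" for n
    using x by (auto simp: u_def v_def mem_Times_iff)
  have tt: "t \<in> {a..b}" "s \<in> {a..b}" using p ts by auto
  have lu: "u \<longlonglongrightarrow> t" and lv: "v \<longlonglongrightarrow> s"
    using tendsto_fst[OF lim] tendsto_snd[OF lim] ts by (simp_all add: u_def[abs_def] v_def[abs_def])
  obtain C where C: "C \<ge> 0" "\<And>t s. t \<in> {a..b} \<Longrightarrow> s \<in> {a<..<b} \<Longrightarrow> t \<noteq> s \<Longrightarrow> \<bar>G t s\<bar> \<le> C"
    using bkernel_bound[OF G] by blast
  have "bounded ((\<lambda>(t, s). R t s) ` ({a..b} \<times> {a..b}))"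
    by (intro compact_imp_bounded compact_continuous_image R compact_Times compact_Icc)
  then obtain D where "\<forall>x\<in>(\<lambda>(t, s). R t s) ` ({a..b} \<times> {a..b}). norm x \<le> D"
    unfolding bounded_iff by blast
  then have D: "\<bar>R r s\<bar> \<le> D" if "r \<in> {a..b}" "s \<in> {a..b}" for r s using that by force
  have Rc: "continuous_on {a..b} (\<lambda>r. R r s)" if "s \<in> {a..b}" for s
    using continuous_on_section(2)[OF R that] .
  have "(\<lambda>n. LINT r:{a<..<b}|lborel. G (u n) r * R r (v n)) \<longlonglongrightarrow> (LINT r:{a<..<b}|lborel. G t r * R r s)"
  \<comment> \<open>At \<open>r = u k\<close> the kernel of index \<open>k\<close> is on its
    diagonal, and at \<open>r = t\<close> the limit kernel is.\<close>
  proof (rule LINT_dominated[where X = "insert t (range u)" and C = "C * D"])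
    show "\<bar>G (u k) r * R r (v k)\<bar> \<le> C * D" if "r \<in> {a<..<b} - insert t (range u)" for k r
      unfolding abs_mult by (intro mult_mono C D uv) (use that C uv in auto)
    show "(\<lambda>k. G (u k) r * R r (v k)) \<longlonglongrightarrow> G t r * R r s" if r: "r \<in> {a<..<b} - insert t (range u)" for r
    proof (intro tendsto_mult)
      have "(\<lambda>k. (\<lambda>(t, s). G t s) (u k, r)) \<longlonglongrightarrow> (\<lambda>(t, s). G t s) (t, r)"
        by (rule continuous_on_tendsto_compose[where s = "{a..b} \<times> {a..b} - Id"])
           (use G r uv tt lu in \<open>auto simp: bkernel_def intro!: tendsto_intros always_eventually\<close>)
      then show "(\<lambda>k. G (u k) r) \<longlonglongrightarrow> G t r" by simp
      have "(\<lambda>k. (\<lambda>(t, s). R t s) (r, v k)) \<longlonglongrightarrow> (\<lambda>(t, s). R t s) (r, s)"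
        by (rule continuous_on_tendsto_compose[OF R])
           (use r uv tt lv in \<open>auto intro!: tendsto_intros\<close>)
      then show "(\<lambda>k. R r (v k)) \<longlonglongrightarrow> R r s" by simp
    qed
  qed (use G Rc uv tt in \<open>auto intro!: kint_integrable\<close>)
  then show "((\<lambda>(t, s). kint a b G (\<lambda>r. R r s) t) \<circ> x) \<longlonglongrightarrow> (\<lambda>(t, s). kint a b G (\<lambda>r. R r s) t) p"
    by (simp add: kint_def o_def uv(1) ts)
qed

lemma kint_continuous:
  assumes "bkernel a b G" "continuous_on {a..b} \<sigma>"
  shows "continuous_on {a..b} (kint a b G \<sigma>)"
proof (cases "a \<le> b")
  case True
  have "continuous_on ({a..b} \<times> {a..b}) (\<lambda>(t, s). kint a b G (\<lambda>r. \<sigma> r) t)"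
    by (rule kint_jointly_continuous[OF assms(1)])
       (auto simp: case_prod_unfold intro!: continuous_on_compose2[OF assms(2)] continuous_intros)
  from continuous_on_section(2)[OF this, of a] True show ?thesis by (simp add: eta_contract_eq)
qed auto

lemma kint_bound:
  assumes "bkernel a b G" "continuous_on {a..b} \<sigma>" "t \<in> {a..b}" "a \<le> b"
    and C: "\<And>s. s \<in> {a<..<b} \<Longrightarrow> s \<noteq> t \<Longrightarrow> \<bar>G t s\<bar> \<le> C" and D: "\<And>s. s \<in> {a<..<b} \<Longrightarrow> \<bar>\<sigma> s\<bar> \<le> D"
    and "C \<ge> 0"
  shows "\<bar>kint a b G \<sigma> t\<bar> \<le> (b - a) * C * D"
proof -
  have "\<bar>kint a b G \<sigma> t\<bar> \<le> (LINT r:{a<..<b}|lborel. \<bar>G t r * \<sigma> r\<bar>)"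
    unfolding kint_def using set_integral_norm_bound[OF kint_integrable[OF assms(1-3)]] by simp
  also have "\<dots> \<le> (LINT r:{a<..<b}|lborel. C * D)"
  proof -
    have "AE r in lborel. r \<notin> {t}"
      by (rule AE_not_in[OF countable_imp_null_set_lborel]) auto
    then have ae: "AE r in lborel. r \<in> {a<..<b} \<longrightarrow> \<bar>G t r * \<sigma> r\<bar> \<le> C * D"
      by eventually_elim (use C D \<open>C \<ge> 0\<close> in \<open>auto simp: abs_mult intro!: mult_mono\<close>)
    show ?thesis
      by (rule set_integral_mono_AE[OF _ _ ae])
         (use set_integrable_abs[OF kint_integrable[OF assms(1-3)]]
             set_integrable_bounded_off_point[of a b a "\<lambda>_. C*D" "\<bar>C*D\<bar>"] in auto)
  qed
  also have "\<dots> = (b - a) * C * D"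
    using \<open>a \<le> b\<close> by (simp add: set_integral_const measure_def emeasure_lborel_Ioo)
  finally show ?thesis .
qed

lemma kint_mono:
  assumes "bkernel a b F" "continuous_on {a..b} \<sigma>" "bkernel a b G" "continuous_on {a..b} \<tau>" "t \<in> {a..b}" "t' \<in> {a..b}"
    and le: "\<And>s. s \<in> {a<..<b} \<Longrightarrow> s \<noteq> t \<Longrightarrow> s \<noteq> t' \<Longrightarrow> F t s * \<sigma> s \<le> G t' s * \<tau> s"
  shows "kint a b F \<sigma> t \<le> kint a b G \<tau> t'"
proof -
  have "AE r in lborel. r \<notin> {t, t'}"
    by (rule AE_not_in[OF countable_imp_null_set_lborel]) auto
  then have ae: "AE r in lborel. r \<in> {a<..<b} \<longrightarrow> F t r * \<sigma> r \<le> G t' r * \<tau> r"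
    by eventually_elim (use le in auto)
  show ?thesis
    unfolding kint_def
    by (rule set_integral_mono_AE[OF _ _ ae]) (use kint_integrable assms in auto)
qed

lemma kint_nonneg:
  assumes "bkernel a b G" "continuous_on {a..b} \<sigma>" "t \<in> {a..b}"
    and "\<And>s. s \<in> {a<..<b} \<Longrightarrow> s \<noteq> t \<Longrightarrow> 0 \<le> G t s * \<sigma> s"
  shows "0 \<le> kint a b G \<sigma> t"
  using kint_mono[OF assms(1) continuous_on_const assms(1,2,3,3), of 0] assms(4)
  by (simp add: kint_def)

lemma kint_lincomb:
  assumes "bkernel a b G" "continuous_on {a..b} \<sigma>" "continuous_on {a..b} \<tau>" "t \<in> {a..b}"
  shows "kint a b G (\<lambda>r. \<sigma> r + c * \<tau> r) t = kint a b G \<sigma> t + c * kint a b G \<tau> t"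
proof -
  have "kint a b G (\<lambda>r. \<sigma> r + c * \<tau> r) t = (LINT r:{a<..<b}|lborel. G t r * \<sigma> r + c * (G t r * \<tau> r))"
    by (simp add: kint_def algebra_simps)
  also have "\<dots> = (LINT r:{a<..<b}|lborel. G t r * \<sigma> r) + (LINT r:{a<..<b}|lborel. c * (G t r * \<tau> r))"
    by (intro set_integral_add kint_integrable set_integrable_mult_right impI assms)
  finally show ?thesis by (simp add: kint_def)
qed

lemma kint_cmult: "kint a b G (\<lambda>r. c * \<sigma> r) t = c * kint a b G \<sigma> t"
proof -
  have "kint a b G (\<lambda>r. c * \<sigma> r) t = (LINT r:{a<..<b}|lborel. c * (G t r * \<sigma> r))"
    by (simp add: kint_def mult.left_commute)
  then show ?thesis by (simp add: kint_def)
qed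

lemma kint_cong:
  assumes "\<And>s. s \<in> {a<..<b} \<Longrightarrow> G t s * \<sigma> s = G' t' s * \<tau> s"
  shows "kint a b G \<sigma> t = kint a b G' \<tau> t'"
  unfolding kint_def by (rule set_lebesgue_integral_cong) (use assms in auto)

text \<open>Write \<open>F\<close> as a part without jump plus \<open>c\<close> times the indicator
  of \<open>s < t\<close>. The first part is Lipschitz in \<open>t\<close> uniformly in
  \<open>s\<close>, so dominated convergence allows differentiation under the integral. The second
  part integrates to \<open>c\<close> times the primitive \<open>J\<close> of
  \<open>\<sigma>\<close> and produces the extra term \<open>c * \<sigma> t\<close>.\<close>

lemma kint_has_derivative:
  fixes F G :: "real \<Rightarrow> real \<Rightarrow> real"
  assumes ab: "a < b" and F: "bkernel a b F" and G: "bkernel a b G" and \<sigma>: "continuous_on {a..b} \<sigma>"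
    and FG: "\<And>s t. s \<in> {a<..<b} \<Longrightarrow> t \<in> {a..b} - {s} \<Longrightarrow>
        ((\<lambda>r. F r s) has_real_derivative G t s) (at t within {a..b})"
    and jump: "\<And>s. s \<in> {a<..<b} \<Longrightarrow>
        \<exists>hp hm. ((\<lambda>r. F r s) \<longlongrightarrow> hp) (at_right s) \<and> ((\<lambda>r. F r s) \<longlongrightarrow> hm) (at_left s) \<and> hp - hm = c"
    and t: "t \<in> {a..b}"
  shows "(kint a b F \<sigma> has_real_derivative kint a b G \<sigma> t + c * \<sigma> t) (at t within {a..b})"
proof -
  define J where "J x = (LINT s:{a<..<b}|lborel. (if s < x then 1 else 0) * \<sigma> s)" for x
  obtain D where D: "D \<ge> 0" "\<And>x. x \<in> {a..b} \<Longrightarrow> \<bar>\<sigma> x\<bar> \<le> D"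
    using continuous_on_Icc_bounded[OF \<sigma>] by blast
  have Jint: "set_integrable lborel {a<..<b} (\<lambda>s. (if s < x then 1 else 0) * \<sigma> s)" for x
  proof (rule set_integrable_bounded_off_point[where c = x and C = D])
    have "isCont (\<lambda>s. if s < x then 1 else (0::real)) s" if "s \<noteq> x" for s
    proof (cases "s < x")
      case True
      then have "eventually (\<lambda>y. y \<in> {..<x}) (nhds s)"
        by (intro eventually_nhds_in_open) (use True in auto)
      then have "eventually (\<lambda>y. (if y < x then 1 else (0::real)) = 1) (nhds s)"
        by eventually_elim auto
      then show ?thesis by (simp add: isCont_cong)
    next
      case False
      then have "eventually (\<lambda>y. y \<in> {x<..}) (nhds s)"
        by (intro eventually_nhds_in_open) (use that False in auto)
      then have "eventually (\<lambda>y. (if y < x then 1 else (0::real)) = 0) (nhds s)"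
        by eventually_elim auto
      then show ?thesis by (simp add: isCont_cong)
    qed
    then have "continuous_on ({a<..<b} - {x}) (\<lambda>s. if s < x then 1 else (0::real))"
      by (intro continuous_at_imp_continuous_on) auto
    then show "continuous_on ({a<..<b} - {x}) (\<lambda>s. (if s < x then 1 else 0) * \<sigma> s)"
      by (intro continuous_intros continuous_on_subset[OF \<sigma>]) auto
  qed (use D in auto)
  have Jderiv: "(J has_real_derivative \<sigma> t) (at t within {a..b})"
  proof -
    have J: "J x = integral {a..x} \<sigma>" if x: "x \<in> {a..b}" for x
    proof -
      have "J x = (LINT s:{a<..<x}|lborel. \<sigma> s)"
        unfolding J_def set_lebesgue_integral_def
        by (rule Bochner_Integration.integral_cong) (use x in \<open>auto simp: indicator_def\<close>)
      also have "\<dots> = integral {a<..<x} \<sigma>"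
      proof (rule set_borel_integral_eq_integral)
        show "set_integrable lborel {a<..<x} \<sigma>"
          by (rule set_integrable_bounded_off_point[where c = a and C = D])
             (use x D in \<open>auto intro!: continuous_on_subset[OF \<sigma>]\<close>)
      qed
      finally show ?thesis by (simp add: integral_open_interval_real)
    qed
    have "((\<lambda>x. integral {a..x} \<sigma>) has_real_derivative \<sigma> t) (at t within {a..b})"
      by (rule integral_has_real_derivative[OF \<sigma> t])
    then show ?thesis
      by (rule has_field_derivative_transform_within[OF _ zero_less_one t]) (simp add: J)
  qed
  obtain C where C: "C \<ge> 0" "\<And>t s. t \<in> {a..b} \<Longrightarrow> s \<in> {a<..<b} \<Longrightarrow> t \<noteq> s \<Longrightarrow> \<bar>G t s\<bar> \<le> C"
    using bkernel_bound[OF G] by blast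
  have "((\<lambda>x. kint a b F \<sigma> x - c * J x) has_real_derivative kint a b G \<sigma> t) (at t within {a..b})"
    unfolding has_field_derivative_iff tendsto_at_iff_sequentially
  proof (intro allI impI)
    fix x :: "nat \<Rightarrow> real" assume x: "\<forall>i. x i \<in> {a..b} - {t}" and lim: "x \<longlonglongrightarrow> t"
    define H where "H y s = F y s - c * (if s < y then 1 else 0)" for y s
    have Hint: "set_integrable lborel {a<..<b} (\<lambda>s. H y s * \<sigma> s)"
      and Heq: "kint a b F \<sigma> y - c * J y = (LINT s:{a<..<b}|lborel. H y s * \<sigma> s)" if "y \<in> {a..b}" for y
    proof -
      have eq: "(\<lambda>s. H y s * \<sigma> s) = (\<lambda>s. F y s * \<sigma> s - c * ((if s < y then 1 else 0) * \<sigma> s))"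
        by (auto simp: H_def algebra_simps)
      show "set_integrable lborel {a<..<b} (\<lambda>s. H y s * \<sigma> s)"
        unfolding eq by (intro set_integral_diff(1) kint_integrable F \<sigma> that set_integrable_mult_right impI Jint)
      show "kint a b F \<sigma> y - c * J y = (LINT s:{a<..<b}|lborel. H y s * \<sigma> s)"
        unfolding eq
        by (subst set_integral_diff(2))
           (auto simp: kint_def J_def intro!: kint_integrable F \<sigma> that set_integrable_mult_right Jint)
    qed
    let ?q = "\<lambda>n s. (H (x n) s * \<sigma> s - H t s * \<sigma> s) / (x n - t)"
    have "(\<lambda>n. LINT s:{a<..<b}|lborel. ?q n s) \<longlonglongrightarrow> (LINT s:{a<..<b}|lborel. G t s * \<sigma> s)"
    proof (rule LINT_dominated[where X = "insert t (range x)" and C = "C * D"])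
      show "set_integrable lborel {a<..<b} (?q n)" for n
        by (intro set_integrable_divide set_integral_diff(1) Hint impI) (use x t in auto)
      show "\<bar>?q n s\<bar> \<le> C * D" if s: "s \<in> {a<..<b} - insert t (range x)" for n s
      proof -
        obtain hp hm where h: "((\<lambda>r. F r s) \<longlongrightarrow> hp) (at_right s)" "((\<lambda>r. F r s) \<longlongrightarrow> hm) (at_left s)" "hp - hm = c"
          using jump[of s] s by auto
        \<comment> \<open>The jump height is \<open>hp - hm = c\<close> for every \<open>s\<close>,
          so this is a Lipschitz bound for \<open>H\<close> with a constant independent of
          \<open>s\<close>: the dominating bound for the difference quotients.\<close>
        have "\<bar>(F (x n) s - (if s < x n then hp - hm else 0)) - (F t s - (if s < t then hp - hm else 0))\<bar> \<le> C * \<bar>x n - t\<bar>"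
        proof (rule lipschitz_off_jump[OF _ _ _ h(1,2), where f' = "\<lambda>r. G r s" and a = a and b = b])
          show "x n \<in> {a..b} - {s}" using x s by auto
        qed (use FG C s t in auto)
        then have "\<bar>H (x n) s - H t s\<bar> \<le> C * \<bar>x n - t\<bar>"
          by (simp add: H_def h(3) if_distrib cong: if_cong)
        moreover have "x n \<noteq> t" using x by auto
        ultimately have "\<bar>H (x n) s - H t s\<bar> / \<bar>x n - t\<bar> \<le> C"
          by (simp add: divide_le_eq)
        then have "\<bar>H (x n) s - H t s\<bar> / \<bar>x n - t\<bar> * \<bar>\<sigma> s\<bar> \<le> C * D"
          by (intro mult_mono D C) (use s in auto)
        then show ?thesis
          by (simp add: left_diff_distrib[symmetric] abs_mult)
      qed
      show "(\<lambda>n. ?q n s) \<longlonglongrightarrow> G t s * \<sigma> s" if s: "s \<in> {a<..<b} - insert t (range x)" for s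
      proof -
        have "((\<lambda>y. (F y s - F t s) / (y - t)) \<longlongrightarrow> G t s) (at t within {a..b})"
          using FG[of s t] s t by (auto simp: has_field_derivative_iff)
        then have "(\<lambda>n. (F (x n) s - F t s) / (x n - t)) \<longlonglongrightarrow> G t s"
          using x lim unfolding tendsto_at_iff_sequentially by (auto simp: o_def)
        then have l: "(\<lambda>n. (F (x n) s - F t s) / (x n - t) * \<sigma> s) \<longlonglongrightarrow> G t s * \<sigma> s"
          by (intro tendsto_intros)
        \<comment> \<open>For fixed \<open>s\<close> different from \<open>t\<close> the indicators
          at \<open>x n\<close> and \<open>t\<close> finally coincide and cancel, so the quotients
          of \<open>H\<close> have the same limit as those of \<open>F\<close>.\<close>
        have "eventually (\<lambda>n. (s < x n) = (s < t)) sequentially"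
        proof (cases "s < t")
          case True
          from order_tendstoD(1)[OF lim this] show ?thesis by eventually_elim (use True in auto)
        next
          case False
          then have "t < s" using s by auto
          from order_tendstoD(2)[OF lim this] show ?thesis by eventually_elim (use \<open>t < s\<close> in auto)
        qed
        then have "eventually (\<lambda>n. (F (x n) s - F t s) / (x n - t) * \<sigma> s = ?q n s) sequentially"
          by eventually_elim (auto simp: H_def left_diff_distrib diff_divide_distrib)
        from Lim_transform_eventually[OF l this] show ?thesis .
      qed
    qed (use G \<sigma> t in \<open>auto intro: kint_integrable\<close>)
    moreover have "(LINT s:{a<..<b}|lborel. ?q n s)
        = ((kint a b F \<sigma> (x n) - c * J (x n)) - (kint a b F \<sigma> t - c * J t)) / (x n - t)" for n
      using x t by (simp add: Heq set_integral_diff(2)[OF Hint Hint])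
    ultimately show "((\<lambda>y. (kint a b F \<sigma> y - c * J y - (kint a b F \<sigma> t - c * J t)) / (y - t)) \<circ> x)
      \<longlonglongrightarrow> kint a b G \<sigma> t"
      by (simp only: o_def kint_def[of a b G \<sigma> t])
  qed
  from DERIV_add[OF this DERIV_cmult[OF Jderiv, of c]] show ?thesis by simp
qed

section \<open>Green's functions and the solution operator\<close>

lemma LINT_zero:
  fixes f :: "real \<Rightarrow> real"
  assumes "countable X" "\<And>x. x \<in> {a<..<b} - X \<Longrightarrow> f x = 0"
  shows "(LINT x:{a<..<b}|lborel. f x) = 0"
  unfolding set_lebesgue_integral_def
proof (rule integral_eq_zero_AE)
  have "AE x in lborel. x \<notin> X"
    by (rule AE_not_in[OF countable_imp_null_set_lborel[OF assms(1)]])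
  then show "AE x in lborel. indicator {a<..<b} x *\<^sub>R f x = 0"
    by eventually_elim (use assms(2) in \<open>auto simp: indicator_def\<close>)
qed

lemma
  assumes "finite K" "\<And>k. k \<in> K \<Longrightarrow> bkernel a b (G k)" "continuous_on {a..b} \<sigma>" "t \<in> {a..b}"
  shows kint_sum: "(\<Sum>k\<in>K. c k * kint a b (G k) \<sigma> t) = (LINT r:{a<..<b}|lborel. (\<Sum>k\<in>K. c k * G k t r) * \<sigma> r)" (is ?A)
    and kint_sum_integrable: "set_integrable lborel {a<..<b} (\<lambda>r. (\<Sum>k\<in>K. c k * G k t r) * \<sigma> r)" (is ?B)
proof -
  have int: "set_integrable lborel {a<..<b} (\<lambda>r. c k * (G k t r * \<sigma> r))" if "k \<in> K" for k
    using that assms by (intro set_integrable_mult_right impI kint_integrable) auto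
  have eq: "indicator {a<..<b} r *\<^sub>R ((\<Sum>k\<in>K. c k * G k t r) * \<sigma> r)
      = (\<Sum>k\<in>K. indicator {a<..<b} r *\<^sub>R (c k * (G k t r * \<sigma> r)))" for r
    by (simp add: sum_distrib_left sum_distrib_right mult_ac)
  show ?B
    unfolding set_integrable_def eq
    by (rule Bochner_Integration.integrable_sum) (use int in \<open>simp add: set_integrable_def\<close>)
  have "(LINT r:{a<..<b}|lborel. (\<Sum>k\<in>K. c k * G k t r) * \<sigma> r)
      = (\<Sum>k\<in>K. (LINT r:{a<..<b}|lborel. c k * (G k t r * \<sigma> r)))"
    unfolding set_lebesgue_integral_def eq
    by (rule Bochner_Integration.integral_sum) (use int in \<open>simp add: set_integrable_def\<close>)
  then show ?A by (simp add: kint_def)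
qed

lemma bounded_continuous_on_square:
  fixes G :: "real \<Rightarrow> real \<Rightarrow> real"
  assumes "continuous_on ({a..b} \<times> {a..b}) (\<lambda>(t, s). G t s)"
  obtains C where "C > 0" "\<And>t s. t \<in> {a..b} \<Longrightarrow> s \<in> {a..b} \<Longrightarrow> \<bar>G t s\<bar> \<le> C"
proof -
  have "bounded ((\<lambda>(t, s). G t s) ` ({a..b} \<times> {a..b}))"
    by (intro compact_imp_bounded compact_continuous_image assms compact_Times compact_Icc)
  then obtain C where C: "\<forall>x\<in>(\<lambda>(t, s). G t s) ` ({a..b} \<times> {a..b}). norm x \<le> C"
    unfolding bounded_iff by blast
  show ?thesis
    by (rule that[of "\<bar>C\<bar> + 1"]) (use C in force)+
qed

lemma continuous_eq_on_Icc:
  fixes f g :: "real \<Rightarrow> real"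
  assumes "a < b" "continuous_on {a..b} f" "continuous_on {a..b} g"
    and "\<And>x. x \<in> {a<..<b} \<Longrightarrow> f x = g x" "x \<in> {a..b}"
  shows "f x = g x"
proof -
  have "f x - g x = 0"
  proof (rule continuous_constant_on_closure[where S = "{a<..<b}" and f = "\<lambda>x. f x - g x"])
    show "continuous_on (closure {a<..<b}) (\<lambda>x. f x - g x)"
      using assms by (auto intro!: continuous_intros)
  qed (use assms in auto)
  then show ?thesis by simp
qed

section \<open>The boundary value problem and sections of its Green's function\<close>

locale regular_bvp =
  fixes p :: bvp
  assumes order_ge2: "2 \<le> dim_ord p" and lend_less_rend: "lend p < rend p"
    and coef_continuous: "\<And>k. k \<in> {1..dim_ord p} \<Longrightarrow> continuous_on {lend p..rend p} (coef p k)"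
begin

abbreviation "n \<equiv> dim_ord p"
abbreviation "a \<equiv> lend p"
abbreviation "b \<equiv> rend p"

lemma intv: "intv p = {a..b}"
  by (simp add: intv_def)

lemma openin_Icc_minus: "openin (top_of_set {a..b}) ({a..b} - {s})"
  by (auto simp: openin_open intro!: exI[of _ "- {s}"])

lemma T_op_lincomb:
  assumes U: "openin (top_of_set {a..b}) U" and "C_on {a..b} n U u" "C_on {a..b} n U v" "t \<in> U"
  shows "T_op p M (\<lambda>t. u t + c * v t) t = T_op p M u t + c * T_op p M v t"
  using nderiv_lincomb[OF lend_less_rend assms(1-3) _ assms(4)]
  by (simp add: T_op_def intv sum.distrib algebra_simps sum_distrib_left)

lemma B_op_lincomb:
  assumes U: "openin (top_of_set {a..b}) U" and "C_on {a..b} n U u" "C_on {a..b} n U v" "a \<in> U" "b \<in> U"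
  shows "B_op p i (\<lambda>t. u t + c * v t) = B_op p i u + c * B_op p i v"
  using nderiv_lincomb[OF lend_less_rend assms(1-3)] assms(4,5)
  by (simp add: B_op_def intv sum.distrib algebra_simps sum_distrib_left)

lemma T_op_shift: "T_op p N u t = T_op p M u t + (N - M) * u t"
  by (simp add: T_op_def algebra_simps)

lemma C_on_tendsto:
  assumes "C_on {a..b} k {a..b} w" "j \<le> k" "s \<in> {a<..<b}"
  shows "(nderiv {a..b} j w \<longlongrightarrow> nderiv {a..b} j w s) (at_right s)"
    "(nderiv {a..b} j w \<longlongrightarrow> nderiv {a..b} j w s) (at_left s)"
  by (rule continuous_on_Icc_tendsto[OF C_on_continuous[OF assms(1,2)] assms(3)])+

text \<open>A summand that is smooth across \<open>s\<close> does not affect the unit jump, and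
  \<open>eq\<close> is the differential equation of the sum after shifting the parameter from
  \<open>M\<close> to \<open>N\<close>. The same computation serves homogeneous solutions
  (\<open>N = M\<close>) and all passages between two parameters.\<close>

lemma green_section_add:
  assumes s: "s \<in> {a<..<b}" and v: "green_section p M s v"
    and w: "C_on {a..b} n {a..b} w" and Bw: "\<And>i. i \<in> {1..n} \<Longrightarrow> B_op p i w = 0"
    and eq: "\<And>t. t \<in> {a..b} - {s} \<Longrightarrow> (N - M) * v t + c * T_op p N w t = 0"
  shows "green_section p N s (\<lambda>t. v t + c * w t)"
proof -
  note ab = lend_less_rend
  have v1: "C_on {a..b} (n - 2) {a..b} v" and v2: "C_on {a..b} n ({a..b} - {s}) v"
    and Tv: "\<And>t. t \<in> {a..b} - {s} \<Longrightarrow> T_op p M v t = 0" and Bv: "\<And>i. i \<in> {1..n} \<Longrightarrow> B_op p i v = 0"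
    using v by (auto simp: green_section_def intv)
  obtain hp hm where h: "(nderiv {a..b} (n - 1) v \<longlongrightarrow> hp) (at_right s)"
      "(nderiv {a..b} (n - 1) v \<longlongrightarrow> hm) (at_left s)" "hp - hm = 1"
    using v by (auto simp: green_section_def intv)
  have w1: "C_on {a..b} (n - 2) {a..b} w" and w2: "C_on {a..b} n ({a..b} - {s}) w"
    by (rule C_on_mono[OF w]; auto)+
  have c1: "C_on {a..b} (n - 2) {a..b} (\<lambda>t. v t + c * w t)"
    by (rule C_on_lincomb[OF ab _ v1 w1]) auto
  have c2: "C_on {a..b} n ({a..b} - {s}) (\<lambda>t. v t + c * w t)"
    by (rule C_on_lincomb[OF ab openin_Icc_minus v2 w2])
  have T: "T_op p N (\<lambda>t. v t + c * w t) t = 0" if t: "t \<in> {a..b} - {s}" for t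
    using T_op_lincomb[OF openin_Icc_minus v2 w2 t, of N c] eq[OF t] Tv[OF t] T_op_shift[of N v t M] by simp
  \<comment> \<open>Since \<open>s\<close> is interior, both end points lie in the set on which the
    functions are of class \<open>C^n\<close>.\<close>
  have B: "B_op p i (\<lambda>t. v t + c * w t) = 0" if i: "i \<in> {1..n}" for i
    using B_op_lincomb[OF openin_Icc_minus v2 w2] Bv[OF i] Bw[OF i] s by simp
  have lim: "nderiv {a..b} (n - 1) (\<lambda>t. v t + c * w t) t
      = nderiv {a..b} (n - 1) v t + c * nderiv {a..b} (n - 1) w t" if "t \<in> {a..b} - {s}" for t
    by (rule nderiv_lincomb[OF ab openin_Icc_minus v2 w2]) (use that in auto)
  have evs: "eventually (\<lambda>t. nderiv {a..b} (n - 1) v t + c * nderiv {a..b} (n - 1) w t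
        = nderiv {a..b} (n - 1) (\<lambda>t. v t + c * w t) t) (at_left s)"
     "eventually (\<lambda>t. nderiv {a..b} (n - 1) v t + c * nderiv {a..b} (n - 1) w t
        = nderiv {a..b} (n - 1) (\<lambda>t. v t + c * w t) t) (at_right s)"
    using eventually_Icc_minus[OF s] by - (erule eventually_mono, rule lim[symmetric], assumption)+
  let ?l = "nderiv {a..b} (n - 1) w s"
  have l: "(nderiv {a..b} (n - 1) w \<longlongrightarrow> ?l) (at_right s)" "(nderiv {a..b} (n - 1) w \<longlongrightarrow> ?l) (at_left s)"
    by (rule C_on_tendsto[OF w]; use s in auto)+
  have "(nderiv {a..b} (n - 1) (\<lambda>t. v t + c * w t) \<longlongrightarrow> hp + c * ?l) (at_right s)"
    by (rule Lim_transform_eventually[OF _ evs(2)]) (intro tendsto_intros h l)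
  moreover have "(nderiv {a..b} (n - 1) (\<lambda>t. v t + c * w t) \<longlongrightarrow> hm + c * ?l) (at_left s)"
    by (rule Lim_transform_eventually[OF _ evs(1)]) (intro tendsto_intros h l)
  moreover have "(hp + c * ?l) - (hm + c * ?l) = 1" using h by simp
  ultimately show ?thesis
    unfolding green_section_def intv using c1 c2 T B by blast
qed

end

section \<open>Regularity of a single Green's function and the solution operator it defines\<close>

locale green_kernel = regular_bvp +
  fixes M :: real and g :: "real \<Rightarrow> real \<Rightarrow> real"
  assumes is_green: "is_green p M g"
begin

abbreviation "d j \<equiv> dt {a..b} j g"

lemma d_0: "d 0 = g"
  by (simp add: dt_def fun_eq_iff)

lemma section_green: "s \<in> {a<..<b} \<Longrightarrow> green_section p M s (\<lambda>t. g t s)"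
  using is_green by (auto simp: is_green_def)

lemma section_unique: "s \<in> {a<..<b} \<Longrightarrow> green_section p M s v \<Longrightarrow> t \<in> {a..b} \<Longrightarrow> v t = g t s"
  using is_green by (auto simp: is_green_def intv)

lemma d_continuous: "j \<le> n - 2 \<Longrightarrow> continuous_on ({a..b} \<times> {a..b}) (\<lambda>(t, s). d j t s)"
  and d_continuous_off: "j \<le> n \<Longrightarrow> continuous_on ({a..b} \<times> {a..b} - Id) (\<lambda>(t, s). d j t s)"
  using is_green by (auto simp: is_green_def kernel_C_on_def intv)

lemma g_continuous: "continuous_on ({a..b} \<times> {a..b}) (\<lambda>(t, s). g t s)"
  using d_continuous[of 0] by (simp add: d_0)

text \<open>Derived from the smoothness of the kernel rather than from \<open>green_section\<close>,
  and therefore valid also for \<open>s = a\<close> and \<open>s = b\<close>.\<close>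

lemma section_C: 
  assumes "s \<in> {a..b}"
  shows "C_on {a..b} (n - 2) {a..b} (\<lambda>t. g t s)" "C_on {a..b} n ({a..b} - {s}) (\<lambda>t. g t s)"
proof -
  show "C_on {a..b} (n - 2) {a..b} (\<lambda>t. g t s)"
    unfolding C_on_def
  proof (intro conjI allI ballI impI)
    fix j t assume "j < n - 2" "t \<in> {a..b}"
    then show "nderiv {a..b} j (\<lambda>t. g t s) differentiable (at t within {a..b})"
      using is_green assms by (auto simp: is_green_def kernel_C_on_def intv dt_def)
  next
    fix j assume "j \<le> n - 2"
    from continuous_on_section(2)[OF d_continuous[OF this] assms]
    show "continuous_on {a..b} (nderiv {a..b} j (\<lambda>t. g t s))" by (simp add: dt_def)
  qed
  show "C_on {a..b} n ({a..b} - {s}) (\<lambda>t. g t s)"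
    unfolding C_on_def
  proof (intro conjI allI ballI impI)
    fix j t assume j: "j < n" and t: "t \<in> {a..b} - {s}"
    have "\<forall>j<n. \<forall>(t, s)\<in>{a..b} \<times> {a..b} - Id. (\<lambda>r. d j r s) differentiable (at t within {a..b})"
      using is_green by (simp add: is_green_def kernel_C_on_def intv)
    moreover have "(t, s) \<in> {a..b} \<times> {a..b} - Id" using t assms by auto
    ultimately have "(\<lambda>r. d j r s) differentiable (at t within {a..b})" using j by blast
    then show "nderiv {a..b} j (\<lambda>t. g t s) differentiable (at t within {a..b})"
      by (simp add: dt_def)
  next
    fix j assume "j \<le> n"
    have "continuous_on ({a..b} - {s}) (\<lambda>t. (\<lambda>(t, s). d j t s) (t, s))"
      by (rule continuous_on_compose2[OF d_continuous_off[OF \<open>j \<le> n\<close>]])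
         (use assms in \<open>auto intro!: continuous_intros\<close>)
    then show "continuous_on ({a..b} - {s}) (nderiv {a..b} j (\<lambda>t. g t s))" by (simp add: dt_def)
  qed
qed

lemma d_deriv:
  assumes "j < n" "s \<in> {a..b}" "t \<in> {a..b} - {s}"
  shows "((\<lambda>r. d j r s) has_real_derivative d (Suc j) t s) (at t within {a..b})"
  using C_on_deriv[OF section_C(2)[OF assms(2)] assms(1,3)] by (simp only: dt_def)

lemma d_ode:
  assumes "s \<in> {a<..<b}" "t \<in> {a..b} - {s}"
  shows "d n t s + (\<Sum>k=1..n. coef p k t * d (n - k) t s) + M * g t s = 0"
  using section_green[OF assms(1)] assms by (simp add: green_section_def T_op_def intv dt_def)

lemma d_boundary:
  assumes "s \<in> {a<..<b}" "i \<in> {1..n}"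
  shows "(\<Sum>j<n. bl p i j * d j a s + br p i j * d j b s) = 0"
  using section_green[OF assms(1)] assms by (simp add: green_section_def B_op_def intv dt_def)

text \<open>Orders up to \<open>n - 2\<close> are continuous and jump by 0. Treating them together
  with order \<open>n - 1\<close> gives the form in which \<open>kint_has_derivative\<close> takes
  its jump \<open>c\<close>.\<close>

lemma d_jump:
  assumes j: "j < n" and s: "s \<in> {a<..<b}"
  shows "\<exists>hp hm. ((\<lambda>r. d j r s) \<longlongrightarrow> hp) (at_right s) \<and> ((\<lambda>r. d j r s) \<longlongrightarrow> hm) (at_left s) \<and>
     hp - hm = (if j = n - 1 then 1 else 0)"
proof (cases "j = n - 1")
  case True
  then show ?thesis using section_green[OF s] by (auto simp: green_section_def intv dt_def)
next
  case False
  then have "j \<le> n - 2" using j by auto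
  moreover have "s \<in> {a..b}" using s by auto
  ultimately show ?thesis
    using False C_on_tendsto[OF section_C(1)[of s], of j s] s unfolding dt_def by auto
qed

text \<open>Boundedness of \<open>\<partial>\<^sup>n\<^sup>-\<^sup>1g\<close> near the diagonal and the corners is not part of the definition. For
  fixed \<open>s\<close> the differential equation is of first order in \<open>\<partial>\<^sup>n\<^sup>-\<^sup>1g\<close>, with a bounded inhomogeneity; an
  integrating factor makes the solution Lipschitz up to the unit jump, uniformly in \<open>s\<close>, and the mean
  value theorem for \<open>\<partial>\<^sup>n\<^sup>-\<^sup>2g\<close> provides a point \<open>t0\<close> at which it is bounded.\<close>

lemma d_bkernel_top: "bkernel a b (d (n - 1))" "bkernel a b (d n)"
proof -
  note ab = lend_less_rend
  obtain m where m: "n = Suc (Suc m)" using order_ge2 by (metis add_2_eq_Suc le_Suc_ex)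
  \<comment> \<open>All terms of the differential equation except those of order \<open>n\<close>
    and \<open>n - 1\<close>; they are jointly continuous on the closed square, hence
    bounded.\<close>
  define f where "f t s = - (\<Sum>k=2..n. coef p k t * d (n - k) t s) - M * g t s" for t s
  have "continuous_on ({a..b} \<times> {a..b}) (\<lambda>x. coef p k (fst x) * d (n - k) (fst x) (snd x))" if "k \<in> {2..n}" for k
    using coef_continuous[of k] d_continuous[of "n - k"] that
    by (auto simp: case_prod_unfold intro!: continuous_intros continuous_on_compose2[of "{a..b}" "coef p k"])
  then have "continuous_on ({a..b} \<times> {a..b}) (\<lambda>(t, s). f t s)"
    unfolding f_def case_prod_unfold using g_continuous
    by (intro continuous_on_diff continuous_on_minus continuous_on_sum continuous_on_mult_left)
       (auto simp: case_prod_unfold)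
  then obtain F where F: "F > 0" "\<And>t s. t \<in> {a..b} \<Longrightarrow> s \<in> {a..b} \<Longrightarrow> \<bar>f t s\<bar> \<le> F"
    using bounded_continuous_on_square by blast
  have ode: "d n t s = f t s - coef p 1 t * d (n - 1) t s" if "s \<in> {a<..<b}" "t \<in> {a..b} - {s}" for s t
    using d_ode[OF that] sum.atLeast_Suc_atMost[of 1 n "\<lambda>k. coef p k t * d (n - k) t s"] order_ge2
    by (simp add: f_def numeral_2_eq_2)
  have c1: "continuous_on {a..b} (coef p 1)" using coef_continuous[of 1] order_ge2 by auto
  define A where "A t = integral {a..t} (coef p 1)" for t
  have A: "(A has_real_derivative coef p 1 t) (at t within {a..b})" if "t \<in> {a..b}" for t
    unfolding A_def by (rule integral_has_real_derivative[OF c1 that])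
  then have Acont: "continuous_on {a..b} A" using DERIV_continuous continuous_on_eq_continuous_within by blast
  obtain \<alpha> where \<alpha>: "\<alpha> \<ge> 0" "\<And>t. t \<in> {a..b} \<Longrightarrow> \<bar>A t\<bar> \<le> \<alpha>"
    using continuous_on_Icc_bounded[OF Acont] by blast
  have expA: "exp (A t) \<le> exp \<alpha>" "exp (-\<alpha>) \<le> exp (A t)" if "t \<in> {a..b}" for t
    using \<alpha>(2)[OF that] by auto
  obtain D where D: "D > 0" "\<And>t s. t \<in> {a..b} \<Longrightarrow> s \<in> {a..b} \<Longrightarrow> \<bar>d (n - 2) t s\<bar> \<le> D"
    using bounded_continuous_on_square[OF d_continuous[of "n - 2"]] by blast
  define q where "q = (b - a) / 4"
  have q: "q > 0" using ab by (simp add: q_def)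
  have start: "\<exists>t0\<in>{a..b} - {s}. \<bar>d (n - 1) t0 s\<bar> \<le> 2 * D / q" if s: "s \<in> {a<..<b}" for s
  proof -
    \<comment> \<open>The midpoint of \<open>{a..b}\<close> is \<open>a + 2 * q\<close>, so the
      outer quarter in the half opposite to \<open>s\<close> avoids \<open>s\<close>.\<close>
    define c where "c = (if s \<le> a + 2 * q then b - q else a)"
    have sub: "{c..c + q} \<subseteq> {a..b} - {s}"
      using s by (auto simp: c_def q_def field_simps split: if_splits)
    have "\<exists>l z. c < z \<and> z < c + q \<and> ((\<lambda>r. d (n - 2) r s) has_real_derivative l) (at z) \<and>
        d (n - 2) (c + q) s - d (n - 2) c s = (c + q - c) * l"
    proof (rule MVT)
      have "continuous_on ({a..b} - {s}) (\<lambda>r. d (n - 2) r s)"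
        using C_on_continuous[OF section_C(2)[of s], of "n - 2"] s by (simp add: dt_def)
      then show "continuous_on {c..c + q} (\<lambda>r. d (n - 2) r s)" using sub continuous_on_subset by blast
      fix z assume z: "c < z" "z < c + q"
      have "z \<in> {c..c + q}" using z by auto
      then have zz: "z \<in> {a..b} - {s}" "z \<in> {c<..<c+q}" using z sub by (blast, simp)
      have "((\<lambda>r. d (n - 2) r s) has_real_derivative d (Suc (n - 2)) z s) (at z within {a..b})"
        using d_deriv[of "n - 2" s z] zz s order_ge2 by auto
      moreover have "{c<..<c+q} \<subseteq> {a..b}"
        using sub greaterThanLessThan_subseteq_atLeastAtMost_iff[of c "c + q" c "c + q"] by blast
      then have "z \<in> interior {a..b}" using zz(2) by (meson interiorI open_greaterThanLessThan)
      ultimately show "(\<lambda>r. d (n - 2) r s) differentiable (at z)"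
        using at_within_interior real_differentiable_def by metis
    qed (use q in simp)
    then obtain l z where z: "c < z" "z < c + q" "((\<lambda>r. d (n - 2) r s) has_real_derivative l) (at z)"
       "d (n - 2) (c + q) s - d (n - 2) c s = q * l" by auto
    have "z \<in> {c..c + q}" using z by auto
    then have zz: "z \<in> {a..b} - {s}" using sub by blast
    have "((\<lambda>r. d (n - 2) r s) has_real_derivative d (n - 1) z s) (at z within {a..b})"
      using d_deriv[of "n - 2" s z] zz s m by auto
    moreover have "at z within {a..b} = at z"
    proof -
      have "{c<..<c+q} \<subseteq> {a..b}"
        using sub greaterThanLessThan_subseteq_atLeastAtMost_iff[of c "c + q" c "c + q"] by blast
      then have "z \<in> interior {a..b}" using z(1,2) by (meson interiorI open_greaterThanLessThan greaterThanLessThan_iff)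
      then show ?thesis by (rule at_within_interior)
    qed
    ultimately have "l = d (n - 1) z s" using z(3) DERIV_unique by metis
    moreover have "\<bar>q * l\<bar> \<le> 2 * D"
    proof -
      have "c \<in> {c..c + q}" "c + q \<in> {c..c + q}" using q by auto
      then have "c \<in> {a..b}" "c + q \<in> {a..b}" using sub by blast+
      then have "\<bar>d (n - 2) (c + q) s\<bar> \<le> D" "\<bar>d (n - 2) c s\<bar> \<le> D" using D(2) s by auto
      then show ?thesis using z(4) by linarith
    qed
    ultimately have "\<bar>d (n - 1) z s\<bar> \<le> 2 * D / q"
      using q by (simp add: abs_mult field_simps)
    then show ?thesis using zz by blast
  qed
  \<comment> \<open>The three summands bound the weighted value at \<open>t0\<close>, the Lipschitz
    variation over \<open>{a..b}\<close>, and the two jump corrections; the outer factor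
    \<open>exp \<alpha>\<close> undoes the weight.\<close>
  define Y where "Y = exp \<alpha> * (exp \<alpha> * (2 * D / q) + exp \<alpha> * F * (b - a) + 2 * exp \<alpha>)"
  have Y: "\<bar>d (n - 1) t s\<bar> \<le> Y" if s: "s \<in> {a<..<b}" and t: "t \<in> {a..b} - {s}" for s t
  proof -
    obtain t0 where t0: "t0 \<in> {a..b} - {s}" "\<bar>d (n - 1) t0 s\<bar> \<le> 2 * D / q" using start[OF s] by blast
    \<comment> \<open>The weight is the integrating factor that absorbs the term with
      \<open>coef p 1\<close>; the jump of \<open>z\<close> is \<open>exp (A s)\<close>.\<close>
    define z where "z t = exp (A t) * d (n - 1) t s" for t
    obtain hp hm where h: "((\<lambda>r. d (n - 1) r s) \<longlongrightarrow> hp) (at_right s)" "((\<lambda>r. d (n - 1) r s) \<longlongrightarrow> hm) (at_left s)"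
       "hp - hm = 1"
      using d_jump[of "n - 1" s] s order_ge2 by auto
    have dz: "(z has_real_derivative exp (A t) * f t s) (at t within {a..b})" if t: "t \<in> {a..b} - {s}" for t
    proof -
      have "((\<lambda>r. d (n - 1) r s) has_real_derivative d n t s) (at t within {a..b})"
        using d_deriv[of "n - 1" s t] t s m by auto
      moreover have "((\<lambda>r. exp (A r)) has_real_derivative exp (A t) * coef p 1 t) (at t within {a..b})"
        using A[of t] t by (auto intro!: derivative_eq_intros)
      ultimately have "((\<lambda>r. exp (A r) * d (n - 1) r s) has_real_derivative
          exp (A t) * coef p 1 t * d (n - 1) t s + d n t s * exp (A t)) (at t within {a..b})"
        by (intro DERIV_mult)
      moreover have "exp (A t) * coef p 1 t * d (n - 1) t s + d n t s * exp (A t) = exp (A t) * f t s"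
        unfolding ode[OF s t] by (simp add: algebra_simps)
      ultimately show ?thesis by (simp only: z_def[abs_def])
    qed
    have "isCont A s"
      using Acont s by (simp add: continuous_on_eq_continuous_at continuous_on_interior)
    then have As: "(A \<longlongrightarrow> A s) (at_left s)" "(A \<longlongrightarrow> A s) (at_right s)"
      by (auto simp: isCont_def filterlim_at_split)
    have zp: "(z \<longlongrightarrow> exp (A s) * hp) (at_right s)" and zm: "(z \<longlongrightarrow> exp (A s) * hm) (at_left s)"
      unfolding z_def[abs_def] by (intro tendsto_intros As h)+
    have j: "exp (A s) * hp - exp (A s) * hm = exp (A s)" using h(3) by (simp add: algebra_simps)
    have "\<bar>(z t - (if s < t then exp (A s) * hp - exp (A s) * hm else 0)) -
        (z t0 - (if s < t0 then exp (A s) * hp - exp (A s) * hm else 0))\<bar> \<le> exp \<alpha> * F * \<bar>t - t0\<bar>"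
    proof (rule lipschitz_off_jump[OF s dz _ zp zm t t0(1)])
      fix t assume "t \<in> {a..b} - {s}"
      then show "\<bar>exp (A t) * f t s\<bar> \<le> exp \<alpha> * F"
        unfolding abs_mult using F(2)[of t s] s expA(1)[of t] by (intro mult_mono) auto
    qed
    also have "\<dots> \<le> exp \<alpha> * F * (b - a)"
      using t t0 F by (intro mult_left_mono) auto
    finally have le: "\<bar>(z t - (if s < t then exp (A s) else 0)) - (z t0 - (if s < t0 then exp (A s) else 0))\<bar>
        \<le> exp \<alpha> * F * (b - a)"
      unfolding j .
    have "0 \<le> (if s < r then exp (A s) else 0)" "(if s < r then exp (A s) else 0) \<le> exp \<alpha>" for r
      using expA(1)[of s] s by auto
    from le this[of t] this[of t0] have "\<bar>z t\<bar> \<le> \<bar>z t0\<bar> + exp \<alpha> * F * (b - a) + 2 * exp \<alpha>"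
      by linarith
    also have "\<bar>z t0\<bar> \<le> exp \<alpha> * (2 * D / q)"
      unfolding z_def abs_mult using t0 expA(1)[of t0] by (intro mult_mono) auto
    finally have "\<bar>z t\<bar> \<le> exp \<alpha> * (2 * D / q) + exp \<alpha> * F * (b - a) + 2 * exp \<alpha>" by simp
    moreover have "\<bar>d (n - 1) t s\<bar> = exp (- A t) * \<bar>z t\<bar>"
      by (simp add: z_def abs_mult exp_minus field_simps)
    moreover have "exp (- A t) \<le> exp \<alpha>" using \<alpha>(2)[of t] t by auto
    ultimately show ?thesis unfolding Y_def by (auto intro!: mult_mono)
  qed
  then show "bkernel a b (d (n - 1))"
    unfolding bkernel_def using d_continuous_off[of "n - 1"] by (intro conjI exI[of _ Y]) auto
  obtain \<gamma> where \<gamma>: "\<gamma> \<ge> 0" "\<And>t. t \<in> {a..b} \<Longrightarrow> \<bar>coef p 1 t\<bar> \<le> \<gamma>"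
    using continuous_on_Icc_bounded[OF c1] by blast
  have "\<bar>d n t s\<bar> \<le> F + \<gamma> * Y" if s: "s \<in> {a<..<b}" and t: "t \<in> {a..b}" "t \<noteq> s" for s t
  proof -
    have "\<bar>coef p 1 t * d (n - 1) t s\<bar> \<le> \<gamma> * Y"
      unfolding abs_mult using \<gamma> Y[of s t] s t by (intro mult_mono) auto
    then show ?thesis using ode[of s t] F(2)[of t s] s t by auto
  qed
  then show "bkernel a b (d n)"
    unfolding bkernel_def using d_continuous_off[of n] by (intro conjI exI[of _ "F + \<gamma> * Y"]) auto
qed

lemma d_bkernel: "j \<le> n \<Longrightarrow> bkernel a b (d j)"
proof -
  assume "j \<le> n"
  then consider "j \<le> n - 2" | "j = n - 1" | "j = n" by linarith
  then show ?thesis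
    using d_bkernel_top bkernelI_continuous[OF d_continuous] by cases auto
qed

lemma g_bkernel: "bkernel a b g"
  using d_bkernel[of 0] by (simp add: d_0)

text \<open>Differentiation under the integral produces no extra term until the jumping derivative
  of order \<open>n - 1\<close> is differentiated, which contributes \<open>\<sigma>\<close>. The
  operator and the boundary conditions then act on the kernel alone, where they vanish for interior
  \<open>r\<close> different from \<open>t\<close>.\<close>

lemma
  assumes \<sigma>: "continuous_on {a..b} \<sigma>"
  shows solution_C: "C_on {a..b} n {a..b} (kint a b g \<sigma>)"
    and solution_nderiv: "\<And>j t. j < n \<Longrightarrow> t \<in> {a..b} \<Longrightarrow> nderiv {a..b} j (kint a b g \<sigma>) t = kint a b (d j) \<sigma> t"
    and solution_nderiv_order: "\<And>t. t \<in> {a..b} \<Longrightarrow> nderiv {a..b} n (kint a b g \<sigma>) t = kint a b (d n) \<sigma> t + \<sigma> t"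
    and solution_T: "\<And>t. t \<in> {a..b} \<Longrightarrow> T_op p M (kint a b g \<sigma>) t = \<sigma> t"
    and solution_B: "\<And>i. i \<in> {1..n} \<Longrightarrow> B_op p i (kint a b g \<sigma>) = 0"
proof -
  note ab = lend_less_rend
  define f where "f j t = kint a b (d j) \<sigma> t + (if j = n then 1 else 0) * \<sigma> t" for j t
  have der: "(f j has_real_derivative f (Suc j) t) (at t within {a..b})" if j: "j < n" and t: "t \<in> {a..b}" for j t
  proof -
    have e: "f j = kint a b (d j) \<sigma>" using j by (simp add: f_def fun_eq_iff)
    have e': "f (Suc j) t = kint a b (d (Suc j)) \<sigma> t + (if j = n - 1 then 1 else 0) * \<sigma> t"
      using order_ge2 by (auto simp: f_def)
    show ?thesis unfolding e e'
    proof (rule kint_has_derivative[OF ab _ _ \<sigma> _ _ t])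
      show "((\<lambda>r. d j r s) has_real_derivative d (Suc j) t s) (at t within {a..b})"
        if "s \<in> {a<..<b}" "t \<in> {a..b} - {s}" for s t
        using d_deriv[OF j, of s t] that by auto
    qed (use j d_bkernel d_jump[OF j] in auto)
  qed
  have f0: "kint a b g \<sigma> t = f 0 t" for t using order_ge2 by (auto simp: f_def d_0)
  have fn: "continuous_on {a..b} (f n)"
    unfolding f_def[abs_def] using \<sigma> by (intro continuous_intros kint_continuous d_bkernel) auto
  show "C_on {a..b} n {a..b} (kint a b g \<sigma>)"
    by (rule C_on_chain[where f = f, OF ab _ f0 der fn]) auto
  have nd: "nderiv {a..b} j (kint a b g \<sigma>) t = f j t" if "j \<le> n" "t \<in> {a..b}" for j t
    by (rule nderiv_chain[where f = f and k = n and U = "{a..b}", OF ab _ f0 der]) (use that in auto)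
  show nd': "nderiv {a..b} j (kint a b g \<sigma>) t = kint a b (d j) \<sigma> t" if "j < n" "t \<in> {a..b}" for j t
    using nd[of j t] that by (simp add: f_def)
  show "nderiv {a..b} n (kint a b g \<sigma>) t = kint a b (d n) \<sigma> t + \<sigma> t" if "t \<in> {a..b}" for t
    using nd[of n t] that by (simp add: f_def)
  show "T_op p M (kint a b g \<sigma>) t = \<sigma> t" if t: "t \<in> {a..b}" for t
  proof -
    \<comment> \<open>The leading coefficient 1 is stored at \<open>k = 0\<close> and the parameter
      \<open>M\<close> is added at \<open>k = n\<close>, so that the operator becomes a single sum
      to which \<open>kint_sum\<close> applies.\<close>
    define c where "c k = (if k = 0 then 1 else coef p k t) + (if k = n then M else 0)" for k
    have "T_op p M (kint a b g \<sigma>) t = \<sigma> t + (kint a b (d n) \<sigma> t + (\<Sum>k=1..n. coef p k t * kint a b (d (n - k)) \<sigma> t)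
        + M * kint a b (d 0) \<sigma> t)"
      using nd'[OF _ t] nd[of n t] t order_ge2 unfolding T_op_def intv
      by (auto simp: f_def d_0 intro!: sum.cong)
    also have "(kint a b (d n) \<sigma> t + (\<Sum>k=1..n. coef p k t * kint a b (d (n - k)) \<sigma> t)
        + M * kint a b (d 0) \<sigma> t) = (\<Sum>k=0..n. c k * kint a b (d (n - k)) \<sigma> t)"
    proof -
      have "(\<Sum>k=0..n. c k * kint a b (d (n - k)) \<sigma> t)
         = kint a b (d n) \<sigma> t + (\<Sum>k=1..n. c k * kint a b (d (n - k)) \<sigma> t)"
        using order_ge2 by (subst sum.atLeast_Suc_atMost) (auto simp: c_def)
      also have "(\<Sum>k=1..n. c k * kint a b (d (n - k)) \<sigma> t)
         = (\<Sum>k=1..n. coef p k t * kint a b (d (n - k)) \<sigma> t) + (\<Sum>k=1..n. if k = n then M * kint a b (d (n - k)) \<sigma> t else 0)"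
        unfolding sum.distrib[symmetric] by (rule sum.cong) (auto simp: c_def algebra_simps)
      also have "(\<Sum>k=1..n. if k = n then M * kint a b (d (n - k)) \<sigma> t else 0) = M * kint a b (d 0) \<sigma> t"
        using order_ge2 by (simp add: sum.delta)
      finally show ?thesis by simp
    qed
    also have "(\<Sum>k=0..n. c k * kint a b (d (n - k)) \<sigma> t) = (LINT r:{a<..<b}|lborel. (\<Sum>k=0..n. c k * d (n - k) t r) * \<sigma> r)"
      by (rule kint_sum) (use d_bkernel \<sigma> t in auto)
    also have "\<dots> = 0"
    proof (rule LINT_zero[where X = "{t}"])
      fix r assume r: "r \<in> {a<..<b} - {t}"
      have "(\<Sum>k=0..n. c k * d (n - k) t r)
         = d n t r + (\<Sum>k=1..n. c k * d (n - k) t r)"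
        using order_ge2 by (subst sum.atLeast_Suc_atMost) (auto simp: c_def)
      also have "(\<Sum>k=1..n. c k * d (n - k) t r)
         = (\<Sum>k=1..n. coef p k t * d (n - k) t r) + (\<Sum>k=1..n. if k = n then M * d (n - k) t r else 0)"
        unfolding sum.distrib[symmetric] by (rule sum.cong) (auto simp: c_def algebra_simps)
      also have "(\<Sum>k=1..n. if k = n then M * d (n - k) t r else 0) = M * g t r"
        using order_ge2 by (simp add: sum.delta d_0)
      finally have "(\<Sum>k=0..n. c k * d (n - k) t r) = 0"
        using d_ode[of r t] r t by auto
      then show "(\<Sum>k=0..n. c k * d (n - k) t r) * \<sigma> r = 0" by simp
    qed simp
    finally show ?thesis by simp
  qed
  show "B_op p i (kint a b g \<sigma>) = 0" if i: "i \<in> {1..n}" for i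
  proof -
    have "B_op p i (kint a b g \<sigma>) = (\<Sum>j<n. bl p i j * kint a b (d j) \<sigma> a) + (\<Sum>j<n. br p i j * kint a b (d j) \<sigma> b)"
      unfolding B_op_def intv using nd' ab by (simp add: sum.distrib)
    also have "(\<Sum>j<n. bl p i j * kint a b (d j) \<sigma> a) = (LINT r:{a<..<b}|lborel. (\<Sum>j<n. bl p i j * d j a r) * \<sigma> r)"
      by (rule kint_sum) (use d_bkernel \<sigma> ab in auto)
    also have "(\<Sum>j<n. br p i j * kint a b (d j) \<sigma> b) = (LINT r:{a<..<b}|lborel. (\<Sum>j<n. br p i j * d j b r) * \<sigma> r)"
      by (rule kint_sum) (use d_bkernel \<sigma> ab in auto)
    also have "(LINT r:{a<..<b}|lborel. (\<Sum>j<n. bl p i j * d j a r) * \<sigma> r)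
        + (LINT r:{a<..<b}|lborel. (\<Sum>j<n. br p i j * d j b r) * \<sigma> r)
      = (LINT r:{a<..<b}|lborel. (\<Sum>j<n. bl p i j * d j a r) * \<sigma> r + (\<Sum>j<n. br p i j * d j b r) * \<sigma> r)"
      by (rule set_integral_add(2)[symmetric]; rule kint_sum_integrable) (use d_bkernel \<sigma> ab in auto)
    also have "\<dots> = 0"
      by (rule LINT_zero[where X = "{}"])
         (use d_boundary[OF _ i] in \<open>auto simp: sum.distrib distrib_right[symmetric]\<close>)
    finally show ?thesis .
  qed
qed

text \<open>Adding a solution of the homogeneous problem to \<open>g(\<cdot>,s)\<close> gives another section of the Green's
  function, so uniqueness of the sections is uniqueness for the boundary value problem.\<close>

lemma homogeneous_zero:
  assumes "C_on {a..b} n {a..b} w" "\<And>t. t \<in> {a..b} \<Longrightarrow> T_op p M w t = 0"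
    "\<And>i. i \<in> {1..n} \<Longrightarrow> B_op p i w = 0" "t \<in> {a..b}"
  shows "w t = 0"
proof -
  have s: "(a + b) / 2 \<in> {a<..<b}" using lend_less_rend by auto
  have "green_section p M ((a + b) / 2) (\<lambda>t. g t ((a + b) / 2) + 1 * w t)"
    by (rule green_section_add[OF s section_green[OF s]]) (use assms in auto)
  from section_unique[OF s this assms(4)] show ?thesis by simp
qed

lemma solution_unique:
  assumes u: "C_on {a..b} n {a..b} u" and "continuous_on {a..b} \<sigma>" "\<And>t. t \<in> {a..b} \<Longrightarrow> T_op p M u t = \<sigma> t"
    "\<And>i. i \<in> {1..n} \<Longrightarrow> B_op p i u = 0" "t \<in> {a..b}"
  shows "u t = kint a b g \<sigma> t"
proof -
  note s = solution_C[OF assms(2)]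
  let ?w = "\<lambda>t. u t + (-1) * kint a b g \<sigma> t"
  have "?w t = 0"
  proof (rule homogeneous_zero[of ?w])
    show "C_on {a..b} n {a..b} ?w"
      by (rule C_on_lincomb[OF lend_less_rend _ u s]) auto
    show "T_op p M ?w t = 0" if "t \<in> {a..b}" for t
      using T_op_lincomb[OF _ u s that, of M "-1"] that assms(3) solution_T[OF assms(2)] by simp
    show "B_op p i ?w = 0" if "i \<in> {1..n}" for i
      using B_op_lincomb[OF _ u s, of i "-1"] that assms(4) solution_B[OF assms(2)] lend_less_rend by simp
  qed fact
  then show ?thesis by simp
qed

end

section \<open>Perturbation of the parameter\<close>

text \<open>Starting from 0 makes step \<open>k\<close> the partial sum of the first
  \<open>k\<close> terms of the Neumann series for \<open>R = g + c * kint a b g R\<close>.\<close>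

primrec neumann :: "real \<Rightarrow> real \<Rightarrow> real \<Rightarrow> (real \<Rightarrow> real \<Rightarrow> real) \<Rightarrow> nat \<Rightarrow> real \<Rightarrow> real \<Rightarrow> real" where
  "neumann a b c g 0 = (\<lambda>t s. 0)"
| "neumann a b c g (Suc k) = (\<lambda>t s. g t s + c * kint a b g (\<lambda>r. neumann a b c g k r s) t)"

text \<open>The integral operator times \<open>c\<close> has norm at most 1/2, so consecutive
  iterates differ by at most \<open>C * (1 / 2) ^ k\<close> and converge uniformly. Nonnegativity of
  \<open>c\<close> and \<open>g\<close> passes to every iterate and to the limit.\<close>

lemma neumann_solution:
  fixes g :: "real \<Rightarrow> real \<Rightarrow> real"
  assumes ab: "a < b" and g: "continuous_on ({a..b} \<times> {a..b}) (\<lambda>(t, s). g t s)"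
    and C: "\<And>t s. t \<in> {a..b} \<Longrightarrow> s \<in> {a..b} \<Longrightarrow> \<bar>g t s\<bar> \<le> C" and small: "\<bar>c\<bar> * (b - a) * C \<le> 1 / 2"
  obtains R where "continuous_on ({a..b} \<times> {a..b}) (\<lambda>(t, s). R t s)"
    "\<forall>s\<in>{a..b}. \<forall>t. R t s = g t s + c * kint a b g (\<lambda>r. R r s) t"
    "c \<ge> 0 \<and> (\<forall>t\<in>{a..b}. \<forall>s\<in>{a..b}. g t s \<ge> 0) \<longrightarrow> (\<forall>t\<in>{a..b}. \<forall>s\<in>{a..b}. R t s \<ge> 0)"
proof -
  let ?S = "neumann a b c g"
  let ?Q = "{a..b} \<times> {a..b}"
  have C0: "C \<ge> 0" using C[of a a] ab by auto
  note gb = bkernelI_continuous[OF g]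
  have cont: "continuous_on ?Q (\<lambda>(t, s). ?S k t s)" for k
  proof (induction k)
    case (Suc k)
    have "continuous_on ?Q (\<lambda>x. (\<lambda>(t, s). g t s) x + c * (\<lambda>(t, s). kint a b g (\<lambda>r. ?S k r s) t) x)"
      by (intro continuous_intros g kint_jointly_continuous gb Suc)
    then show ?case by (simp add: case_prod_unfold)
  qed (simp add: case_prod_unfold)
  note sec = continuous_on_section(2)[OF cont]
  have step: "?S (Suc k) t s = g t s + c * kint a b g (\<lambda>r. ?S k r s) t" for k t s
    by simp
  have diff: "\<bar>?S (Suc k) t s - ?S k t s\<bar> \<le> C * (1 / 2) ^ k" if "t \<in> {a..b}" "s \<in> {a..b}" for k t s
    using that
  proof (induction k arbitrary: t s)
    case 0
    then show ?case using C by (simp add: kint_def)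
  next
    case (Suc k)
    have "kint a b g (\<lambda>r. ?S (Suc k) r s + (-1) * ?S k r s) t
      = kint a b g (\<lambda>r. ?S (Suc k) r s) t + (-1) * kint a b g (\<lambda>r. ?S k r s) t"
      by (rule kint_lincomb[OF gb sec sec]) (use Suc.prems in auto)
    moreover have "?S (Suc (Suc k)) t s - ?S (Suc k) t s
      = c * kint a b g (\<lambda>r. ?S (Suc k) r s) t - c * kint a b g (\<lambda>r. ?S k r s) t"
      using step[of "Suc k" t s] step[of k t s] by linarith
    ultimately have "?S (Suc (Suc k)) t s - ?S (Suc k) t s = c * kint a b g (\<lambda>r. ?S (Suc k) r s + (-1) * ?S k r s) t"
      by (simp only: right_diff_distrib[symmetric] mult_minus1 add_uminus_conv_diff)
    also have "\<bar>\<dots>\<bar> \<le> \<bar>c\<bar> * ((b - a) * C * (C * (1 / 2) ^ k))"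
      unfolding abs_mult
    proof (intro mult_left_mono kint_bound gb)
      show "continuous_on {a..b} (\<lambda>r. ?S (Suc k) r s + - 1 * ?S k r s)"
        using Suc.prems by (intro continuous_intros sec)
      show "\<bar>?S (Suc k) r s + - 1 * ?S k r s\<bar> \<le> C * (1 / 2) ^ k" if "r \<in> {a<..<b}" for r
        using Suc.IH[of r s] that Suc.prems by simp
    qed (use Suc.prems C ab C0 in auto)
    also have "\<dots> = (\<bar>c\<bar> * (b - a) * C) * (C * (1 / 2) ^ k)" by simp
    also have "\<dots> \<le> (1 / 2) * (C * (1 / 2) ^ k)"
      by (intro mult_right_mono small) (use C0 in auto)
    finally show ?case by simp
  qed
  have nn: "?S k t s \<ge> 0" if "c \<ge> 0" "\<And>t s. t \<in> {a..b} \<Longrightarrow> s \<in> {a..b} \<Longrightarrow> g t s \<ge> 0"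
    "t \<in> {a..b}" "s \<in> {a..b}" for k t s
    using that(3,4)
  proof (induction k arbitrary: t s)
    case (Suc k)
    then have "0 \<le> kint a b g (\<lambda>r. ?S k r s) t"
      using that by (intro kint_nonneg gb sec) auto
    then show ?case using that Suc.prems by simp
  qed simp
  define f where "f i x = (case x of (t, s) \<Rightarrow> ?S (Suc i) t s - ?S i t s)" for i and x :: "real \<times> real"
  define L where "L x = (\<Sum>i. f i x)" for x
  have "uniform_limit ?Q (\<lambda>k x. \<Sum>i<k. f i x) L sequentially"
    unfolding L_def
  proof (rule Weierstrass_m_test)
    show "norm (f k x) \<le> C * (1 / 2) ^ k" if "x \<in> ?Q" for k x
      using diff that unfolding f_def by (auto simp del: neumann.simps)
    show "summable (\<lambda>k. C * (1 / 2) ^ k)" by (intro summable_mult summable_geometric) simp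
  qed
  moreover have "(\<Sum>i<k. f i x) = ?S k (fst x) (snd x)" for k x
    unfolding f_def case_prod_unfold by (subst sum_lessThan_telescope) simp
  ultimately have ul: "uniform_limit ?Q (\<lambda>k x. ?S k (fst x) (snd x)) L sequentially" by simp
  have Lc: "continuous_on ?Q L"
    by (rule uniform_limit_theorem[OF _ ul]) (use cont in \<open>auto simp: case_prod_unfold\<close>)
  have lim: "(\<lambda>k. ?S k t s) \<longlonglongrightarrow> L (t, s)" if "t \<in> {a..b}" "s \<in> {a..b}" for t s
    using tendsto_uniform_limitI[OF ul, of "(t, s)"] that by simp
  have bd: "\<bar>?S k t s\<bar> \<le> 2 * C" if "t \<in> {a..b}" "s \<in> {a..b}" for k t s
    using that
  proof (induction k arbitrary: t s)
    case (Suc k)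
    have "\<bar>c * kint a b g (\<lambda>r. ?S k r s) t\<bar> \<le> \<bar>c\<bar> * ((b - a) * C * (2 * C))"
      unfolding abs_mult using Suc C C0 ab
      by (intro mult_left_mono kint_bound gb sec) auto
    also have "\<dots> = (\<bar>c\<bar> * (b - a) * C) * (2 * C)" by simp
    also have "\<dots> \<le> (1 / 2) * (2 * C)" by (intro mult_right_mono small) (use C0 in auto)
    finally show ?case using C[OF Suc.prems] by simp
  qed (use C0 in simp)
  have Lsec: "continuous_on {a..b} (\<lambda>r. L (r, s))" if "s \<in> {a..b}" for s
    by (rule continuous_on_compose2[OF Lc]) (use that in \<open>auto intro!: continuous_intros\<close>)
  have eq: "L (t, s) = g t s + c * kint a b g (\<lambda>r. L (r, s)) t" if ts: "t \<in> {a..b}" "s \<in> {a..b}" for t s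
  proof -
    have "(\<lambda>k. kint a b g (\<lambda>r. ?S k r s) t) \<longlonglongrightarrow> kint a b g (\<lambda>r. L (r, s)) t"
      unfolding kint_def
    proof (rule LINT_dominated[where X = "{}" and C = "C * (2 * C)"])
      show "\<bar>g t x * ?S k x s\<bar> \<le> C * (2 * C)" if "x \<in> {a<..<b} - {}" for k x
        unfolding abs_mult by (intro mult_mono C bd) (use that ts C0 in auto)
      show "(\<lambda>k. g t x * ?S k x s) \<longlonglongrightarrow> g t x * L (x, s)" if "x \<in> {a<..<b} - {}" for x
        by (intro tendsto_intros lim) (use that ts in auto)
    qed (use ts in \<open>auto intro!: kint_integrable gb sec Lsec\<close>)
    then have "(\<lambda>k. ?S (Suc k) t s) \<longlonglongrightarrow> g t s + c * kint a b g (\<lambda>r. L (r, s)) t"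
      by (auto intro!: tendsto_intros)
    moreover have "(\<lambda>k. ?S (Suc k) t s) \<longlonglongrightarrow> L (t, s)"
      using lim[OF ts] by (rule LIMSEQ_Suc)
    ultimately show ?thesis using LIMSEQ_unique by blast
  qed
  \<comment> \<open>On the square this is the limit \<open>L\<close>. Defining it by the right-hand
    side makes the identity hold for all real \<open>t\<close>, so that it can be used as an
    equation between functions.\<close>
  define R where "R t s = g t s + c * kint a b g (\<lambda>r. L (r, s)) t" for t s
  have RL: "R t s = L (t, s)" if "t \<in> {a..b}" "s \<in> {a..b}" for t s
    using eq[OF that] by (simp add: R_def)
  show ?thesis
  proof (rule that[of R])
    show "continuous_on ?Q (\<lambda>(t, s). R t s)"
      using Lc by (rule continuous_on_cong[THEN iffD1, rotated -1]) (auto simp: RL)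
    show "\<forall>s\<in>{a..b}. \<forall>t. R t s = g t s + c * kint a b g (\<lambda>r. R r s) t"
    proof (intro ballI allI)
      fix s t assume "s \<in> {a..b}"
      then have "kint a b g (\<lambda>r. L (r, s)) t = kint a b g (\<lambda>r. R r s) t"
        by (intro kint_cong) (use RL in auto)
      then show "R t s = g t s + c * kint a b g (\<lambda>r. R r s) t" by (simp add: R_def)
    qed
    show "c \<ge> 0 \<and> (\<forall>t\<in>{a..b}. \<forall>s\<in>{a..b}. g t s \<ge> 0) \<longrightarrow> (\<forall>t\<in>{a..b}. \<forall>s\<in>{a..b}. R t s \<ge> 0)"
    proof (intro impI ballI)
      fix t s assume pos: "c \<ge> 0 \<and> (\<forall>t\<in>{a..b}. \<forall>s\<in>{a..b}. g t s \<ge> 0)" and ts: "t \<in> {a..b}" "s \<in> {a..b}"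
      show "R t s \<ge> 0"
        unfolding RL[OF ts] by (rule LIMSEQ_le_const[OF lim[OF ts]]) (use nn[of t s] pos ts in auto)
    qed
  qed
qed

text \<open>At a maximum point of its modulus, \<open>w\<close> is bounded by half of that
  maximum.\<close>

lemma kint_fixpoint_zero:
  fixes g :: "real \<Rightarrow> real \<Rightarrow> real"
  assumes ab: "a < b" and g: "continuous_on ({a..b} \<times> {a..b}) (\<lambda>(t, s). g t s)"
    and C: "\<And>t s. t \<in> {a..b} \<Longrightarrow> s \<in> {a..b} \<Longrightarrow> \<bar>g t s\<bar> \<le> C" and small: "\<bar>c\<bar> * (b - a) * C \<le> 1 / 2"
    and w: "continuous_on {a..b} w" and eq: "\<And>t. t \<in> {a..b} \<Longrightarrow> w t = c * kint a b g w t" and t: "t \<in> {a..b}"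
  shows "w t = 0"
proof -
  have C0: "C \<ge> 0" using C[of a a] ab by auto
  have "continuous_on {a..b} (\<lambda>t. \<bar>w t\<bar>)" using w by (intro continuous_intros)
  then obtain t0 where t0: "t0 \<in> {a..b}" "\<And>t. t \<in> {a..b} \<Longrightarrow> \<bar>w t\<bar> \<le> \<bar>w t0\<bar>"
    using continuous_attains_sup[of "{a..b}" "\<lambda>t. \<bar>w t\<bar>"] ab by auto
  have "\<bar>w t0\<bar> = \<bar>c\<bar> * \<bar>kint a b g w t0\<bar>" using eq[OF t0(1)] by (metis abs_mult)
  also have "\<dots> \<le> \<bar>c\<bar> * ((b - a) * C * \<bar>w t0\<bar>)"
    using t0 ab C C0 w by (intro mult_left_mono kint_bound bkernelI_continuous[OF g]) auto
  also have "\<dots> = (\<bar>c\<bar> * (b - a) * C) * \<bar>w t0\<bar>" by simp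
  also have "\<dots> \<le> (1 / 2) * \<bar>w t0\<bar>" by (intro mult_right_mono small) auto
  finally have "w t0 = 0" by simp
  then show ?thesis using t0(2)[OF t] by simp
qed

section \<open>Green's functions for neighbouring parameters\<close>

context green_kernel
begin

text \<open>The integral term is of class \<open>C^n\<close> in \<open>t\<close>, so
  \<open>R\<close> inherits the diagonal behaviour of \<open>g\<close>, and applying the operator to
  it gives the equation for \<open>M - c\<close>. Conversely, any section \<open>v\<close> for
  \<open>M - c\<close> becomes a section for \<open>M\<close> after subtracting
  \<open>c * kint a b g v\<close>; uniqueness for \<open>M\<close> shows that \<open>v\<close>
  solves the same integral equation as \<open>R\<close>, and \<open>inj\<close> makes the two
  equal.\<close>

lemma is_green_resolvent:
  assumes R: "continuous_on ({a..b} \<times> {a..b}) (\<lambda>(t, s). R t s)"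
    and eq: "\<And>t s. s \<in> {a..b} \<Longrightarrow> R t s = g t s + c * kint a b g (\<lambda>r. R r s) t"
    and inj: "\<And>w t. continuous_on {a..b} w \<Longrightarrow> (\<And>t. t \<in> {a..b} \<Longrightarrow> w t = c * kint a b g w t) \<Longrightarrow>
        t \<in> {a..b} \<Longrightarrow> w t = 0"
  shows "is_green p (M - c) R"
proof -
  note ab = lend_less_rend
  define K where "K s = kint a b g (\<lambda>r. R r s)" for s
  have Rs: "continuous_on {a..b} (\<lambda>r. R r s)" if "s \<in> {a..b}" for s
    using continuous_on_section(2)[OF R that] .
  have Req: "(\<lambda>t. R t s) = (\<lambda>t. g t s + c * K s t)" if "s \<in> {a..b}" for s
    unfolding K_def by (rule ext) (rule eq[OF that])
  have KC: "C_on {a..b} n {a..b} (K s)" if "s \<in> {a..b}" for s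
    unfolding K_def by (rule solution_C[OF Rs[OF that]])
  have C1: "C_on {a..b} (n - 2) {a..b} (\<lambda>t. R t s)" and C2: "C_on {a..b} n ({a..b} - {s}) (\<lambda>t. R t s)"
    and N1: "\<And>j t. j \<le> n - 2 \<Longrightarrow> t \<in> {a..b} \<Longrightarrow> dt {a..b} j R t s = d j t s + c * nderiv {a..b} j (K s) t"
    and N2: "\<And>j t. j \<le> n \<Longrightarrow> t \<in> {a..b} - {s} \<Longrightarrow> dt {a..b} j R t s = d j t s + c * nderiv {a..b} j (K s) t"
    if s: "s \<in> {a..b}" for s
  proof -
    have k1: "C_on {a..b} (n - 2) {a..b} (K s)" and k2: "C_on {a..b} n ({a..b} - {s}) (K s)"
      by (rule C_on_mono[OF KC[OF s]]; auto)+
    have o: "openin (top_of_set {a..b}) {a..b}" by simp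
    show "C_on {a..b} (n - 2) {a..b} (\<lambda>t. R t s)"
      unfolding Req[OF s] by (rule C_on_lincomb[OF ab o section_C(1)[OF s] k1])
    show "C_on {a..b} n ({a..b} - {s}) (\<lambda>t. R t s)"
      unfolding Req[OF s] by (rule C_on_lincomb[OF ab openin_Icc_minus section_C(2)[OF s] k2])
    show "dt {a..b} j R t s = d j t s + c * nderiv {a..b} j (K s) t" if "j \<le> n - 2" "t \<in> {a..b}" for j t
      unfolding dt_def Req[OF s] by (rule nderiv_lincomb[OF ab o section_C(1)[OF s] k1 that])
    show "dt {a..b} j R t s = d j t s + c * nderiv {a..b} j (K s) t" if "j \<le> n" "t \<in> {a..b} - {s}" for j t
      unfolding dt_def Req[OF s] by (rule nderiv_lincomb[OF ab openin_Icc_minus section_C(2)[OF s] k2 that])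
  qed
  \<comment> \<open>At order \<open>n\<close> the inhomogeneity \<open>R t s\<close> itself appears;
    it is continuous on the square, so all derivatives of \<open>K s\<close> up to order
    \<open>n\<close> are jointly continuous.\<close>
  have Kd: "nderiv {a..b} j (K s) t = kint a b (d j) (\<lambda>r. R r s) t + (if j = n then R t s else 0)"
    if "j \<le> n" "t \<in> {a..b}" "s \<in> {a..b}" for j t s
    unfolding K_def using solution_nderiv[OF Rs[OF that(3)], of j t] solution_nderiv_order[OF Rs[OF that(3)], of t] that
    by auto
  have Kc: "continuous_on ({a..b} \<times> {a..b}) (\<lambda>(t, s). nderiv {a..b} j (K s) t)" if "j \<le> n" for j
  proof -
    have "continuous_on ({a..b} \<times> {a..b})
        (\<lambda>x. (\<lambda>(t, s). kint a b (d j) (\<lambda>r. R r s) t) x + (if j = n then (\<lambda>(t, s). R t s) x else 0))"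
      using that by (cases "j = n") (auto intro!: continuous_intros kint_jointly_continuous d_bkernel R)
    then show ?thesis
      by (rule continuous_on_cong[THEN iffD1, rotated -1]) (use Kd[OF that] in auto)
  qed
  have c1: "continuous_on ({a..b} \<times> {a..b}) (\<lambda>(t, s). dt {a..b} j R t s)" if "j \<le> n - 2" for j
  proof -
    have "continuous_on ({a..b} \<times> {a..b}) (\<lambda>x. (\<lambda>(t, s). d j t s) x + c * (\<lambda>(t, s). nderiv {a..b} j (K s) t) x)"
      using that by (intro continuous_intros d_continuous Kc) auto
    then show ?thesis
      by (rule continuous_on_cong[THEN iffD1, rotated -1]) (use N1[OF _ that] in auto)
  qed
  have c2: "continuous_on ({a..b} \<times> {a..b} - Id) (\<lambda>(t, s). dt {a..b} j R t s)" if "j \<le> n" for j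
  proof -
    have "continuous_on ({a..b} \<times> {a..b} - Id) (\<lambda>x. (\<lambda>(t, s). d j t s) x + c * (\<lambda>(t, s). nderiv {a..b} j (K s) t) x)"
      using that by (intro continuous_intros d_continuous_off continuous_on_subset[OF Kc]) auto
    then show ?thesis
    proof (rule continuous_on_cong[THEN iffD1, rotated -1])
      fix x assume "x \<in> {a..b} \<times> {a..b} - Id"
      moreover obtain t s where "x = (t, s)" by (cases x)
      ultimately have "x = (t, s)" "s \<in> {a..b}" "t \<in> {a..b} - {s}" by auto
      then show "(\<lambda>(t, s). d j t s) x + c * (\<lambda>(t, s). nderiv {a..b} j (K s) t) x
          = (\<lambda>(t, s). dt {a..b} j R t s) x"
        using N2[of s j t] that by simp
    qed simp
  qed
  have k1: "kernel_C_on {a..b} (n - 2) ({a..b} \<times> {a..b}) R"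
    unfolding kernel_C_on_def
  proof (intro conjI allI impI c1)
    fix j assume "j < n - 2"
    then show "\<forall>(t, s)\<in>{a..b} \<times> {a..b}. (\<lambda>r. dt {a..b} j R r s) differentiable (at t within {a..b})"
      using C1 by (auto simp: C_on_def dt_def)
  qed
  have k2: "kernel_C_on {a..b} n ({a..b} \<times> {a..b} - Id) R"
    unfolding kernel_C_on_def
  proof (intro conjI allI impI c2)
    fix j assume "j < n"
    then have df: "(\<lambda>r. dt {a..b} j R r s) differentiable (at t within {a..b})" if "t \<in> {a..b}" "s \<in> {a..b}" "t \<noteq> s" for t s
      using C2[OF that(2)] that by (auto simp: C_on_def dt_def)
    show "\<forall>(t, s)\<in>{a..b} \<times> {a..b} - Id. (\<lambda>r. dt {a..b} j R r s) differentiable (at t within {a..b})"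
    proof (intro ballI)
      fix x assume "x \<in> {a..b} \<times> {a..b} - Id"
      with df show "case x of (t, s) \<Rightarrow> (\<lambda>r. dt {a..b} j R r s) differentiable (at t within {a..b})"
        by (cases x) auto
    qed
  qed
  have sec: "green_section p (M - c) s (\<lambda>t. R t s)" if s: "s \<in> {a<..<b}" for s
  proof -
    have s': "s \<in> {a..b}" using s by auto
    show ?thesis unfolding Req[OF s']
    proof (rule green_section_add[OF s section_green[OF s] KC[OF s']])
      show "B_op p i (K s) = 0" if "i \<in> {1..n}" for i
        unfolding K_def by (rule solution_B[OF Rs[OF s'] that])
      fix t assume t: "t \<in> {a..b} - {s}"
      then have "T_op p (M - c) (K s) t = R t s - c * K s t"
        using solution_T[OF Rs[OF s'], of t] T_op_shift[of "M - c" "K s" t M] by (simp add: K_def)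
      moreover have "R t s = g t s + c * K s t" unfolding K_def by (rule eq[OF s'])
      ultimately show "(M - c - M) * g t s + c * T_op p (M - c) (K s) t = 0" by (simp add: algebra_simps)
    qed
  qed
  have uni: "v t = R t s" if s: "s \<in> {a<..<b}" and v: "green_section p (M - c) s v" and t: "t \<in> {a..b}" for s v t
  proof -
    have s': "s \<in> {a..b}" using s by auto
    have vc: "continuous_on {a..b} v"
      using v C_on_continuous[of "{a..b}" "n - 2" "{a..b}" v 0] by (auto simp: green_section_def intv)
    have "green_section p M s (\<lambda>t. v t + (- c) * kint a b g v t)"
      by (rule green_section_add[OF s v solution_C[OF vc]])
         (use solution_B[OF vc] solution_T[OF vc] in auto)
    then have v_eq: "v t = g t s + c * kint a b g v t" if "t \<in> {a..b}" for t
      using section_unique[OF s _ that] by fastforce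
    have "v t + (-1) * R t s = 0"
    proof (rule inj[OF _ _ t])
      show "continuous_on {a..b} (\<lambda>t. v t + (-1) * R t s)"
        by (intro continuous_intros vc Rs s')
      fix t assume t: "t \<in> {a..b}"
      show "v t + (-1) * R t s = c * kint a b g (\<lambda>t. v t + (-1) * R t s) t"
        unfolding kint_lincomb[OF g_bkernel vc Rs[OF s'] t] using v_eq[OF t] eq[OF s', of t]
        by (simp add: algebra_simps)
    qed
    then show ?thesis by simp
  qed
  have lims: "\<exists>hp hm. ((\<lambda>r. dt {a..b} (n - 1) R r t) \<longlongrightarrow> hp) (at_right t) \<and> ((\<lambda>r. dt {a..b} (n - 1) R t r) \<longlongrightarrow> hp) (at_left t) \<and>
      ((\<lambda>r. dt {a..b} (n - 1) R r t) \<longlongrightarrow> hm) (at_left t) \<and> ((\<lambda>r. dt {a..b} (n - 1) R t r) \<longlongrightarrow> hm) (at_right t) \<and> hp - hm = 1"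
    if t: "t \<in> {a<..<b}" for t
  proof -
    obtain hp hm where h: "((\<lambda>r. d (n - 1) r t) \<longlongrightarrow> hp) (at_right t)" "((\<lambda>r. d (n - 1) t r) \<longlongrightarrow> hp) (at_left t)"
      "((\<lambda>r. d (n - 1) r t) \<longlongrightarrow> hm) (at_left t)" "((\<lambda>r. d (n - 1) t r) \<longlongrightarrow> hm) (at_right t)" "hp - hm = 1"
    proof -
      have "\<forall>t\<in>{a<..<b}. \<exists>hp hm. ((\<lambda>r. d (n - 1) r t) \<longlongrightarrow> hp) (at_right t) \<and> ((\<lambda>r. d (n - 1) t r) \<longlongrightarrow> hp) (at_left t) \<and>
          ((\<lambda>r. d (n - 1) r t) \<longlongrightarrow> hm) (at_left t) \<and> ((\<lambda>r. d (n - 1) t r) \<longlongrightarrow> hm) (at_right t) \<and> hp - hm = 1"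
        using is_green unfolding is_green_def Let_def intv by blast
      then show ?thesis using that t by blast
    qed
    \<comment> \<open>Joint continuity of this term makes all four lateral limits shift by the same
      number \<open>c * ?k t t\<close>, which leaves the jump at 1.\<close>
    let ?k = "\<lambda>t s. nderiv {a..b} (n - 1) (K s) t"
    have kc: "continuous_on {a..b} (\<lambda>r. ?k r t)" "continuous_on {a..b} (\<lambda>r. ?k t r)"
      using continuous_on_section[OF Kc[of "n - 1"]] t by auto
    note l = continuous_on_Icc_tendsto[OF kc(1) t] continuous_on_Icc_tendsto[OF kc(2) t]
    have e1: "d (n - 1) r t + c * ?k r t = dt {a..b} (n - 1) R r t" 
      "d (n - 1) t r + c * ?k t r = dt {a..b} (n - 1) R t r" if "r \<in> {a..b} - {t}" for r
      using N2[of t "n - 1" r] N2[of r "n - 1" t] that t by auto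
    note ev = eventually_mono[OF eventually_Icc_minus(1)[OF t] e1(1)] eventually_mono[OF eventually_Icc_minus(1)[OF t] e1(2)]
      eventually_mono[OF eventually_Icc_minus(2)[OF t] e1(1)] eventually_mono[OF eventually_Icc_minus(2)[OF t] e1(2)]
    show ?thesis
    proof (intro exI conjI)
      show "((\<lambda>r. dt {a..b} (n - 1) R r t) \<longlongrightarrow> hp + c * ?k t t) (at_right t)"
        by (rule Lim_transform_eventually[OF _ ev(3)]) (intro tendsto_intros h l)
      show "((\<lambda>r. dt {a..b} (n - 1) R t r) \<longlongrightarrow> hp + c * ?k t t) (at_left t)"
        by (rule Lim_transform_eventually[OF _ ev(2)]) (intro tendsto_intros h l)
      show "((\<lambda>r. dt {a..b} (n - 1) R r t) \<longlongrightarrow> hm + c * ?k t t) (at_left t)"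
        by (rule Lim_transform_eventually[OF _ ev(1)]) (intro tendsto_intros h l)
      show "((\<lambda>r. dt {a..b} (n - 1) R t r) \<longlongrightarrow> hm + c * ?k t t) (at_right t)"
        by (rule Lim_transform_eventually[OF _ ev(4)]) (intro tendsto_intros h l)
    qed (use h in simp)
  qed
  show ?thesis
    unfolding is_green_def intv Let_def
    by (intro conjI ballI allI impI k1 k2 lims) (use sec uni in auto)
qed

lemma green_perturbation:
  assumes C: "\<And>t s. t \<in> {a..b} \<Longrightarrow> s \<in> {a..b} \<Longrightarrow> \<bar>g t s\<bar> \<le> C" and small: "\<bar>M - N\<bar> * (b - a) * C \<le> 1 / 2"
  obtains R where "is_green p N R"
    "N \<le> M \<and> (\<forall>t\<in>{a..b}. \<forall>s\<in>{a..b}. g t s \<ge> 0) \<longrightarrow> (\<forall>t\<in>{a..b}. \<forall>s\<in>{a..b}. R t s \<ge> 0)"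
proof -
  obtain R where R: "continuous_on ({a..b} \<times> {a..b}) (\<lambda>(t, s). R t s)"
    "\<forall>s\<in>{a..b}. \<forall>t. R t s = g t s + (M - N) * kint a b g (\<lambda>r. R r s) t"
    "M - N \<ge> 0 \<and> (\<forall>t\<in>{a..b}. \<forall>s\<in>{a..b}. g t s \<ge> 0) \<longrightarrow> (\<forall>t\<in>{a..b}. \<forall>s\<in>{a..b}. R t s \<ge> 0)"
    by (rule neumann_solution[OF lend_less_rend g_continuous C small])
  have "is_green p (M - (M - N)) R"
  proof (rule is_green_resolvent[OF R(1)])
    show "R t s = g t s + (M - N) * kint a b g (\<lambda>r. R r s) t" if "s \<in> {a..b}" for t s
      using R(2) that by blast
  qed (rule kint_fixpoint_zero[OF lend_less_rend g_continuous C small])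
  with that[of R] R(3) show ?thesis by simp
qed

end

section \<open>The resolvent identity and its consequences\<close>

context regular_bvp
begin

text \<open>For interior \<open>s\<close>,
  \<open>g t s + (M - N) * kint a b h (\<lambda>r. g r s) t\<close> is, as a function of
  \<open>t\<close>, a section for \<open>N\<close>, hence equals \<open>h t s\<close>. Continuity in
  \<open>s\<close> gives the end points. The distance of \<open>M\<close> and \<open>N\<close> is
  arbitrary.\<close>

lemma resolvent_identity:
  assumes G: "is_green p M g" and H: "is_green p N h" and t: "t \<in> {a..b}" and s: "s \<in> {a..b}"
  shows "g t s = h t s + (N - M) * kint a b h (\<lambda>r. g r s) t"
proof -
  interpret G: green_kernel p M g by unfold_locales (rule G)
  interpret H: green_kernel p N h by unfold_locales (rule H)
  have gs: "continuous_on {a..b} (\<lambda>r. g r s)" if "s \<in> {a..b}" for s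
    using continuous_on_section(2)[OF G.g_continuous that] .
  have inner: "g t s = h t s + (N - M) * kint a b h (\<lambda>r. g r s) t" if s: "s \<in> {a<..<b}" for s
  proof -
    have s': "s \<in> {a..b}" using s by auto
    have "green_section p N s (\<lambda>t. g t s + (M - N) * kint a b h (\<lambda>r. g r s) t)"
      by (rule green_section_add[OF s G.section_green[OF s] H.solution_C[OF gs[OF s']]])
         (use H.solution_B[OF gs[OF s']] H.solution_T[OF gs[OF s']] in \<open>auto simp: algebra_simps\<close>)
    from H.section_unique[OF s this t] show ?thesis by (simp add: algebra_simps)
  qed
  show ?thesis
  proof (rule continuous_eq_on_Icc[OF lend_less_rend _ _ inner s])
    show "continuous_on {a..b} (g t)"
      using continuous_on_section(1)[OF G.g_continuous t] .
    show "continuous_on {a..b} (\<lambda>s. h t s + (N - M) * kint a b h (\<lambda>r. g r s) t)"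
      using continuous_on_section(1)[OF H.g_continuous t]
        continuous_on_section(1)[OF kint_jointly_continuous[OF H.g_bkernel G.g_continuous] t]
      by (intro continuous_intros)
  qed
qed

lemma resolvent_identity_dt:
  assumes G: "is_green p M g" and H: "is_green p N h" and l: "l < n" and ts: "(t, s) \<in> dt_dom p l"
  shows "dt {a..b} l g t s = dt {a..b} l h t s + (N - M) * kint a b (dt {a..b} l h) (\<lambda>r. g r s) t"
proof -
  interpret G: green_kernel p M g by unfold_locales (rule G)
  interpret H: green_kernel p N h by unfold_locales (rule H)
  note ab = lend_less_rend
  have t: "t \<in> {a..b}" and s: "s \<in> {a..b}" using ts by (auto simp: dt_dom_def intv)
  have gs: "continuous_on {a..b} (\<lambda>r. g r s)"
    using continuous_on_section(2)[OF G.g_continuous s] .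
  note K = H.solution_C[OF gs]
  let ?w = "\<lambda>t. h t s + (N - M) * kint a b h (\<lambda>r. g r s) t"
  have "nderiv {a..b} l (\<lambda>r. g r s) t = nderiv {a..b} l ?w t"
    by (rule nderiv_cong_on[OF ab _ _ t]) (use resolvent_identity[OF G H _ s] in auto)
  \<comment> \<open>On the diagonal \<open>dt_dom\<close> admits orders up to \<open>n - 2\<close>
    only, which are smooth on the whole interval; off the diagonal the order may be
    \<open>n - 1\<close>.\<close>
  also have "\<dots> = nderiv {a..b} l (\<lambda>r. h r s) t + (N - M) * nderiv {a..b} l (kint a b h (\<lambda>r. g r s)) t"
  proof (cases "t = s")
    case True
    then have l': "l \<le> n - 2" using ts l by (auto simp: dt_dom_def)
    have "C_on {a..b} (n - 2) {a..b} (kint a b h (\<lambda>r. g r s))" by (rule C_on_mono[OF K]) auto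
    from nderiv_lincomb[OF ab _ H.section_C(1)[OF s] this l' t] show ?thesis by simp
  next
    case False
    have "C_on {a..b} n ({a..b} - {s}) (kint a b h (\<lambda>r. g r s))" by (rule C_on_mono[OF K]) auto
    from nderiv_lincomb[OF ab openin_Icc_minus H.section_C(2)[OF s] this] l t False show ?thesis by simp
  qed
  finally show ?thesis
    using H.solution_nderiv[OF gs l t] by (simp add: dt_def)
qed

text \<open>At a maximum point of \<open>\<bar>g\<bar>\<close> the integral term is at most half of
  that maximum and can be absorbed. This bounds the kernels of all parameters near \<open>N\<close>
  by means of the kernel at \<open>N\<close> alone.\<close>

lemma resolvent_bound:
  assumes G: "is_green p M g" and H: "is_green p N h"
    and C: "\<And>t s. t \<in> {a..b} \<Longrightarrow> s \<in> {a..b} \<Longrightarrow> \<bar>h t s\<bar> \<le> C" and small: "\<bar>N - M\<bar> * (b - a) * C \<le> 1 / 2"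
    and t: "t \<in> {a..b}" and s: "s \<in> {a..b}"
  shows "\<bar>g t s\<bar> \<le> 2 * C"
proof -
  interpret G: green_kernel p M g by unfold_locales (rule G)
  interpret H: green_kernel p N h by unfold_locales (rule H)
  note ab = lend_less_rend
  have C0: "C \<ge> 0" using C[of a a] ab by auto
  let ?Q = "{a..b} \<times> {a..b}"
  have "continuous_on ?Q (\<lambda>x. \<bar>(\<lambda>(t, s). g t s) x\<bar>)" by (intro continuous_intros G.g_continuous)
  moreover have "compact ?Q" "?Q \<noteq> {}" using ab by (auto intro: compact_Times)
  ultimately have "\<exists>x\<in>?Q. \<forall>y\<in>?Q. \<bar>(\<lambda>(t, s). g t s) y\<bar> \<le> \<bar>(\<lambda>(t, s). g t s) x\<bar>"
    by (intro continuous_attains_sup)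
  then obtain x where x: "x \<in> ?Q" "\<forall>y\<in>?Q. \<bar>(\<lambda>(t, s). g t s) y\<bar> \<le> \<bar>(\<lambda>(t, s). g t s) x\<bar>" ..
  obtain t0 s0 where ts0: "x = (t0, s0)" by (cases x)
  have t0: "t0 \<in> {a..b}" "s0 \<in> {a..b}" using x ts0 by auto
  have mx: "\<bar>g t s\<bar> \<le> \<bar>g t0 s0\<bar>" if "t \<in> {a..b}" "s \<in> {a..b}" for t s
    using x(2) that unfolding ts0 by fastforce
  have "\<bar>(N - M) * kint a b h (\<lambda>r. g r s0) t0\<bar> \<le> \<bar>N - M\<bar> * ((b - a) * C * \<bar>g t0 s0\<bar>)"
    unfolding abs_mult
    using t0 ab C C0 mx continuous_on_section(2)[OF G.g_continuous t0(2)]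
    by (intro mult_left_mono kint_bound H.g_bkernel) auto
  also have "\<dots> = (\<bar>N - M\<bar> * (b - a) * C) * \<bar>g t0 s0\<bar>" by simp
  also have "\<dots> \<le> (1 / 2) * \<bar>g t0 s0\<bar>" by (intro mult_right_mono small) auto
  finally have "\<bar>g t0 s0\<bar> \<le> 2 * C"
    using resolvent_identity[OF G H t0] C[OF t0] by linarith
  then show ?thesis using mx[OF t s] by linarith
qed

lemma green_unique:
  assumes "is_green p M g" "is_green p M h" "t \<in> {a..b}" "s \<in> {a..b}"
  shows "g t s = h t s"
  using resolvent_identity[OF assms] by simp

end

section \<open>The structure of the sets of parameters\<close>

lemma AE_continuous_le:
  fixes f h :: "real \<Rightarrow> real"
  assumes ab: "a < b" and f: "continuous_on {a..b} f" and h: "continuous_on {a..b} h"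
    and ae: "AE x in lebesgue. x \<in> {a<..<b} \<longrightarrow> f x \<le> h x" and x: "x \<in> {a..b}"
  shows "f x \<le> h x"
proof -
  let ?C = "{x \<in> {a..b}. f x \<le> h x}"
  have C: "closed ?C" by (rule continuous_on_closed_Collect_le[OF f h closed_atLeastAtMost])
  have "AE x\<in>{a<..<b} in lebesgue. x \<in> ?C"
    using ae by eventually_elim auto
  then have "{a<..<b} \<subseteq> ?C"
    using mem_closed_if_AE_lebesgue_open[OF open_greaterThanLessThan C] by blast
  then have "closure {a<..<b} \<subseteq> ?C" using C by (rule closure_minimal)
  then show ?thesis using x ab by auto
qed

text \<open>Packs the lower estimate of the condition into a monotone functional \<open>L\<close>,
  strictly positive on nonzero nonnegative functions, with \<open>\<phi> t * L v\<close> below the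
  integral operator. Later arguments use only these properties and no measure theory.\<close>

lemma cond_Pg_lower_bound:
  assumes Pg: "cond_Pg p g" and ab: "lend p < rend p"
    and g: "continuous_on ({lend p..rend p} \<times> {lend p..rend p}) (\<lambda>(t, s). g t s)"
  obtains \<phi> and L :: "(real \<Rightarrow> real) \<Rightarrow> real" where
    "continuous_on {lend p..rend p} \<phi>" "\<forall>t\<in>{lend p<..<rend p}. \<phi> t > 0" "\<forall>t\<in>{lend p..rend p}. \<phi> t \<ge> 0"
    "\<forall>t\<in>{lend p..rend p}. \<forall>s\<in>{lend p..rend p}. g t s \<ge> 0"
    "\<forall>v t. continuous_on {lend p..rend p} v \<longrightarrow> (\<forall>s\<in>{lend p..rend p}. v s \<ge> 0) \<longrightarrow> t \<in> {lend p..rend p} \<longrightarrow>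
        \<phi> t * L v \<le> kint (lend p) (rend p) g v t"
    "\<forall>v t. continuous_on {lend p..rend p} v \<longrightarrow> (\<forall>s\<in>{lend p..rend p}. v s \<ge> 0) \<longrightarrow> t \<in> {lend p..rend p} \<longrightarrow>
        v t > 0 \<longrightarrow> L v > 0"
    "\<forall>v w c. continuous_on {lend p..rend p} v \<longrightarrow> continuous_on {lend p..rend p} w \<longrightarrow>
        (\<forall>s\<in>{lend p..rend p}. c * w s \<le> v s) \<longrightarrow> c * L w \<le> L v"
proof -
  define a b where "a = lend p" and "b = rend p"
  note ab = ab[folded a_def b_def] and g = g[folded a_def b_def]
  have I: "intv p = {a..b}" by (simp add: intv_def a_def b_def)
  obtain \<phi> k1 k2 where \<phi>: "continuous_on {a..b} \<phi>" "\<forall>t\<in>{a<..<b}. \<phi> t > 0"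
    and k1: "k1 absolutely_integrable_on {a..b}"
    and k1pos: "AE s in lebesgue. s \<in> {a..b} \<longrightarrow> 0 < k1 s \<and> k1 s < k2 s"
    and lower: "AE (t, s) in lebesgue. (t, s) \<in> {a..b} \<times> {a..b} \<longrightarrow> \<phi> t * k1 s \<le> g t s \<and> g t s \<le> \<phi> t * k2 s"
    using Pg unfolding cond_Pg_def I a_def[symmetric] b_def[symmetric] by blast
  define L where "L v = (LINT r:{a<..<b}|lebesgue. k1 r * v r)" for v
  \<comment> \<open>Positivity is given in the open interval; by continuity it survives as
    nonnegativity at the end points.\<close>
  have \<phi>0: "\<phi> t \<ge> 0" if "t \<in> {a..b}" for t
    by (rule AE_continuous_le[OF ab continuous_on_const \<phi>(1) _ that]) (use \<phi>(2) in \<open>auto intro!: AE_I2 intro: less_imp_le\<close>)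
  have k1': "set_integrable lebesgue {a<..<b} k1"
    by (rule set_integrable_subset[OF k1]) auto
  have kv: "set_integrable lebesgue {a<..<b} (\<lambda>r. k1 r * v r)" if v: "continuous_on {a..b} v" for v
  proof -
    obtain C where C: "C \<ge> 0" "\<And>x. x \<in> {a..b} \<Longrightarrow> \<bar>v x\<bar> \<le> C" using continuous_on_Icc_bounded[OF v] by blast
    have m: "(\<lambda>x. indicator {a<..<b} x *\<^sub>R v x) \<in> borel_measurable lebesgue"
    proof -
      have "(\<lambda>x. indicator {a<..<b} x *\<^sub>R v x) \<in> borel_measurable borel"
        by (intro borel_measurable_continuous_on_indicator continuous_on_subset[OF v]) auto
      then show ?thesis by (simp add: measurable_completion)
    qed
    have m1: "(\<lambda>x. indicator {a<..<b} x *\<^sub>R k1 x) \<in> borel_measurable lebesgue"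
      using k1' by (auto simp: set_integrable_def)
    have eq: "indicator {a<..<b} x *\<^sub>R (k1 x * v x) = (indicator {a<..<b} x *\<^sub>R k1 x) * (indicator {a<..<b} x *\<^sub>R v x)" for x
      by (simp add: indicator_def)
    show ?thesis unfolding set_integrable_def
    proof (rule Bochner_Integration.integrable_bound[where f = "\<lambda>x. C * (indicator {a<..<b} x *\<^sub>R k1 x)"])
      show "integrable lebesgue (\<lambda>x. C * (indicator {a<..<b} x *\<^sub>R k1 x))"
        using k1' unfolding set_integrable_def by (intro integrable_mult_right) auto
      show "(\<lambda>x. indicator {a<..<b} x *\<^sub>R (k1 x * v x)) \<in> borel_measurable lebesgue"
        unfolding eq by (intro borel_measurable_times m m1)
      show "AE x in lebesgue. norm (indicator {a<..<b} x *\<^sub>R (k1 x * v x)) \<le> norm (C * (indicator {a<..<b} x *\<^sub>R k1 x))"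
      proof (rule AE_I2)
        fix x
        have "\<bar>k1 x\<bar> * \<bar>v x\<bar> \<le> \<bar>k1 x\<bar> * C" if "x \<in> {a<..<b}"
          using C(2)[of x] that by (intro mult_left_mono) auto
        then show "norm (indicator {a<..<b} x *\<^sub>R (k1 x * v x)) \<le> norm (C * (indicator {a<..<b} x *\<^sub>R k1 x))"
          using C(1) by (auto simp: indicator_def abs_mult mult.commute)
      qed
    qed
  qed
  \<comment> \<open>Fubini splits the null set in the plane into null sets of sections. Continuity
    in each variable then removes the exceptional points one variable at a time.\<close>
  have sections: "AE t in lebesgue. AE s in lebesgue. t \<in> {a..b} \<longrightarrow> s \<in> {a..b} \<longrightarrow> \<phi> t * k1 s \<le> g t s"
  proof -
    have "AE x in lborel. case x of (t, s) \<Rightarrow> (t, s) \<in> {a..b} \<times> {a..b} \<longrightarrow> \<phi> t * k1 s \<le> g t s \<and> g t s \<le> \<phi> t * k2 s"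
      using lower by (simp add: AE_completion_iff)
    then have "AE x in lborel \<Otimes>\<^sub>M lborel. case x of (t, s) \<Rightarrow> (t, s) \<in> {a..b} \<times> {a..b} \<longrightarrow> \<phi> t * k1 s \<le> g t s \<and> g t s \<le> \<phi> t * k2 s"
      unfolding lborel_prod .
    from lborel_pair.AE_pair[OF this]
    have "AE t in lborel. AE s in lborel. t \<in> {a..b} \<longrightarrow> s \<in> {a..b} \<longrightarrow> \<phi> t * k1 s \<le> g t s"
      by (auto elim!: eventually_mono)
    then show ?thesis by (simp add: AE_completion_iff)
  qed
  have gs: "continuous_on {a..b} (g t)" "continuous_on {a..b} (\<lambda>t. g t s)" if "t \<in> {a..b}" "s \<in> {a..b}" for t s
    using continuous_on_section[OF g] that by auto
  have pos: "g t s \<ge> 0" if ts: "t \<in> {a..b}" "s \<in> {a..b}" for t s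
  proof (rule AE_continuous_le[OF ab continuous_on_const gs(2)[OF ts] _ ts(1)])
    show "AE t in lebesgue. t \<in> {a<..<b} \<longrightarrow> 0 \<le> g t s"
      using sections
    proof eventually_elim
      fix t assume ae: "AE s in lebesgue. t \<in> {a..b} \<longrightarrow> s \<in> {a..b} \<longrightarrow> \<phi> t * k1 s \<le> g t s"
      show "t \<in> {a<..<b} \<longrightarrow> 0 \<le> g t s"
      proof
        assume t: "t \<in> {a<..<b}"
        then have t': "t \<in> {a..b}" by auto
        show "0 \<le> g t s"
        proof (rule AE_continuous_le[OF ab continuous_on_const gs(1)[OF t' ts(2)] _ ts(2)])
          show "AE s in lebesgue. s \<in> {a<..<b} \<longrightarrow> 0 \<le> g t s"
            using ae k1pos
          proof eventually_elim
            case (elim s)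
            show ?case
            proof
              assume "s \<in> {a<..<b}"
              then have "\<phi> t * k1 s \<le> g t s" "0 < k1 s" using elim t' by auto
              moreover have "0 \<le> \<phi> t * k1 s" using \<phi>0[OF t'] \<open>0 < k1 s\<close> by simp
              ultimately show "0 \<le> g t s" by linarith
            qed
          qed
        qed
      qed
    qed
  qed
  have low: "\<phi> t * L v \<le> kint a b g v t"
    if v: "continuous_on {a..b} v" and v0: "\<forall>s\<in>{a..b}. v s \<ge> 0" and t: "t \<in> {a..b}" for v t
  proof (rule AE_continuous_le[OF ab _ _ _ t])
    show "continuous_on {a..b} (\<lambda>t. \<phi> t * L v)" using \<phi>(1) by (intro continuous_intros)
    show "continuous_on {a..b} (kint a b g v)"
      by (rule kint_continuous[OF bkernelI_continuous[OF g] v])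
    show "AE t in lebesgue. t \<in> {a<..<b} \<longrightarrow> \<phi> t * L v \<le> kint a b g v t"
      using sections
    proof eventually_elim
      fix t assume ae: "AE s in lebesgue. t \<in> {a..b} \<longrightarrow> s \<in> {a..b} \<longrightarrow> \<phi> t * k1 s \<le> g t s"
      show "t \<in> {a<..<b} \<longrightarrow> \<phi> t * L v \<le> kint a b g v t"
      proof
        assume "t \<in> {a<..<b}"
        then have t: "t \<in> {a..b}" by auto
        have int: "set_integrable lborel {a<..<b} (\<lambda>r. g t r * v r)"
          by (rule kint_integrable[OF bkernelI_continuous[OF g] v t])
        then have int': "set_integrable lebesgue {a<..<b} (\<lambda>r. g t r * v r)"
          and eq: "kint a b g v t = (LINT r:{a<..<b}|lebesgue. g t r * v r)"
          unfolding set_integrable_def kint_def set_lebesgue_integral_def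
          by (auto simp: integrable_completion integral_completion)
        have "\<phi> t * L v = (LINT r:{a<..<b}|lebesgue. \<phi> t * (k1 r * v r))"
          by (simp add: L_def)
        also have "\<dots> \<le> (LINT r:{a<..<b}|lebesgue. g t r * v r)"
        proof (rule set_integral_mono_AE[OF _ int'])
          show "set_integrable lebesgue {a<..<b} (\<lambda>r. \<phi> t * (k1 r * v r))"
            using kv[OF v] by (intro set_integrable_mult_right)
          show "AE r\<in>{a<..<b} in lebesgue. \<phi> t * (k1 r * v r) \<le> g t r * v r"
            using ae
          proof eventually_elim
            case (elim r)
            show ?case
            proof
              assume r: "r \<in> {a<..<b}"
              then have "(\<phi> t * k1 r) * v r \<le> g t r * v r"
                using elim t v0 by (intro mult_right_mono) auto
              then show "\<phi> t * (k1 r * v r) \<le> g t r * v r" by simp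
            qed
          qed
        qed
        finally show "\<phi> t * L v \<le> kint a b g v t" by (simp add: eq)
      qed
    qed
  qed
  have Lpos: "L v > 0"
    if v: "continuous_on {a..b} v" and v0: "\<forall>s\<in>{a..b}. v s \<ge> 0" and t: "t \<in> {a..b}" "v t > 0" for v t
  proof -
    have nn: "AE r in lebesgue. 0 \<le> indicator {a<..<b} r *\<^sub>R (k1 r * v r)"
      using k1pos by eventually_elim (use v0 in \<open>auto simp: indicator_def\<close>)
    have int: "integrable lebesgue (\<lambda>r. indicator {a<..<b} r *\<^sub>R (k1 r * v r))"
      using kv[OF v] by (simp add: set_integrable_def)
    have "L v \<noteq> 0"
    proof
      assume "L v = 0"
      then have "AE r in lebesgue. indicator {a<..<b} r *\<^sub>R (k1 r * v r) = 0"
        using integral_nonneg_eq_0_iff_AE[OF int nn] by (simp add: L_def set_lebesgue_integral_def)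
      then have "AE r in lebesgue. r \<in> {a<..<b} \<longrightarrow> v r \<le> 0"
        using k1pos by eventually_elim (auto simp: indicator_def)
      from AE_continuous_le[OF ab v continuous_on_const this t(1)] t(2) show False by simp
    qed
    moreover have "L v \<ge> 0"
      unfolding L_def set_lebesgue_integral_def by (rule integral_nonneg_AE[OF nn])
    ultimately show ?thesis by simp
  qed
  have Lmono: "c * L w \<le> L v"
    if v: "continuous_on {a..b} v" and w: "continuous_on {a..b} w" and le: "\<forall>s\<in>{a..b}. c * w s \<le> v s" for v w c
  proof -
    have "c * L w = (LINT r:{a<..<b}|lebesgue. c * (k1 r * w r))"
      by (simp add: L_def)
    also have "\<dots> \<le> L v" unfolding L_def
    proof (rule set_integral_mono_AE[OF _ kv[OF v]])
      show "set_integrable lebesgue {a<..<b} (\<lambda>r. c * (k1 r * w r))"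
        using kv[OF w] by (intro set_integrable_mult_right)
      show "AE r\<in>{a<..<b} in lebesgue. c * (k1 r * w r) \<le> k1 r * v r"
        using k1pos
      proof eventually_elim
        case (elim r)
        show ?case
        proof
          assume r: "r \<in> {a<..<b}"
          then have "k1 r * (c * w r) \<le> k1 r * v r"
            using elim le by (intro mult_left_mono) auto
          then show "c * (k1 r * w r) \<le> k1 r * v r" by (simp add: mult_ac)
        qed
      qed
    qed
    finally show ?thesis .
  qed
  show ?thesis
    by (rule that[of \<phi> L, folded a_def b_def]) (use \<phi> \<phi>0 pos low Lpos Lmono in blast)+
qed

context green_kernel
begin

text \<open>If the derivative of order \<open>l\<close> vanishes off the diagonal, so does that of
  order \<open>n - 1\<close>; both its lateral limits at \<open>s\<close> are then 0, against the
  unit jump.\<close>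

lemma d_not_zero:
  assumes s: "s \<in> {a<..<b}" and l: "l < n" and z: "\<And>t. t \<in> {a..b} - {s} \<Longrightarrow> d l t s = 0"
  shows False
proof -
  obtain hp hm where h: "((\<lambda>r. d (n - 1) r s) \<longlongrightarrow> hp) (at_right s)" "((\<lambda>r. d (n - 1) r s) \<longlongrightarrow> hm) (at_left s)"
     "hp - hm = 1"
    using d_jump[of "n - 1" s] s order_ge2 by auto
  have z': "0 = d (n - 1) t s" if "t \<in> {a..b} - {s}" for t
    unfolding dt_def
    by (rule nderiv_zero_on[OF lend_less_rend openin_Icc_minus _ that, symmetric])
       (use z l in \<open>auto simp: dt_def\<close>)
  have "((\<lambda>r. d (n - 1) r s) \<longlongrightarrow> 0) (at_right s)"
    by (rule Lim_transform_eventually[OF tendsto_const eventually_mono[OF eventually_Icc_minus(2)[OF s] z']])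
  moreover have "((\<lambda>r. d (n - 1) r s) \<longlongrightarrow> 0) (at_left s)"
    by (rule Lim_transform_eventually[OF tendsto_const eventually_mono[OF eventually_Icc_minus(1)[OF s] z']])
  ultimately have "hp = 0" "hm = 0"
    using h tendsto_unique[OF trivial_limit_at_right_real] tendsto_unique[OF trivial_limit_at_left_real] by blast+
  then show False using h by simp
qed

end

section \<open>Sign sets and the interval structure of \<open>Pset p 0\<close>\<close>

context regular_bvp
begin

lemma is_green_green: "green_exists p M \<Longrightarrow> is_green p M (green p M)"
  unfolding green_exists_def green_def by (rule someI_ex[of "is_green p M"])

lemma green_kernel_green: "green_exists p M \<Longrightarrow> green_kernel p M (green p M)"
  by unfold_locales (rule is_green_green)

lemma dt_dom_0: "dt_dom p 0 = {a..b} \<times> {a..b}"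
  using order_ge2 by (auto simp: dt_dom_def intv)

lemma Pset_0: "M \<in> Pset p 0 \<longleftrightarrow> green_exists p M \<and> (\<forall>t\<in>{a..b}. \<forall>s\<in>{a..b}. green p M t s \<ge> 0)"
  by (auto simp: Pset_def dt_dom_0 dt_def)

lemma Pset_green_exists: "M \<in> Pset p l \<Longrightarrow> green_exists p M"
  by (simp add: Pset_def)

lemma green_step:
  assumes N: "green_exists p N" and C: "\<And>t s. t \<in> {a..b} \<Longrightarrow> s \<in> {a..b} \<Longrightarrow> \<bar>green p N t s\<bar> \<le> C"
    and small: "\<bar>N - M\<bar> * (b - a) * C \<le> 1 / 2"
  shows "green_exists p M" and "M \<le> N \<Longrightarrow> N \<in> Pset p 0 \<Longrightarrow> M \<in> Pset p 0"
proof -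
  interpret green_kernel p N "green p N" by (rule green_kernel_green[OF N])
  obtain R where R: "is_green p M R"
    "M \<le> N \<and> (\<forall>t\<in>{a..b}. \<forall>s\<in>{a..b}. green p N t s \<ge> 0) \<longrightarrow> (\<forall>t\<in>{a..b}. \<forall>s\<in>{a..b}. R t s \<ge> 0)"
    by (rule green_perturbation[OF C small])
  show M: "green_exists p M" using R(1) by (auto simp: green_exists_def)
  assume "M \<le> N" "N \<in> Pset p 0"
  then have "\<forall>t\<in>{a..b}. \<forall>s\<in>{a..b}. R t s \<ge> 0" using R(2) by (simp add: Pset_0)
  then show "M \<in> Pset p 0"
    using M green_unique[OF R(1) is_green_green[OF M]] by (simp add: Pset_0)
qed

text \<open>The factor \<open>e\<close> is 1 for \<open>Pset\<close> and -1 for \<open>Nset\<close>,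
  so that both halves of the claim have one proof.\<close>

definition signset :: "real \<Rightarrow> nat \<Rightarrow> real set" where
  "signset e l = {M. green_exists p M \<and> (\<forall>(t, s)\<in>dt_dom p l. 0 \<le> e * dt {a..b} l (green p M) t s)}"

lemma Pset_signset: "Pset p l = signset 1 l" and Nset_signset: "Nset p l = signset (-1) l"
  by (auto simp: Pset_def Nset_def signset_def intv)

text \<open>Only the signs of the kernel at \<open>M\<close> and of the derivative at
  \<open>N\<close> enter the resolvent identity, so \<open>N\<close> may lie outside
  \<open>Pset p 0\<close>.\<close>

lemma signset_antimono:
  assumes M: "M \<in> Pset p 0" and N: "N \<in> signset e l" and "M \<le> N" and l: "l < n" and ts: "(t, s) \<in> dt_dom p l"
  shows "e * dt {a..b} l (green p N) t s \<le> e * dt {a..b} l (green p M) t s"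
proof -
  have gM: "green_exists p M" and gN: "green_exists p N" using M N by (auto simp: Pset_def signset_def)
  interpret M: green_kernel p M "green p M" by (rule green_kernel_green[OF gM])
  interpret N: green_kernel p N "green p N" by (rule green_kernel_green[OF gN])
  have t: "t \<in> {a..b}" and s: "s \<in> {a..b}" using ts by (auto simp: dt_dom_def intv)
  have c: "continuous_on {a..b} (\<lambda>r. e * green p M r s)"
    using continuous_on_section(2)[OF M.g_continuous s] by (intro continuous_intros)
  have "0 \<le> kint a b (N.d l) (\<lambda>r. e * green p M r s) t"
  proof (rule kint_nonneg[OF N.d_bkernel c t])
    fix r assume r: "r \<in> {a<..<b}" "r \<noteq> t"
    then have "(t, r) \<in> dt_dom p l" using t by (auto simp: dt_dom_def intv)
    then have "0 \<le> e * N.d l t r" using N by (auto simp: signset_def)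
    moreover have "0 \<le> green p M r s" using M r s by (auto simp: Pset_0)
    ultimately have "0 \<le> (e * N.d l t r) * green p M r s" by simp
    then show "0 \<le> N.d l t r * (e * green p M r s)" by (simp add: mult_ac)
  qed (use l in simp)
  then have "0 \<le> (N - M) * (e * kint a b (N.d l) (\<lambda>r. green p M r s) t)"
    using \<open>M \<le> N\<close> by (simp add: kint_cmult)
  moreover have "e * M.d l t s = e * N.d l t s + (N - M) * (e * kint a b (N.d l) (\<lambda>r. green p M r s) t)"
    unfolding resolvent_identity_dt[OF M.is_green N.is_green l ts] by (simp add: algebra_simps)
  ultimately show ?thesis by linarith
qed

lemma signset_downward:
  assumes M: "M \<in> Pset p 0" and N: "N \<in> signset e l" and "M \<le> N" and l: "l < n"
  shows "M \<in> signset e l"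
proof -
  have "0 \<le> e * dt {a..b} l (green p M) t s" if "(t, s) \<in> dt_dom p l" for t s
  proof -
    have "0 \<le> e * dt {a..b} l (green p N) t s" using N that by (auto simp: signset_def)
    with signset_antimono[OF assms that] show ?thesis by linarith
  qed
  then show ?thesis using M by (auto simp: signset_def Pset_def)
qed

lemma green_antimono:
  assumes "M \<in> Pset p 0" "N \<in> Pset p 0" "M \<le> N" "t \<in> {a..b}" "s \<in> {a..b}"
  shows "green p N t s \<le> green p M t s"
  using signset_antimono[of M N 1 0 t s] assms order_ge2 by (simp add: Pset_signset dt_dom_0 dt_def)

lemma green_bounded:
  assumes "green_exists p M"
  obtains C where "C > 0" "\<And>t s. t \<in> {a..b} \<Longrightarrow> s \<in> {a..b} \<Longrightarrow> \<bar>green p M t s\<bar> \<le> C"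
  using bounded_continuous_on_square[OF green_kernel.g_continuous[OF green_kernel_green[OF assms]]] by blast

text \<open>Descend from \<open>N\<close> in steps of length \<open>\<delta>\<close>. Every
  parameter met lies to the right of \<open>M\<close>, where the kernel is dominated by the one at
  \<open>M\<close>; hence \<open>C\<close> stays valid, the steps do not shrink, and finitely many
  reach \<open>L\<close>.\<close>

lemma Pset_0_convex:
  assumes M: "M \<in> Pset p 0" and N: "N \<in> Pset p 0" and L: "M \<le> L" "L \<le> N"
  shows "L \<in> Pset p 0"
proof -
  obtain C where C: "C > 0" "\<And>t s. t \<in> {a..b} \<Longrightarrow> s \<in> {a..b} \<Longrightarrow> \<bar>green p M t s\<bar> \<le> C"
    using green_bounded[OF Pset_green_exists[OF M]] by blast
  define \<delta> where "\<delta> = 1 / (2 * (b - a) * C)"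
  have \<delta>: "\<delta> > 0" "\<delta> * (b - a) * C = 1 / 2" using C lend_less_rend by (auto simp: \<delta>_def field_simps)
  have *: "L \<in> Pset p 0" if "N - real k * \<delta> \<le> L" "M \<le> L" "L \<le> N" for k L
    using that
  proof (induction k arbitrary: L)
    case 0
    then show ?case using N by simp
  next
    case (Suc k)
    \<comment> \<open>The previous stop of the descent: at most \<open>\<delta>\<close> above
      \<open>L\<close>, but never beyond \<open>N\<close>.\<close>
    define L' where "L' = min N (L + \<delta>)"
    have L': "L' \<in> Pset p 0" using Suc \<delta> unfolding L'_def by (intro Suc.IH) (auto simp: algebra_simps)
    have LL: "L \<le> L'" "L' - L \<le> \<delta>" "M \<le> L'" using Suc.prems \<delta> by (auto simp: L'_def)
    have "\<bar>green p L' t s\<bar> \<le> C" if "t \<in> {a..b}" "s \<in> {a..b}" for t s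
      using green_antimono[OF M L' LL(3) that] C(2)[OF that] L' that by (auto simp: Pset_0)
    moreover have "\<bar>L' - L\<bar> * (b - a) * C \<le> 1 / 2"
    proof -
      have "\<bar>L' - L\<bar> * (b - a) * C \<le> \<delta> * (b - a) * C"
        using LL C lend_less_rend by (intro mult_right_mono) auto
      then show ?thesis using \<delta> by simp
    qed
    ultimately show ?case
      using green_step(2)[of L' C L] L' LL(1) by (auto simp: Pset_0)
  qed
  obtain k :: nat where "(N - L) / \<delta> \<le> real k" using real_arch_simple by blast
  then have "N - real k * \<delta> \<le> L" using \<delta> by (simp add: field_simps)
  then show ?thesis using * L by blast
qed

text \<open>A downward step has a nonnegative factor \<open>N - M\<close> in the Neumann series, so
  it preserves nonnegativity.\<close>

lemma Pset_0_left_open: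
  assumes N: "N \<in> Pset p 0"
  obtains M where "M < N" "M \<in> Pset p 0"
proof -
  obtain C where C: "C > 0" "\<And>t s. t \<in> {a..b} \<Longrightarrow> s \<in> {a..b} \<Longrightarrow> \<bar>green p N t s\<bar> \<le> C"
    using green_bounded[OF Pset_green_exists[OF N]] by blast
  define \<delta> where "\<delta> = 1 / (2 * (b - a) * C)"
  have \<delta>: "\<delta> > 0" "\<delta> * (b - a) * C = 1 / 2" using C lend_less_rend by (auto simp: \<delta>_def field_simps)
  have "N - \<delta> \<in> Pset p 0"
    using green_step(2)[of N C "N - \<delta>"] C \<delta> N by (auto simp: Pset_0)
  then show ?thesis using that[of "N - \<delta>"] \<delta> by simp
qed

text \<open>Once a Green's function exists at \<open>N\<close>, the resolvent identity makes the
  derivatives for nearby parameters differ from those at \<open>N\<close> by a multiple of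
  \<open>\<bar>N - M\<bar>\<close>, so a strictly wrong sign at \<open>N\<close> would persist
  nearby.\<close>

lemma signset_closed:
  assumes N: "green_exists p N" and l: "l < n"
    and lim: "\<And>\<delta>. \<delta> > 0 \<Longrightarrow> \<exists>M. \<bar>N - M\<bar> < \<delta> \<and> M \<in> signset e l"
  shows "N \<in> signset e l"
proof -
  interpret N: green_kernel p N "green p N" by (rule green_kernel_green[OF N])
  obtain C where C: "C > 0" "\<And>t s. t \<in> {a..b} \<Longrightarrow> s \<in> {a..b} \<Longrightarrow> \<bar>green p N t s\<bar> \<le> C"
    using green_bounded[OF N] by blast
  obtain D where D: "D \<ge> 0" "\<And>t s. t \<in> {a..b} \<Longrightarrow> s \<in> {a<..<b} \<Longrightarrow> t \<noteq> s \<Longrightarrow> \<bar>N.d l t s\<bar> \<le> D"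
    using bkernel_bound[OF N.d_bkernel[of l]] l by auto
  define \<delta>0 where "\<delta>0 = 1 / (2 * (b - a) * C)"
  have \<delta>0: "\<delta>0 > 0" "\<delta>0 * (b - a) * C = 1 / 2" using C lend_less_rend by (auto simp: \<delta>0_def field_simps)
  have "0 \<le> e * N.d l t s" if ts: "(t, s) \<in> dt_dom p l" for t s
  proof (rule ccontr)
    have t: "t \<in> {a..b}" and s: "s \<in> {a..b}" using ts by (auto simp: dt_dom_def intv)
    assume neg: "\<not> 0 \<le> e * N.d l t s"
    \<comment> \<open>Bounds \<open>\<bar>e\<bar>\<close> times the integral in the resolvent
      identity, with \<open>2 * C\<close> from \<open>resolvent_bound\<close>; adding 1 makes it
      safe to divide by.\<close>
    define B where "B = \<bar>e\<bar> * ((b - a) * D * (2 * C)) + 1"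
    have B: "B > 0" unfolding B_def using C D lend_less_rend by (intro add_nonneg_pos mult_nonneg_nonneg) auto
    \<comment> \<open>\<open>\<delta>0\<close> makes \<open>resolvent_bound\<close> applicable; the
      other term keeps the perturbation smaller than the wrong-signed value.\<close>
    define \<delta> where "\<delta> = min \<delta>0 (- (e * N.d l t s) / B)"
    have "\<delta> > 0" using \<delta>0 B neg by (auto simp: \<delta>_def divide_less_0_iff)
    then obtain M where M: "\<bar>N - M\<bar> < \<delta>" "M \<in> signset e l" using lim by blast
    then have gM: "green_exists p M" by (auto simp: signset_def)
    interpret M: green_kernel p M "green p M" by (rule green_kernel_green[OF gM])
    have "\<bar>N - M\<bar> * (b - a) * C \<le> \<delta>0 * (b - a) * C"
      using M(1) C lend_less_rend by (intro mult_right_mono) (auto simp: \<delta>_def)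
    then have "\<bar>green p M r s\<bar> \<le> 2 * C" if "r \<in> {a..b}" for r
      using resolvent_bound[OF M.is_green N.is_green C(2) _ that s] \<delta>0(2) by simp
    then have "\<bar>kint a b (N.d l) (\<lambda>r. green p M r s) t\<bar> \<le> (b - a) * D * (2 * C)"
      using continuous_on_section(2)[OF M.g_continuous s] l lend_less_rend D t
      by (intro kint_bound N.d_bkernel) auto
    then have "\<bar>e\<bar> * \<bar>kint a b (N.d l) (\<lambda>r. green p M r s) t\<bar> \<le> B"
      unfolding B_def using mult_left_mono[of _ _ "\<bar>e\<bar>"] by fastforce
    then have "\<bar>N - M\<bar> * (\<bar>e\<bar> * \<bar>kint a b (N.d l) (\<lambda>r. green p M r s) t\<bar>) \<le> \<bar>N - M\<bar> * B"
      by (intro mult_left_mono) auto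
    also have "\<dots> < \<delta> * B" using M(1) B by simp
    also have "\<dots> \<le> - (e * N.d l t s)"
    proof -
      have "\<delta> \<le> - (e * N.d l t s) / B" by (simp add: \<delta>_def)
      then show ?thesis using B by (simp only: pos_le_divide_eq)
    qed
    finally have "\<bar>e * ((N - M) * kint a b (N.d l) (\<lambda>r. green p M r s) t)\<bar> < - (e * N.d l t s)"
      by (simp add: abs_mult mult_ac)
    moreover have "0 \<le> e * M.d l t s" using M(2) ts by (auto simp: signset_def)
    moreover have "e * M.d l t s = e * N.d l t s + e * ((N - M) * kint a b (N.d l) (\<lambda>r. green p M r s) t)"
      unfolding resolvent_identity_dt[OF M.is_green N.is_green l ts] by (simp add: algebra_simps)
    ultimately show False by linarith
  qed
  then show ?thesis using N by (auto simp: signset_def)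
qed

text \<open>Existence at the supremum is the point: members to the right of a fixed \<open>M\<close>
  have kernels below \<open>C\<close>, so a member close enough to the supremum reaches it by one
  perturbation step. The sign then follows from \<open>signset_closed\<close>.\<close>

lemma Pset_0_right_closed:
  assumes ne: "Pset p 0 \<noteq> {}" and bdd: "bdd_above (Pset p 0)"
  shows "Sup (Pset p 0) \<in> Pset p 0"
proof -
  obtain M where M: "M \<in> Pset p 0" using ne by blast
  let ?S = "Sup (Pset p 0)"
  have near: "\<exists>N. \<bar>?S - N\<bar> < \<delta> \<and> M \<le> N \<and> N \<in> Pset p 0" if d: "\<delta> > 0" for \<delta>
  proof -
    obtain N where N: "N \<in> Pset p 0" "?S - \<delta> < N"
      using less_cSupD[OF ne, of "?S - \<delta>"] d by auto
    have "max M N \<in> Pset p 0" using M N by (simp add: max_def)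
    moreover have "max M N \<le> ?S" using calculation bdd by (intro cSup_upper)
    ultimately show ?thesis using N d by (intro exI[of _ "max M N"]) auto
  qed
  obtain C where C: "C > 0" "\<And>t s. t \<in> {a..b} \<Longrightarrow> s \<in> {a..b} \<Longrightarrow> \<bar>green p M t s\<bar> \<le> C"
    using green_bounded[OF Pset_green_exists[OF M]] by blast
  define \<delta> where "\<delta> = 1 / (2 * (b - a) * C)"
  have \<delta>: "\<delta> > 0" "\<delta> * (b - a) * C = 1 / 2" using C lend_less_rend by (auto simp: \<delta>_def field_simps)
  obtain N where N: "\<bar>?S - N\<bar> < \<delta>" "M \<le> N" "N \<in> Pset p 0" using near[OF \<delta>(1)] by blast
  have "\<bar>green p N t s\<bar> \<le> C" if "t \<in> {a..b}" "s \<in> {a..b}" for t s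
    using green_antimono[OF M N(3,2) that] C(2)[OF that] N that by (auto simp: Pset_0)
  moreover have "\<bar>N - ?S\<bar> * (b - a) * C \<le> 1 / 2"
  proof -
    have "\<bar>N - ?S\<bar> * (b - a) * C \<le> \<delta> * (b - a) * C"
      using N C lend_less_rend by (intro mult_right_mono) auto
    then show ?thesis using \<delta> by simp
  qed
  ultimately have "green_exists p ?S"
    using green_step(1)[of N C ?S] N(3) by (auto simp: Pset_0)
  then show ?thesis
    using signset_closed[of ?S 0 1] near order_ge2 unfolding Pset_signset by fastforce
qed

lemma Pset_0_interval:
  assumes ne: "Pset p 0 \<noteq> {}" and bdd: "bdd_below (Pset p 0)"
  shows "if bdd_above (Pset p 0) then \<exists>M1. Pset p 0 = {Inf (Pset p 0)<..M1} else Pset p 0 = {Inf (Pset p 0)<..}"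
proof -
  let ?m = "Inf (Pset p 0)"
  have low: "?m < M" if M: "M \<in> Pset p 0" for M
  proof -
    obtain N where "N < M" "N \<in> Pset p 0" by (rule Pset_0_left_open[OF M])
    moreover from this have "?m \<le> N" using bdd by (intro cInf_lower)
    ultimately show ?thesis by simp
  qed
  have mid: "L \<in> Pset p 0" if L: "?m < L" "L \<le> N" "N \<in> Pset p 0" for L N
  proof -
    obtain M where "M \<in> Pset p 0" "M < L" using cInf_lessD[OF ne L(1)] by blast
    then show ?thesis using Pset_0_convex L by (meson less_imp_le)
  qed
  show ?thesis
  proof (cases "bdd_above (Pset p 0)")
    case True
    have "Pset p 0 = {?m<..Sup (Pset p 0)}"
      using low mid[OF _ _ Pset_0_right_closed[OF ne True]] cSup_upper[OF _ True] by fastforce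
    then show ?thesis using True by auto
  next
    case False
    have "L \<in> Pset p 0" if L: "?m < L" for L
    proof -
      obtain N where "N \<in> Pset p 0" "L < N" using False unfolding bdd_above_def by (meson not_le)
      then show ?thesis using mid L by (meson less_imp_le)
    qed
    then have "Pset p 0 = {?m<..}" using low by auto
    then show ?thesis using False by simp
  qed
qed

end

section \<open>The critical parameter\<close>

text \<open>The integrand is nonnegative and vanishes almost everywhere; it is continuous on a small
  interval around \<open>s\<close> that avoids the diagonal point \<open>t\<close>.\<close>

lemma kint_zero_imp_zero:
  assumes G: "bkernel a b G" and u: "continuous_on {a..b} u" and t: "t \<in> {a..b}"
    and nn: "\<And>s. s \<in> {a<..<b} \<Longrightarrow> s \<noteq> t \<Longrightarrow> 0 \<le> G t s * u s" and z: "kint a b G u t = 0"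
    and s: "s \<in> {a<..<b}" "s \<noteq> t"
  shows "G t s * u s = 0"
proof -
  let ?U = "{a<..<b} - {t}"
  have "open ?U" by (auto intro: open_delete)
  then obtain e where e: "e > 0" "cball s e \<subseteq> ?U" using s by (meson DiffI open_contains_cball singletonD)
  have sub: "{s - e..s + e} \<subseteq> ?U" using e(2) by (simp add: cball_eq_atLeastAtMost)
  have ne: "AE r in lborel. r \<notin> {t}"
    by (rule AE_not_in[OF countable_imp_null_set_lborel]) auto
  have nonneg: "AE r in lborel. 0 \<le> indicator {a<..<b} r *\<^sub>R (G t r * u r)"
    using ne by eventually_elim (use nn in \<open>auto simp: indicator_def\<close>)
  have int: "integrable lborel (\<lambda>r. indicator {a<..<b} r *\<^sub>R (G t r * u r))"
    using kint_integrable[OF G u t] by (simp add: set_integrable_def)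
  have "AE r in lborel. indicator {a<..<b} r *\<^sub>R (G t r * u r) = 0"
    using z integral_nonneg_eq_0_iff_AE[OF int nonneg] by (simp add: kint_def set_lebesgue_integral_def)
  then have "AE r in lborel. r \<in> {s - e<..<s + e} \<longrightarrow> G t r * u r \<le> 0"
  proof eventually_elim
    case (elim r)
    show ?case
    proof
      assume "r \<in> {s - e<..<s + e}"
      then have "r \<in> {s - e..s + e}" by auto
      then have "r \<in> {a<..<b}" using sub by blast
      then show "G t r * u r \<le> 0" using elim by auto
    qed
  qed
  then have ae: "AE r in lebesgue. r \<in> {s - e<..<s + e} \<longrightarrow> G t r * u r \<le> 0"
    by (simp add: AE_completion_iff)
  have "continuous_on ?U (\<lambda>r. G t r * u r)"
    by (intro continuous_intros bkernel_section G t continuous_on_subset[OF u]) auto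
  then have cont: "continuous_on {s - e..s + e} (\<lambda>r. G t r * u r)" using sub by (rule continuous_on_subset)
  have "G t s * u s \<le> 0"
    by (rule AE_continuous_le[OF _ cont continuous_on_const ae]) (use e in auto)
  then show ?thesis using nn[OF s] by simp
qed

section \<open>The lower end of \<open>Pset p 0\<close> and the eigenfunction there\<close>

context regular_bvp
begin

text \<open>For a member \<open>M < Mb\<close>, a section \<open>v\<close> of its kernel satisfies
  \<open>v \<ge> (Mb - M) * L v * \<phi>\<close> by the resolvent identity and the lower estimate.
  Applying \<open>L\<close> and cancelling \<open>L v > 0\<close> gives
  \<open>(Mb - M) * L \<phi> \<le> 1\<close>.\<close>

lemma Pset_0_bdd_below:
  assumes g: "green_exists p Mb" and Pg: "cond_Pg p (green p Mb)"
  shows "bdd_below (Pset p 0)"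
proof -
  interpret G: green_kernel p Mb "green p Mb" by (rule green_kernel_green[OF g])
  note ab = lend_less_rend
  obtain \<phi> L where \<phi>: "continuous_on {a..b} \<phi>" "\<forall>t\<in>{a<..<b}. \<phi> t > 0" "\<forall>t\<in>{a..b}. \<phi> t \<ge> 0"
    and gpos: "\<forall>t\<in>{a..b}. \<forall>s\<in>{a..b}. green p Mb t s \<ge> 0"
    and low: "\<forall>v t. continuous_on {a..b} v \<longrightarrow> (\<forall>s\<in>{a..b}. v s \<ge> 0) \<longrightarrow> t \<in> {a..b} \<longrightarrow> \<phi> t * L v \<le> kint a b (green p Mb) v t"
    and Lpos: "\<forall>v t. continuous_on {a..b} v \<longrightarrow> (\<forall>s\<in>{a..b}. v s \<ge> 0) \<longrightarrow> t \<in> {a..b} \<longrightarrow> v t > 0 \<longrightarrow> L v > 0"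
    and Lmono: "\<forall>v w c. continuous_on {a..b} v \<longrightarrow> continuous_on {a..b} w \<longrightarrow> (\<forall>s\<in>{a..b}. c * w s \<le> v s) \<longrightarrow> c * L w \<le> L v"
    by (rule cond_Pg_lower_bound[OF Pg ab G.g_continuous])
  define m where "m = (a + b) / 2"
  have m: "m \<in> {a<..<b}" "m \<in> {a..b}" using ab by (auto simp: m_def)
  have L\<phi>: "L \<phi> > 0" using Lpos \<phi> m by blast
  have "Mb - 1 / L \<phi> \<le> M" if M: "M \<in> Pset p 0" for M
  proof (cases "M < Mb")
    case True
    interpret M: green_kernel p M "green p M" by (rule green_kernel_green[OF Pset_green_exists[OF M]])
    define v where "v = (\<lambda>t. green p M t m)"
    have vc: "continuous_on {a..b} v" unfolding v_def using continuous_on_section(2)[OF M.g_continuous m(2)] .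
    have v0: "\<forall>s\<in>{a..b}. v s \<ge> 0" using M m by (auto simp: v_def Pset_0)
    have "\<exists>t\<in>{a..b}. v t > 0"
    proof (rule ccontr)
      assume "\<not> ?thesis"
      then have "v t = 0" if "t \<in> {a..b}" for t using v0 that by force
      then show False using M.d_not_zero[OF m(1), of 0] order_ge2 by (auto simp: v_def M.d_0)
    qed
    then have Lv: "L v > 0" using Lpos vc v0 by blast
    have "(Mb - M) * L v * \<phi> t \<le> v t" if t: "t \<in> {a..b}" for t
    proof -
      have "v t = green p Mb t m + (Mb - M) * kint a b (green p Mb) v t"
        unfolding v_def by (rule resolvent_identity[OF M.is_green G.is_green t m(2)])
      moreover have "(Mb - M) * (\<phi> t * L v) \<le> (Mb - M) * kint a b (green p Mb) v t"
        using low vc v0 t True by (intro mult_left_mono) auto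
      ultimately show ?thesis using gpos t m(2) by (simp add: mult_ac add_increasing)
    qed
    then have "(Mb - M) * L v * L \<phi> \<le> L v" using Lmono vc \<phi>(1) by blast
    then have "((Mb - M) * L \<phi>) * L v \<le> 1 * L v" by (simp only: mult_ac mult_1)
    then have "(Mb - M) * L \<phi> \<le> 1" using Lv by (rule mult_right_le_imp_le)
    then have "Mb - M \<le> 1 / L \<phi>" using L\<phi> by (simp add: pos_le_divide_eq)
    then show ?thesis by simp
  next
    case False
    moreover have "1 / L \<phi> > 0" using L\<phi> by simp
    ultimately show ?thesis by linarith
  qed
  then show ?thesis by (rule bdd_belowI)
qed

text \<open>The Green's functions blow up as \<open>M\<close> decreases to the infimum of \<open>P\<^sub>0\<close>; their normalised
  sections subconverge to an eigenfunction by Arzela-Ascoli.\<close>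

lemma critical_fixpoint:
  assumes Mb: "Mb \<in> Pset p 0" and M0: "M0 \<notin> Pset p 0" and int: "{M0<..Mb} \<subseteq> Pset p 0" and "M0 < Mb"
  obtains w t where "continuous_on {a..b} w" "\<And>s. s \<in> {a..b} \<Longrightarrow> w s \<ge> 0" "t \<in> {a..b}" "w t > 0"
    "\<And>s. s \<in> {a..b} \<Longrightarrow> w s = (Mb - M0) * kint a b (green p Mb) w s"
proof -
  note ab = lend_less_rend
  let ?Q = "{a..b} \<times> {a..b}"
  let ?g = "green p Mb"
  interpret G: green_kernel p Mb ?g by (rule green_kernel_green[OF Pset_green_exists[OF Mb]])
  define \<mu> where "\<mu> = Mb - M0"
  have \<mu>: "\<mu> > 0" using \<open>M0 < Mb\<close> by (simp add: \<mu>_def)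
  \<comment> \<open>Decreases to \<open>M0\<close> from \<open>N 0 = Mb\<close>.\<close>
  define N where "N k = M0 + \<mu> / real (Suc k)" for k
  have N: "N k \<in> Pset p 0" for k
  proof -
    have "\<mu> / real (Suc k) \<le> \<mu>" "\<mu> / real (Suc k) > 0" using \<mu> by (auto simp: field_simps)
    then have "N k \<in> {M0<..Mb}" by (auto simp: N_def \<mu>_def)
    then show ?thesis using int by blast
  qed
  obtain C where C: "C > 0" "\<And>t s. t \<in> {a..b} \<Longrightarrow> s \<in> {a..b} \<Longrightarrow> \<bar>?g t s\<bar> \<le> C"
    using green_bounded[OF Pset_green_exists[OF Mb]] by blast
  have "\<exists>x\<in>?Q. \<forall>y\<in>?Q. (\<lambda>(t, s). green p (N k) t s) y \<le> (\<lambda>(t, s). green p (N k) t s) x" for k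
  proof (rule continuous_attains_sup)
    interpret green_kernel p "N k" "green p (N k)" by (rule green_kernel_green[OF Pset_green_exists[OF N]])
    show "continuous_on ?Q (\<lambda>(t, s). green p (N k) t s)" by (rule g_continuous)
  qed (use ab in \<open>auto intro: compact_Times\<close>)
  then obtain x where x: "\<And>k. x k \<in> ?Q" "\<And>k y. y \<in> ?Q \<Longrightarrow> (\<lambda>(t, s). green p (N k) t s) y \<le> (\<lambda>(t, s). green p (N k) t s) (x k)"
    by metis
  define tt ss where "tt k = fst (x k)" and "ss k = snd (x k)" for k
  have ts: "tt k \<in> {a..b}" "ss k \<in> {a..b}" for k using x(1)[of k] by (auto simp: tt_def ss_def mem_Times_iff)
  define c where "c k = green p (N k) (tt k) (ss k)" for k
  have le_c: "green p (N k) t s \<le> c k" if "t \<in> {a..b}" "s \<in> {a..b}" for k t s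
    using x(2)[of "(t, s)" k] that by (simp add: c_def tt_def ss_def case_prod_unfold)
  have nn: "0 \<le> green p (N k) t s" if "t \<in> {a..b}" "s \<in> {a..b}" for k t s
    using N[of k] that by (auto simp: Pset_0)
  \<comment> \<open>Otherwise one Neumann step from \<open>N k\<close> would place \<open>M0\<close>
    in \<open>Pset p 0\<close>. As \<open>N k - M0\<close> is \<open>\<mu> / real (Suc k)\<close>,
    the maxima \<open>c k\<close> grow at least linearly in \<open>k\<close>.\<close>
  have blow: "1 / 2 < (N k - M0) * (b - a) * c k" for k
  proof (rule ccontr)
    assume "\<not> ?thesis"
    moreover have "N k > M0" using \<mu> by (simp add: N_def)
    ultimately have "M0 \<in> Pset p 0"
      using green_step(2)[of "N k" "c k" M0] N[of k] le_c nn Pset_green_exists[OF N] by auto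
    then show False using M0 by simp
  qed
  have c: "c k > 0" for k
  proof (rule ccontr)
    assume "\<not> c k > 0"
    then have "c k = 0" using nn[OF ts(1)[of k] ts(2)[of k], of k] by (simp add: c_def)
    then show False using blow[of k] by simp
  qed
  have c_inv: "1 / c k \<le> 2 * \<mu> * (b - a) / real (Suc k)" for k
    using blow[of k] c[of k] by (simp add: N_def field_simps)
  define u where "u k t = green p (N k) t (ss k) / c k" for k t
  have u01: "0 \<le> u k t" "u k t \<le> 1" if "t \<in> {a..b}" for k t
    using nn[OF that ts(2)[of k], of k] le_c[OF that ts(2)[of k], of k] c[of k] by (auto simp: u_def)
  have utt: "u k (tt k) = 1" for k using c[of k] by (simp add: u_def c_def)
  have uc: "continuous_on {a..b} (u k)" for k
  proof -
    interpret green_kernel p "N k" "green p (N k)" by (rule green_kernel_green[OF Pset_green_exists[OF N]])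
    show ?thesis
      unfolding u_def using continuous_on_section(2)[OF g_continuous ts(2)] c[of k]
      by (intro continuous_intros) auto
  qed
  \<comment> \<open>Compactness is applied to \<open>w k\<close>, which inherits equicontinuity from
    the uniform continuity of the fixed kernel at \<open>Mb\<close>. By \<open>u_eq\<close> and the
    growth of \<open>c k\<close>, \<open>u k\<close> is then close to \<open>\<mu>\<close> times the
    limit of \<open>w k\<close>.\<close>
  define w where "w k = kint a b ?g (u k)" for k
  have u_eq: "u k t = ?g t (ss k) / c k + (Mb - N k) * w k t" if t: "t \<in> {a..b}" for k t
  proof -
    have "green p (N k) t (ss k) = ?g t (ss k) + (Mb - N k) * kint a b ?g (\<lambda>r. green p (N k) r (ss k)) t"
      by (rule resolvent_identity[OF is_green_green[OF Pset_green_exists[OF N]] G.is_green t ts(2)])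
    moreover have "kint a b ?g (\<lambda>r. green p (N k) r (ss k)) t = c k * w k t"
      unfolding w_def kint_cmult[symmetric] using c[of k] by (simp add: u_def)
    ultimately have "u k t = (?g t (ss k) + (Mb - N k) * (c k * w k t)) / c k" by (simp add: u_def)
    then show ?thesis using c[of k] by (simp add: field_simps)
  qed
  have w_bound: "\<bar>w k t\<bar> \<le> (b - a) * C" if "t \<in> {a..b}" for k t
  proof -
    have "\<bar>w k t\<bar> \<le> (b - a) * C * 1"
      unfolding w_def
      by (rule kint_bound[OF G.g_bkernel uc that less_imp_le[OF ab]]) (use C u01 that in auto)
    then show ?thesis by simp
  qed
  have equi: "\<exists>d>0. \<forall>k y. y \<in> {a..b} \<and> norm (x - y) < d \<longrightarrow> norm (w k x - w k y) < e"
    if x: "x \<in> {a..b}" and e: "0 < e" for x e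
  proof -
    define e' where "e' = e / (2 * (b - a))"
    have "e' > 0" "(b - a) * e' = e / 2" using e ab by (auto simp: e'_def field_simps)
    then have e': "e' > 0" "(b - a) * e' < e" using e by auto
    have "uniformly_continuous_on ?Q (\<lambda>(t, s). ?g t s)"
      by (intro compact_uniformly_continuous G.g_continuous compact_Times compact_Icc)
    then obtain d where d: "d > 0" "\<And>y z. y \<in> ?Q \<Longrightarrow> z \<in> ?Q \<Longrightarrow> dist z y < d \<Longrightarrow>
        dist ((\<lambda>(t, s). ?g t s) z) ((\<lambda>(t, s). ?g t s) y) < e'"
      unfolding uniformly_continuous_on_def using e'(1) by metis
    have "norm (w k x - w k y) < e" if y: "y \<in> {a..b}" "norm (x - y) < d" for k y
    proof -
      let ?D = "\<lambda>t s. ?g x s - ?g y s"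
      have cD: "continuous_on ({a..b} \<times> {a..b}) (\<lambda>(t, s). ?D t s)"
        using continuous_on_section(1)[OF G.g_continuous x] continuous_on_section(1)[OF G.g_continuous y(1)]
        by (auto simp: case_prod_unfold intro!: continuous_intros continuous_on_compose2[of "{a..b}" _ _ snd])
      have "w k x - w k y = kint a b ?D (u k) x"
        unfolding w_def kint_def
        by (subst set_integral_diff(2)[symmetric])
           (use kint_integrable[OF G.g_bkernel uc] x y in \<open>auto simp: left_diff_distrib\<close>)
      also have "\<bar>\<dots>\<bar> \<le> (b - a) * e' * 1"
      proof (rule kint_bound[OF bkernelI_continuous[OF cD] uc x])
        fix s assume s: "s \<in> {a<..<b}"
        have "dist (?g x s) (?g y s) < e'"
          using d(2)[of "(y, s)" "(x, s)"] x y s by (auto simp: dist_Pair_Pair dist_norm)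
        then show "\<bar>?g x s - ?g y s\<bar> \<le> e'" by (simp add: dist_norm)
        show "\<bar>u k s\<bar> \<le> 1" using u01[of s k] s by auto
      qed (use ab e' in auto)
      finally show ?thesis using e'(2) by simp
    qed
    then show ?thesis using d(1) by blast
  qed
  obtain h r where h: "continuous_on {a..b} h" and r: "strict_mono (r :: nat \<Rightarrow> nat)"
    and conv: "\<And>e. 0 < e \<Longrightarrow> \<exists>K. \<forall>k t. k \<ge> K \<and> t \<in> {a..b} \<longrightarrow> norm (w (r k) t - h t) < e"
  proof (rule Arzela_Ascoli[of "{a..b}" w "(b - a) * C"])
    show "norm (w k t) \<le> (b - a) * C" if "t \<in> {a..b}" for k t using w_bound[OF that] by simp
  qed (use equi in auto)
  have lim_inv: "(\<lambda>k. 1 / real (Suc (r k))) \<longlonglongrightarrow> 0"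
    using LIMSEQ_subseq_LIMSEQ[OF LIMSEQ_inverse_real_of_nat r]
    by (simp add: o_def inverse_eq_divide)
  have est: "\<bar>u k t - \<mu> * h t\<bar> \<le> (1 / real (Suc k)) * (2 * \<mu> * (b - a) * C + \<mu> * ((b - a) * C)) + \<mu> * \<bar>w k t - h t\<bar>"
    if t: "t \<in> {a..b}" for k t
  proof -
    have "u k t - \<mu> * h t = ?g t (ss k) * (1 / c k) - (\<mu> / real (Suc k)) * w k t + \<mu> * (w k t - h t)"
      unfolding u_eq[OF t] by (simp add: N_def \<mu>_def algebra_simps)
    also have "\<bar>\<dots>\<bar> \<le> \<bar>?g t (ss k) * (1 / c k)\<bar> + \<bar>(\<mu> / real (Suc k)) * w k t\<bar> + \<bar>\<mu> * (w k t - h t)\<bar>"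
      by linarith
    also have "\<bar>?g t (ss k) * (1 / c k)\<bar> \<le> C * (2 * \<mu> * (b - a) / real (Suc k))"
      unfolding abs_mult using C(2)[OF t ts(2)] c_inv[of k] c[of k] C(1) by (intro mult_mono) auto
    also have "\<bar>(\<mu> / real (Suc k)) * w k t\<bar> \<le> (\<mu> / real (Suc k)) * ((b - a) * C)"
      unfolding abs_mult using w_bound[OF t] \<mu> by (intro mult_mono) auto
    also have "\<bar>\<mu> * (w k t - h t)\<bar> = \<mu> * \<bar>w k t - h t\<bar>" using \<mu> by (simp add: abs_mult)
    finally have "\<bar>u k t - \<mu> * h t\<bar> \<le> C * (2 * \<mu> * (b - a) / real (Suc k)) + \<mu> / real (Suc k) * ((b - a) * C) + \<mu> * \<bar>w k t - h t\<bar>"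
      by linarith
    moreover have "C * (2 * \<mu> * (b - a) / q) + \<mu> / q * ((b - a) * C)
        = (1 / q) * (2 * \<mu> * (b - a) * C + \<mu> * ((b - a) * C))" for q
      by (simp add: divide_inverse algebra_simps)
    ultimately show ?thesis by simp
  qed
  have unif: "\<exists>K. \<forall>k t. k \<ge> K \<and> t \<in> {a..b} \<longrightarrow> \<bar>u (r k) t - \<mu> * h t\<bar> < e" if e: "e > 0" for e
  proof -
    let ?B = "2 * \<mu> * (b - a) * C + \<mu> * ((b - a) * C)"
    have "(\<lambda>k. (1 / real (Suc (r k))) * ?B) \<longlonglongrightarrow> 0" using tendsto_mult_left_zero[OF lim_inv] by blast
    from order_tendstoD(2)[OF this, of "e / 2"] e
    obtain K1 where K1: "\<And>k. k \<ge> K1 \<Longrightarrow> (1 / real (Suc (r k))) * ?B < e / 2"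
      by (auto simp: eventually_sequentially)
    obtain K2 where K2: "\<And>k t. k \<ge> K2 \<Longrightarrow> t \<in> {a..b} \<Longrightarrow> norm (w (r k) t - h t) < e / (2 * \<mu>)"
      using conv[of "e / (2 * \<mu>)"] e \<mu> by auto
    have "\<bar>u (r k) t - \<mu> * h t\<bar> < e" if "k \<ge> max K1 K2" "t \<in> {a..b}" for k t
    proof -
      have "\<bar>w (r k) t - h t\<bar> < e / (2 * \<mu>)" using K2[of k t] that by simp
      then have "\<mu> * \<bar>w (r k) t - h t\<bar> < e / 2" using \<mu> by (simp add: field_simps)
      then show ?thesis using est[OF that(2), of "r k"] K1[of k] that by linarith
    qed
    then show ?thesis by blast
  qed
  have ulim: "(\<lambda>k. u (r k) t) \<longlonglongrightarrow> \<mu> * h t" if "t \<in> {a..b}" for t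
    unfolding LIMSEQ_def dist_real_def using unif that by meson
  have wlim: "(\<lambda>k. w (r k) t) \<longlonglongrightarrow> h t" if "t \<in> {a..b}" for t
    unfolding LIMSEQ_def dist_norm using conv that by meson
  have hc: "continuous_on {a..b} (\<lambda>t. \<mu> * h t)" using h by (intro continuous_intros)
  have heq: "h t = kint a b ?g (\<lambda>r. \<mu> * h r) t" if t: "t \<in> {a..b}" for t
  proof -
    have "(\<lambda>k. w (r k) t) \<longlonglongrightarrow> kint a b ?g (\<lambda>r. \<mu> * h r) t"
      unfolding w_def kint_def
    proof (rule LINT_dominated[where X = "{}" and C = "C * 1"])
      show "\<bar>?g t y * u (r k) y\<bar> \<le> C * 1" if "y \<in> {a<..<b} - {}" for k y
        unfolding abs_mult using C(2)[OF t, of y] C(1) u01[of y "r k"] that by (intro mult_mono) auto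
      show "(\<lambda>k. ?g t y * u (r k) y) \<longlonglongrightarrow> ?g t y * (\<mu> * h y)" if "y \<in> {a<..<b} - {}" for y
        using that by (intro tendsto_intros ulim) auto
    qed (use kint_integrable[OF G.g_bkernel _ t] uc hc in auto)
    then show ?thesis using LIMSEQ_unique wlim[OF t] by blast
  qed
  \<comment> \<open>Nontriviality of the limit: \<open>u (r K)\<close> equals 1 at
    \<open>tt (r K)\<close> and is within less than 1 of \<open>\<mu> * h\<close> everywhere, so the
    limit is positive at that point.\<close>
  obtain K where K: "\<And>t. t \<in> {a..b} \<Longrightarrow> \<bar>u (r K) t - \<mu> * h t\<bar> < 1"
    using unif[of 1] by auto
  show ?thesis
  proof (rule that[of "\<lambda>t. \<mu> * h t" "tt (r K)"])
    show "continuous_on {a..b} (\<lambda>t. \<mu> * h t)" by (rule hc)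
    show "\<mu> * h s \<ge> 0" if "s \<in> {a..b}" for s
      by (rule LIMSEQ_le_const[OF ulim[OF that]]) (use u01 that in auto)
    show "\<mu> * h s = (Mb - M0) * kint a b ?g (\<lambda>r. \<mu> * h r) s" if "s \<in> {a..b}" for s
      using heq[OF that] by (simp add: \<mu>_def)
    show "tt (r K) \<in> {a..b}" by (rule ts)
    show "\<mu> * h (tt (r K)) > 0" using K[OF ts(1)] utt[of "r K"] by (smt (verit))
  qed
qed

text \<open>The fixed point becomes positive in the whole open interval by the lower estimate with
  \<open>\<phi>\<close>. The representation holds for each \<open>M\<close> with a Green's function,
  on either side of \<open>M0\<close>, because \<open>u\<close> solves the problem for
  \<open>M\<close> with right-hand side \<open>(M - M0) * u\<close>.\<close>

lemma critical_eigenfunction: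
  assumes g: "green_exists p Mb" and Pg: "cond_Pg p (green p Mb)"
    and Mb: "Mb \<in> Pset p 0" and M0: "M0 \<notin> Pset p 0" and int: "{M0<..Mb} \<subseteq> Pset p 0" and "M0 < Mb"
  obtains u where "continuous_on {a..b} u" "\<And>t. t \<in> {a<..<b} \<Longrightarrow> u t > 0"
    "\<And>M l t. green_exists p M \<Longrightarrow> l < n \<Longrightarrow> t \<in> {a..b} \<Longrightarrow>
       nderiv {a..b} l u t = (M - M0) * kint a b (dt {a..b} l (green p M)) u t"
proof -
  let ?g = "green p Mb"
  interpret G: green_kernel p Mb ?g by (rule green_kernel_green[OF g])
  note ab = lend_less_rend
  obtain w t0 where w: "continuous_on {a..b} w" "\<And>s. s \<in> {a..b} \<Longrightarrow> w s \<ge> 0" "t0 \<in> {a..b}" "w t0 > 0"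
    "\<And>s. s \<in> {a..b} \<Longrightarrow> w s = (Mb - M0) * kint a b ?g w s"
    by (rule critical_fixpoint[OF Mb M0 int \<open>M0 < Mb\<close>]) blast
  obtain \<phi> L where \<phi>: "continuous_on {a..b} \<phi>" "\<forall>t\<in>{a<..<b}. \<phi> t > 0" "\<forall>t\<in>{a..b}. \<phi> t \<ge> 0"
    and gpos: "\<forall>t\<in>{a..b}. \<forall>s\<in>{a..b}. green p Mb t s \<ge> 0"
    and low: "\<forall>v t. continuous_on {a..b} v \<longrightarrow> (\<forall>s\<in>{a..b}. v s \<ge> 0) \<longrightarrow> t \<in> {a..b} \<longrightarrow> \<phi> t * L v \<le> kint a b (green p Mb) v t"
    and Lpos: "\<forall>v t. continuous_on {a..b} v \<longrightarrow> (\<forall>s\<in>{a..b}. v s \<ge> 0) \<longrightarrow> t \<in> {a..b} \<longrightarrow> v t > 0 \<longrightarrow> L v > 0"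
    and Lmono: "\<forall>v w c. continuous_on {a..b} v \<longrightarrow> continuous_on {a..b} w \<longrightarrow> (\<forall>s\<in>{a..b}. c * w s \<le> v s) \<longrightarrow> c * L w \<le> L v"
    by (rule cond_Pg_lower_bound[OF Pg ab G.g_continuous])
  \<comment> \<open>Proportional to \<open>w\<close> on \<open>{a..b}\<close>, but as an image of
    the solution operator it comes with its smoothness, equation and boundary conditions.\<close>
  define u where "u = kint a b ?g w"
  have wu: "w t = (Mb - M0) * u t" if "t \<in> {a..b}" for t using w(5)[OF that] by (simp add: u_def)
  note uC = G.solution_C[OF w(1), folded u_def]
  have uc: "continuous_on {a..b} u" unfolding u_def by (rule kint_continuous[OF G.g_bkernel w(1)])
  show ?thesis
  proof (rule that[of u])
    show "continuous_on {a..b} u" by (rule uc)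
    show "u t > 0" if t: "t \<in> {a<..<b}" for t
    proof -
      have "L w > 0" using Lpos w by blast
      then have "0 < \<phi> t * L w" using \<phi>(2) t by simp
      also have "\<dots> \<le> u t" unfolding u_def using low w t by auto
      finally show ?thesis .
    qed
    fix M l t assume M: "green_exists p M" and l: "l < n" and t: "t \<in> {a..b}"
    interpret M: green_kernel p M "green p M" by (rule green_kernel_green[OF M])
    have c: "continuous_on {a..b} (\<lambda>r. (M - M0) * u r)" using uc by (intro continuous_intros)
    have "u t = kint a b (green p M) (\<lambda>r. (M - M0) * u r) t" if t: "t \<in> {a..b}" for t
    proof (rule M.solution_unique[OF uC c _ _ t])
      \<comment> \<open>The operator for \<open>Mb\<close> maps \<open>u\<close> to
        \<open>w = (Mb - M0) * u\<close>; shifting the parameter adds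
        \<open>(M - Mb) * u\<close>.\<close>
      show "T_op p M u t = (M - M0) * u t" if t: "t \<in> {a..b}" for t
        using G.solution_T[OF w(1) t, folded u_def] wu[OF t] T_op_shift[of M u t Mb]
        by (simp add: algebra_simps)
      show "B_op p i u = 0" if "i \<in> {1..n}" for i
        using G.solution_B[OF w(1) that] by (simp add: u_def)
    qed
    then have "nderiv {a..b} l u t = nderiv {a..b} l (kint a b (green p M) (\<lambda>r. (M - M0) * u r)) t"
      by (intro nderiv_cong_on[OF ab _ _ t]) auto
    also have "\<dots> = (M - M0) * kint a b (M.d l) u t"
      using M.solution_nderiv[OF c l t] by (simp add: kint_cmult)
    finally show "nderiv {a..b} l u t = (M - M0) * kint a b (M.d l) u t" .
  qed
qed

text \<open>The eigenfunction shows that no member lies below \<open>M0\<close>. Members arbitrarily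
  close to \<open>M0\<close> come from \<open>Pset p 0\<close>, whose elements below
  \<open>N\<close> all belong to the sign set.\<close>

lemma signset_conclusion:
  assumes g: "green_exists p Mb" and Pg: "cond_Pg p (green p Mb)"
    and low: "\<And>M. M \<in> Pset p 0 \<Longrightarrow> M0 < M" and int: "\<And>M N. M0 < M \<Longrightarrow> M \<le> N \<Longrightarrow> N \<in> Pset p 0 \<Longrightarrow> M \<in> Pset p 0"
    and Mb: "Mb \<in> Pset p 0" and e: "e \<noteq> 0" and l: "l < n"
    and N: "N \<in> signset e l" "N > M0"
  shows "Inf (ereal ` signset e l) = ereal M0"
proof -
  note ab = lend_less_rend
  have gN: "green_exists p N" using N by (simp add: signset_def)
  interpret N: green_kernel p N "green p N" by (rule green_kernel_green[OF gN])
  obtain u where u: "continuous_on {a..b} u" "\<And>t. t \<in> {a<..<b} \<Longrightarrow> u t > 0"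
    "\<And>M l t. green_exists p M \<Longrightarrow> l < n \<Longrightarrow> t \<in> {a..b} \<Longrightarrow>
       nderiv {a..b} l u t = (M - M0) * kint a b (dt {a..b} l (green p M)) u t"
  proof (rule critical_eigenfunction[OF g Pg Mb])
    show "M0 \<notin> Pset p 0" using low by blast
    show "{M0<..Mb} \<subseteq> Pset p 0" using int Mb by auto
    show "M0 < Mb" by (rule low[OF Mb])
  qed blast
  have nn: "0 \<le> kint a b (dt {a..b} l (green p M)) (\<lambda>r. e * u r) t" 
     "\<And>r. r \<in> {a<..<b} \<Longrightarrow> r \<noteq> t \<Longrightarrow> 0 \<le> dt {a..b} l (green p M) t r * (e * u r)"
    if M: "M \<in> signset e l" and t: "t \<in> {a..b}" for M t
  proof -
    interpret M: green_kernel p M "green p M"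
      by (rule green_kernel_green) (use M in \<open>simp add: signset_def\<close>)
    show p: "0 \<le> M.d l t r * (e * u r)" if r: "r \<in> {a<..<b}" "r \<noteq> t" for r
    proof -
      have "(t, r) \<in> dt_dom p l" using r t by (auto simp: dt_dom_def intv)
      then have "0 \<le> e * M.d l t r" using M by (auto simp: signset_def)
      then have "0 \<le> (e * M.d l t r) * u r" using u(2)[OF r(1)] by simp
      then show ?thesis by (simp add: mult_ac)
    qed
    show "0 \<le> kint a b (M.d l) (\<lambda>r. e * u r) t"
      by (rule kint_nonneg[OF M.d_bkernel _ t p]) (use l u(1) in \<open>auto intro!: continuous_intros\<close>)
  qed
  have lower: "M0 \<le> M" if M: "M \<in> signset e l" for M
  proof (rule ccontr)
    assume "\<not> M0 \<le> M"
    have gM: "green_exists p M" using M by (simp add: signset_def)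
    \<comment> \<open>The same derivative of \<open>u\<close> is represented once with the positive
      factor \<open>N - M0\<close> and once with the negative factor \<open>M - M0\<close>. With
      kernels of equal sign both integrals must vanish.\<close>
    have z: "kint a b (N.d l) (\<lambda>r. e * u r) t = 0" if t: "t \<in> {a..b}" for t
    proof -
      have "(N - M0) * kint a b (N.d l) (\<lambda>r. e * u r) t = (M - M0) * kint a b (dt {a..b} l (green p M)) (\<lambda>r. e * u r) t"
        unfolding kint_cmult using u(3)[OF gN l t] u(3)[OF gM l t] by simp
      also have "\<dots> \<le> 0" using nn(1)[OF M t] \<open>\<not> M0 \<le> M\<close> by (intro mult_nonpos_nonneg) auto
      finally show ?thesis using nn(1)[OF N(1) t] N(2) by (simp add: mult_le_0_iff)
    qed
    define m where "m = (a + b) / 2"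
    have m: "m \<in> {a<..<b}" using ab by (auto simp: m_def)
    have "N.d l t m = 0" if t: "t \<in> {a..b} - {m}" for t
    proof -
      have t': "t \<in> {a..b}" using t by simp
      have "N.d l t m * (e * u m) = 0"
        by (rule kint_zero_imp_zero[OF N.d_bkernel _ t' nn(2)[OF N(1) t'] z[OF t'] m])
           (use l u(1) t in \<open>auto intro!: continuous_intros\<close>)
      then show ?thesis using e u(2)[OF m] by simp
    qed
    then show False using N.d_not_zero[OF m l] by blast
  qed
  show ?thesis
  proof (rule antisym)
    show "ereal M0 \<le> Inf (ereal ` signset e l)"
      by (rule Inf_greatest) (use lower in auto)
    show "Inf (ereal ` signset e l) \<le> ereal M0"
    proof (rule ereal_le_epsilon2)
      fix d :: real assume d: "0 < d"
      \<comment> \<open>Within \<open>d\<close> of \<open>M0\<close>, not above \<open>Mb\<close> so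
        as to lie in \<open>Pset p 0\<close>, and not above \<open>N\<close> for downward
        closedness.\<close>
      define M where "M = min (M0 + d) (min N Mb)"
      have "M0 < M" using d N(2) low[OF Mb] by (simp add: M_def)
      then have "M \<in> Pset p 0" using int[of M Mb] Mb by (simp add: M_def)
      then have "M \<in> signset e l" using signset_downward[OF _ N(1) _ l] by (simp add: M_def)
      then have "Inf (ereal ` signset e l) \<le> ereal M" by (intro Inf_lower) auto
      also have "\<dots> \<le> ereal M0 + ereal d" by (simp add: M_def)
      finally show "Inf (ereal ` signset e l) \<le> ereal M0 + ereal d" .
    qed
  qed
qed

text \<open>The right end of the range may be the supremum of the sign set, whose membership is not
  known beforehand. All smaller parameters above \<open>M0\<close> are members by downward
  closedness, and closedness yields \<open>N\<close> itself.\<close>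

lemma signset_monotone:
  assumes P: "\<And>M. M0 < M \<Longrightarrow> ereal M \<le> Sup (ereal ` Pset p 0) \<Longrightarrow> M \<in> Pset p 0" 
    and l: "l < n" and ts: "(t, s) \<in> dt_dom p l"
    and M: "M \<in> M_range M0 (Pset p 0) (signset e l)" and N: "N \<in> M_range M0 (Pset p 0) (signset e l)" and "M \<le> N"
  shows "e * dt {a..b} l (green p N) t s \<le> e * dt {a..b} l (green p M) t s"
proof -
  have MN: "M \<in> Pset p 0" "N \<in> Pset p 0" "M0 < N" "ereal N \<le> Sup (ereal ` signset e l)"
    using P M N by (auto simp: M_range_def)
  have below: "L \<in> signset e l" if L: "M0 < L" "L < N" for L
  proof -
    have "ereal L < Sup (ereal ` signset e l)" using L(2) MN(4) by (meson ereal_less_eq(3) less_le_trans less_ereal.simps(1))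
    then obtain K where K: "K \<in> signset e l" "L < K" by (auto simp: less_Sup_iff)
    have "ereal L \<le> Sup (ereal ` Pset p 0)"
      using L(2) MN(2) by (intro Sup_upper2[of "ereal N"]) auto
    then have "L \<in> Pset p 0" using P L by blast
    then show ?thesis using signset_downward[OF _ K(1) _ l] K(2) by simp
  qed
  have "N \<in> signset e l"
  proof (rule signset_closed[OF Pset_green_exists[OF MN(2)] l])
    fix \<delta> :: real assume "\<delta> > 0"
    \<comment> \<open>The first entry brings \<open>L\<close> within \<open>\<delta>\<close> of
      \<open>N\<close>, the midpoint keeps it above \<open>M0\<close>.\<close>
    define L where "L = max (N - \<delta> / 2) ((M0 + N) / 2)"
    have L: "L < N" "M0 < L" "N - \<delta> / 2 \<le> L"
      using MN(3) \<open>\<delta> > 0\<close> by (auto simp: L_def less_max_iff_disj)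
    then have "\<bar>N - L\<bar> < \<delta>" using \<open>\<delta> > 0\<close> by linarith
    moreover have "L \<in> signset e l" using below L by blast
    ultimately show "\<exists>M. \<bar>N - M\<bar> < \<delta> \<and> M \<in> signset e l" by blast
  qed
  then show ?thesis using signset_antimono[OF MN(1) _ \<open>M \<le> N\<close> l ts] by blast
qed

end

theorem theorem3p6:
  fixes p :: bvp and Mbar :: real
  assumes "2 \<le> dim_ord p"
    and "lend p < rend p"
    and "\<forall>k\<in>{1..dim_ord p}. continuous_on (intv p) (coef p k)"
    and "green_exists p Mbar"
    and "cond_Pg p (green p Mbar)"
  shows "\<exists>M0 :: real.
    (if bdd_above (Pset p 0) then \<exists>M1. Pset p 0 = {M0<..M1} else Pset p 0 = {M0<..}) \<and>
    (\<forall>l\<in>{1..dim_ord p - 1}.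
       Pset p l \<noteq> {} \<and> (\<exists>M1\<in>Pset p l. M1 > M0) \<longrightarrow>
         Inf (ereal ` Pset p l) = Inf (ereal ` Pset p 0) \<and>
         Inf (ereal ` Pset p 0) = ereal M0 \<and>
         (\<forall>(t, s)\<in>dt_dom p l.
            antimono_on (M_range M0 (Pset p 0) (Pset p l))
              (\<lambda>M. dt (intv p) l (green p M) t s))) \<and>
    (\<forall>l\<in>{1..dim_ord p - 1}.
       Nset p l \<noteq> {} \<and> (\<exists>M1\<in>Nset p l. M1 > M0) \<longrightarrow>
         Inf (ereal ` Nset p l) = Inf (ereal ` Pset p 0) \<and>
         Inf (ereal ` Pset p 0) = ereal M0 \<and>
         (\<forall>(t, s)\<in>dt_dom p l.
            mono_on (M_range M0 (Pset p 0) (Nset p l))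
              (\<lambda>M. dt (intv p) l (green p M) t s)))"
proof -
  interpret regular_bvp p
    by unfold_locales (use assms(1-3) in \<open>auto simp: intv_def\<close>)
  interpret G: green_kernel p Mbar "green p Mbar" by (rule green_kernel_green[OF assms(4)])
  have Mb: "Mbar \<in> Pset p 0"
  proof -
    have "\<forall>t\<in>{a..b}. \<forall>s\<in>{a..b}. green p Mbar t s \<ge> 0"
      by (rule cond_Pg_lower_bound[OF assms(5) lend_less_rend G.g_continuous])
    then show ?thesis using assms(4) by (simp add: Pset_0)
  qed
  \<comment> \<open>A genuine infimum: \<open>Pset p 0\<close> contains \<open>Mbar\<close> and is
    bounded below by the condition on its kernel.\<close>
  define M0 where "M0 = Inf (Pset p 0)"
  have form: "if bdd_above (Pset p 0) then \<exists>M1. Pset p 0 = {M0<..M1} else Pset p 0 = {M0<..}"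
    unfolding M0_def using Pset_0_interval Pset_0_bdd_below[OF assms(4,5)] Mb by blast
  then have cases: "(\<exists>M1. Pset p 0 = {M0<..M1}) \<or> Pset p 0 = {M0<..}" by presburger
  have low: "M0 < M" if "M \<in> Pset p 0" for M
    using cases that by (elim disjE exE) simp_all
  have int: "M \<in> Pset p 0" if "M0 < M" "M \<le> N" "N \<in> Pset p 0" for M N
    using cases that by (elim disjE exE) simp_all
  have sup: "M \<in> Pset p 0" if M: "M0 < M" "ereal M \<le> Sup (ereal ` Pset p 0)" for M
  proof (cases "bdd_above (Pset p 0)")
    case True
    then obtain M1 where M1: "Pset p 0 = {M0<..M1}" using form by auto
    have "Sup (ereal ` Pset p 0) \<le> ereal M1" by (rule Sup_least) (use M1 in auto)
    then have "M \<le> M1" using M(2) order_trans by fastforce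
    then show ?thesis using M1 M by simp
  qed (use form M in simp)
  \<comment> \<open>\<open>Pset p 0\<close> is itself the sign set with \<open>e = 1\<close> and
    \<open>l = 0\<close>, and \<open>Mbar\<close> is a member above \<open>M0\<close>.\<close>
  have inf0: "Inf (ereal ` Pset p 0) = ereal M0"
    unfolding Pset_signset
    by (rule signset_conclusion[OF assms(4,5) low int Mb, where e = 1 and l = 0 and N = Mbar])
       (use Mb low order_ge2 in \<open>auto simp: Pset_signset\<close>)
  have inf: "Inf (ereal ` signset e l) = ereal M0" if "e \<noteq> 0" "l < n" "N \<in> signset e l" "M0 < N" for e l N
    by (rule signset_conclusion[OF assms(4,5) low int Mb that(1-4)])
  have P: "antimono_on (M_range M0 (Pset p 0) (Pset p l)) (\<lambda>M. dt (intv p) l (green p M) t s)"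
    if "l < n" "(t, s) \<in> dt_dom p l" for l t s
    using signset_monotone[OF sup that, where e = 1] by (auto simp: monotone_on_def Pset_signset intv)
  have N: "mono_on (M_range M0 (Pset p 0) (Nset p l)) (\<lambda>M. dt (intv p) l (green p M) t s)"
    if "l < n" "(t, s) \<in> dt_dom p l" for l t s
    using signset_monotone[OF sup that, where e = "-1"] by (auto simp: monotone_on_def Nset_signset intv)
  show ?thesis
  proof (intro exI[of _ M0] conjI ballI impI form)
    fix l assume l: "l \<in> {1..n - 1}"
    then have l': "l < n" using order_ge2 by auto
    {
      assume "Pset p l \<noteq> {} \<and> (\<exists>M1\<in>Pset p l. M1 > M0)"
      then show "Inf (ereal ` Pset p l) = Inf (ereal ` Pset p 0)"
        using inf[of 1 l] l' inf0 by (auto simp: Pset_signset)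
      show "Inf (ereal ` Pset p 0) = ereal M0" by (rule inf0)
      show "case x of (t, s) \<Rightarrow> antimono_on (M_range M0 (Pset p 0) (Pset p l)) (\<lambda>M. dt (intv p) l (green p M) t s)"
        if "x \<in> dt_dom p l" for x
        using P[OF l'] that by (cases x) simp
    }
    {
      assume "Nset p l \<noteq> {} \<and> (\<exists>M1\<in>Nset p l. M1 > M0)"
      then show "Inf (ereal ` Nset p l) = Inf (ereal ` Pset p 0)"
        using inf[of "-1" l] l' inf0 by (auto simp: Nset_signset)
      show "Inf (ereal ` Pset p 0) = ereal M0" by (rule inf0)
      show "case x of (t, s) \<Rightarrow> mono_on (M_range M0 (Pset p 0) (Nset p l)) (\<lambda>M. dt (intv p) l (green p M) t s)"
        if "x \<in> dt_dom p l" for x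
        using N[OF l'] that by (cases x) simp
    }
  qed
qed

end
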